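(* Let $Y_{h,si}$ and $Y_{h,fi}$ be the SVD-based interface spaces with truncation indices $r_i$, and $V_{h,si}$, $V_{h,fi}$, $V_{h,s}$ the corresponding slow and fast spaces. Let $u_{h,\Gamma}(y)$ be the discrete interface solution, $\tilde u_{h,\Gamma}:D\to V_{h,\Gamma}$ the approximate discrete interface solution, $\sigma_1=\max_{i=1,\dots,N-1}\sigma^{(i)}_1$ and $\sigma_{r+1}=\max_{i=1,\dots,N-1}\sigma^{(i)}_{r_i+1}$, where $\{\sigma^{(i)}_k\}$ are the singular values of $(\mathsf R^{(i)}_0)^{-T}\mathsf C^{(i)}_{01}(\mathsf R^{(i)}_1)^{-1}$. Assume that $\sigma_1<1$ and that $\sigma_{r+1}$ is sufficiently small. Then there exists $C$ such that $$\|u_{h,\Gamma}(y)-\tilde u_{h,\Gamma}(y)\|_E\le C\,\sigma_{r+1}\,\|u_{h,\Gamma}(y)\|_E\quad\text{for any } y\in D.$$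
   Context: Geometry: $N$ is the number of layers; $\rho_1,\rho_2:(0,1)\to\mathbb R$ are sufficiently regular functions with $\rho_1(t)<\rho_2(t)$ for all $t\in(0,1)$; $\Omega_1=\{(x_1,x_2): x_1\in(0,1),\ \rho_1(x_1)<x_2<\rho_2(x_1)\}$; $\Omega_{i+1}=\{(x_1,x_2): (2i-x_1,x_2)\in\Omega_i\}$ and $\Gamma_i=\partial\Omega_i\cap\partial\Omega_{i+1}$ for $i=1,\dots,N-1$; $\Omega=\mathrm{int}(\bigcup_{i=1}^N\overline\Omega_i)$. Where the index $i+1=N$ occurs below, $\Gamma_N$ is the part of $\partial\Omega_N$ on the line $x_1=N$. $(\cdot,\cdot)_\omega$ is the $L^2(\omega)$ inner product. $D\subset(m,M)^N$ with $m,M>0$; $f\in L^2(\Omega)$; for $y\in D$, $a(z,v)=\sum_{i=1}^N y_i(\nabla z,\nabla v)_{\Omega_i}$, $\|v\|_E=a(v,v)^{1/2}$. Finite element space: $V_h\subset H^1_0(\Omega)$ is a finite element space, spanned by a basis $\varphi_1,\dots,\varphi_n$, that conforms to the interfaces $\Gamma_i$ and is locally mirror symmetric in the following sense: for each $v_h\in V_h$ and $i=1,\dots,N-1$ there exists $w_h\in V_h$ such that $w_h=v_h$ in $\Omega_i$ and $w_h(i-t,x_2)=w_h(i+t,x_2)$ for any $t,x_2$ with $(i-t,x_2)\in\Omega_i$. Spaces: $V_{h,\Omega_i}=\{v\in V_h: \mathrm{supp}(v)\subset\Omega_i\}$, understood as the functions of $V_h$ vanishing outside $\Omega_i$; $V_{h,\Gamma}=\{v\in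 V_h:(\nabla v,\nabla w)_\Omega=0\ \forall w\in V_{h,\Omega_i},\ i=1,\dots,N\}$. Discrete harmonic extensions: for $g\in V_h|_{\Gamma_i}$, $Z_{h,0i}g$ is the function $w\in V_h|_{\Omega_{i+1}}$ with $w=g$ on $\Gamma_i$, $w=0$ on $\Gamma_{i+1}$ and $(\nabla w,\nabla v)_{\Omega_{i+1}}=0$ for all $v\in V_{h,\Omega_{i+1}}$; for $g\in V_h|_{\Gamma_{i+1}}$, $Z_{h,1i}g$ is the function $w\in V_h|_{\Omega_{i+1}}$ with $w=0$ on $\Gamma_i$, $w=g$ on $\Gamma_{i+1}$ and the same orthogonality. Matrices: write $\vec\alpha\sim g$ if $\vec\alpha$ is the coordinate vector of $g$ in a fixed basis of the trace space containing $g$. For $i=1,\dots,N-1$ and $n,m\in\{0,1\}$ let $\mathsf C^{(i)}_{nm}$ be the matrix with $\vec\alpha^T\mathsf C^{(i)}_{nm}\vec\beta=(\nabla Z_{h,ni}g_{i+n},\nabla Z_{h,mi}g_{i+m})_{\Omega_{i+1}}$ for all $g_{i+n}\in V_h|_{\Gamma_{i+n}}$, $g_{i+m}\in V_h|_{\Gamma_{i+m}}$, $\vec\alpha\sim g_{i+n}$, $\vec\beta\sim g_{i+m}$. Let $\mathsf R^{(i)}_0,\mathsf R^{(i)}_1$ be the Cholesky factors: $\mathsf C^{(i)}_{00}=(\mathsf R^{(i)}_0)^T\mathsf R^{(i)}_0$, $\mathsf C^{(i)}_{11}=(\mathsf R^{(i)}_1)^T\mathsf R^{(i)}_1$. Let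 $\mathsf U^{(i)}\mathsf\Sigma^{(i)}(\mathsf V^{(i)})^T$ be the SVD of $(\mathsf R^{(i)}_0)^{-T}\mathsf C^{(i)}_{01}(\mathsf R^{(i)}_1)^{-1}$, with singular values $\sigma^{(i)}_1\ge\sigma^{(i)}_2\ge\cdots$ ($\sigma^{(i)}_k=0$ beyond the last one). Slow–fast spaces: for $i=1,\dots,N-1$ and truncation index $r_i\in\mathbb N$, $Y_{h,si}$ (resp. $Y_{h,fi}$) is the set of $g\in V_h|_{\Gamma_i}$ with $g\sim\vec\alpha$ such that $\mathsf R^{(i)}_0\vec\alpha$ lies in the span of the first $r_i$ columns (resp. the remaining columns) of $\mathsf U^{(i)}$. $V_{h,fi}=\{v\in V_{h,\Gamma}: v|_{\Gamma_i}\in Y_{h,fi},\ v|_{\Gamma_j}=0\ \text{for } j\ne i\}$, $V_{h,si}=\{v\in V_{h,\Gamma}: v|_{\Gamma_i}\in Y_{h,si},\ v|_{\Gamma_j}=0\ \text{for } j\ne i\}$ ($j$ ranging over $1,\dots,N-1$), $V_{h,s}=\bigoplus_{i=1}^{N-1}V_{h,si}$. Solutions: $u_{h,\Gamma}(y)\in V_{h,\Gamma}$ satisfies $a(u_{h,\Gamma}(y),v)=(f,v)_\Omega$ for all $v\in V_{h,\Gamma}$. $\tilde u_{h,\Gamma}(y)=\sum_{i=1}^{N-1}\frac{2}{y_i+y_{i+1}}w_{h,fi}+\tilde u_{h,s}(y)$, where $w_{h,fi}\in V_{h,fi}$ satisfies $(\nabla w_{h,fi},\nabla v)_\Omega=(f,v)_\Omega$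 for all $v\in V_{h,fi}$ and $\tilde u_{h,s}(y)\in V_{h,s}$ satisfies $a(\tilde u_{h,s}(y),v)=(f,v)_\Omega$ for all $v\in V_{h,s}$.
   Formalization: Local mirror symmetry is required in both directions (from Ω_i to Ω_{i+1} and back), as the one-directional version is false; it may be imposed on V_h enlarged by degrees of freedom on x_1=0 and x_1=N, the trace space on Γ_N then being taken from that larger space. *)

theory Defs
  imports
    "HOL-Analysis.Analysis"
    "Jordan_Normal_Form.Gauss_Jordan_Elimination"
    "Jordan_Normal_Form.VS_Connect"
begin

section \<open>Sobolev spaces on open subsets of the plane\<close>

type_synonym plane = "real \<times> real"

definition L2_on :: "plane set \<Rightarrow> (plane \<Rightarrow> 'b::euclidean_space) \<Rightarrow> bool" where
  "L2_on S g \<longleftrightarrow> set_borel_measurable lebesgue S g \<and>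
     set_integrable lebesgue S (\<lambda>x. (norm (g x))\<^sup>2)"

definition L2_inner :: "plane set \<Rightarrow> (plane \<Rightarrow> real) \<Rightarrow> (plane \<Rightarrow> real) \<Rightarrow> real" where
  "L2_inner S u v = (LINT x:S|lebesgue. u x * v x)"

primrec C_diff :: "nat \<Rightarrow> (plane \<Rightarrow> real) \<Rightarrow> bool" where
  "C_diff 0 f \<longleftrightarrow> continuous_on UNIV f"
| "C_diff (Suc k) f \<longleftrightarrow>
     (\<exists>f1 f2. (\<forall>x. (f has_derivative (\<lambda>h. fst h * f1 x + snd h * f2 x)) (at x)) \<and>
        C_diff k f1 \<and> C_diff k f2)"

definition test_function :: "plane set \<Rightarrow> (plane \<Rightarrow> real) \<Rightarrow> bool" where
  "test_function S \<phi> \<longleftrightarrow> (\<forall>k. C_diff k \<phi>) \<and>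
     compact (closure {x. \<phi> x \<noteq> 0}) \<and> closure {x. \<phi> x \<noteq> 0} \<subseteq> S"

definition classical_gradient :: "(plane \<Rightarrow> real) \<Rightarrow> plane \<Rightarrow> plane" where
  "classical_gradient \<phi> x = (\<Sum>e\<in>Basis. frechet_derivative \<phi> (at x) e *\<^sub>R e)"

definition is_weak_gradient :: "plane set \<Rightarrow> (plane \<Rightarrow> real) \<Rightarrow> (plane \<Rightarrow> plane) \<Rightarrow> bool" where
  "is_weak_gradient S u g \<longleftrightarrow> L2_on S g \<and>
     (\<forall>\<phi>. test_function S \<phi> \<longrightarrow> (\<forall>e\<in>Basis.
        (LINT x:S|lebesgue. u x * inner (classical_gradient \<phi> x) e) =
        - (LINT x:S|lebesgue. inner (g x) e * \<phi> x)))"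

definition H1 :: "plane set \<Rightarrow> (plane \<Rightarrow> real) set" where
  "H1 S = {u. L2_on S u \<and> (\<exists>g. is_weak_gradient S u g)}"

text \<open>The weak gradient is determined almost everywhere on \<open>S\<close> only; it is used under integrals
  over \<open>S\<close>, so the choice of the representative is immaterial.\<close>

definition grad :: "plane set \<Rightarrow> (plane \<Rightarrow> real) \<Rightarrow> plane \<Rightarrow> plane" where
  "grad S u = (SOME g. is_weak_gradient S u g)"

definition H10 :: "plane set \<Rightarrow> (plane \<Rightarrow> real) set" where
  "H10 S = {u \<in> H1 S. \<forall>\<epsilon>>0. \<exists>\<phi>. test_function S \<phi> \<and>
     (LINT x:S|lebesgue. (u x - \<phi> x)\<^sup>2) +
     (LINT x:S|lebesgue. (norm (grad S u x - classical_gradient \<phi> x))\<^sup>2) < \<epsilon>}"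

definition grad_inner :: "plane set \<Rightarrow> (plane \<Rightarrow> real) \<Rightarrow> (plane \<Rightarrow> real) \<Rightarrow> real" where
  "grad_inner S u v = (LINT x:S|lebesgue. inner (grad S u x) (grad S v x))"

section \<open>Layered domain and finite element space\<close>

text \<open>A discretized layered problem: \<open>layers\<close> is the number of layers, \<open>lower\<close> and \<open>upper\<close>
  bound the first layer, and the shape functions \<open>shape 0, \<dots>, shape (ndof - 1)\<close> are the basis
  of the finite element space with homogeneous Dirichlet conditions.

  Mirroring a finite element function at an interface moves its values on one side of a layer to
  the other side, in particular onto the lines \<open>x\<^sub>1 = 0\<close> and \<open>x\<^sub>1 = layers\<close>, where members of
  \<open>H10\<close> vanish. Local mirror symmetry is therefore a property of the finite element
  space before the Dirichlet condition on these two lines is imposed. The further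
  shape functions \<open>shape ndof, \<dots>, shape (ndof + nlat - 1)\<close> belong to the degrees of freedom on
  the two lines. With \<open>nlat = 0\<close> both spaces coincide.

  \<open>tbasis j\<close> is the fixed basis of the trace space on the \<open>j\<close>-th interface.\<close>

record layered_fem =
  layers :: nat
  lower :: "real \<Rightarrow> real"
  upper :: "real \<Rightarrow> real"
  ndof :: nat
  nlat :: nat
  shape :: "nat \<Rightarrow> plane \<Rightarrow> real"
  tbasis :: "nat \<Rightarrow> (plane \<Rightarrow> real) list"

text \<open>Layers are numbered from 1.\<close>

fun layer :: "layered_fem \<Rightarrow> nat \<Rightarrow> plane set" where
  "layer P 0 = {}"
| "layer P (Suc 0) = {(x1, x2). 0 < x1 \<and> x1 < 1 \<and> lower P x1 < x2 \<and> x2 < upper P x1}"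
| "layer P (Suc (Suc i)) = {(x1, x2). (2 * real (Suc i) - x1, x2) \<in> layer P (Suc i)}"

definition Omega :: "layered_fem \<Rightarrow> plane set" where
  "Omega P = interior (\<Union>i\<in>{1..layers P}. closure (layer P i))"

text \<open>Besides the interfaces proper (indices \<open>1, \<dots>, layers P - 1\<close>) this covers the parts of the
  boundary on the lines \<open>x\<^sub>1 = 0\<close> (index \<open>0\<close>) and \<open>x\<^sub>1 = layers P\<close> (index \<open>layers P\<close>).\<close>

definition iface :: "layered_fem \<Rightarrow> nat \<Rightarrow> plane set" where
  "iface P i =
     (if i = 0 then frontier (layer P 1) \<inter> {x. fst x = 0}
      else if i < layers P then frontier (layer P i) \<inter> frontier (layer P (Suc i))
      else frontier (layer P (layers P)) \<inter> {x. fst x = real (layers P)})"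

definition geometry :: "layered_fem \<Rightarrow> bool" where
  "geometry P \<longleftrightarrow> continuous_on {0<..<1} (lower P) \<and> continuous_on {0<..<1} (upper P) \<and>
     (\<forall>t\<in>{0<..<1}. lower P t < upper P t)"

definition fun_span :: "nat \<Rightarrow> (nat \<Rightarrow> plane \<Rightarrow> real) \<Rightarrow> (plane \<Rightarrow> real) set" where
  "fun_span n \<phi> = {\<lambda>x. \<Sum>k<n. c k * \<phi> k x | c. True}"

definition lin_indep_on :: "plane set \<Rightarrow> nat set \<Rightarrow> (nat \<Rightarrow> plane \<Rightarrow> real) \<Rightarrow> bool" where
  "lin_indep_on S K \<phi> \<longleftrightarrow>
     (\<forall>c. (\<forall>x\<in>S. (\<Sum>k\<in>K. c k * \<phi> k x) = 0) \<longrightarrow> (\<forall>k\<in>K. c k = 0))"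

definition Vh :: "layered_fem \<Rightarrow> (plane \<Rightarrow> real) set" where
  "Vh P = fun_span (ndof P) (shape P)"

definition Xh :: "layered_fem \<Rightarrow> (plane \<Rightarrow> real) set" where
  "Xh P = fun_span (ndof P + nlat P) (shape P)"

text \<open>Finite element functions are continuous up to the boundary, and functions on the domain are
  represented by their extension by zero. Their traces are hence pointwise restrictions.\<close>

definition conforming_functions :: "layered_fem \<Rightarrow> bool" where
  "conforming_functions P \<longleftrightarrow>
     (\<forall>k < ndof P + nlat P. continuous_on (closure (Omega P)) (shape P k) \<and>
        shape P k \<in> H1 (Omega P) \<and>
        (\<forall>x. x \<notin> Omega P \<union> iface P 0 \<union> iface P (layers P) \<longrightarrow> shape P k x = 0)) \<and>
     Vh P \<subseteq> H10 (Omega P) \<and> (\<forall>v\<in>Vh P. \<forall>x. x \<notin> Omega P \<longrightarrow> v x = 0) \<and>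
     lin_indep_on UNIV {..<ndof P + nlat P} (shape P)"

definition layer_dof :: "layered_fem \<Rightarrow> nat \<Rightarrow> nat \<Rightarrow> bool" where
  "layer_dof P i k \<longleftrightarrow> (\<forall>x. x \<notin> layer P i \<longrightarrow> shape P k x = 0)"

definition iface_dof :: "layered_fem \<Rightarrow> nat \<Rightarrow> nat \<Rightarrow> bool" where
  "iface_dof P i k \<longleftrightarrow> (\<exists>x\<in>iface P i. shape P k x \<noteq> 0) \<and>
     (\<forall>x. x \<notin> layer P i \<union> iface P i \<union> layer P (Suc i) \<longrightarrow> shape P k x = 0)"

text \<open>Conformity to the interfaces: no element of the mesh crosses an interface. So each
  shape function belongs to a degree of freedom inside one layer, or to one on an interface, in
  which case it is supported by the two adjacent layers; and the shape functions of an
  interface have linearly independent traces.\<close>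

definition conforming_interfaces :: "layered_fem \<Rightarrow> bool" where
  "conforming_interfaces P \<longleftrightarrow>
     (\<forall>k < ndof P. (\<exists>i\<in>{1..layers P}. layer_dof P i k) \<or> (\<exists>i\<in>{1..<layers P}. iface_dof P i k)) \<and>
     (\<forall>k \<in> {ndof P..<ndof P + nlat P}. iface_dof P 0 k \<or> iface_dof P (layers P) k) \<and>
     (\<forall>i \<le> layers P. lin_indep_on (iface P i) {k. k < ndof P + nlat P \<and> iface_dof P i k} (shape P))"

definition mirrored_at :: "layered_fem \<Rightarrow> nat \<Rightarrow> (plane \<Rightarrow> real) \<Rightarrow> bool" where
  "mirrored_at P i w \<longleftrightarrow>
     (\<forall>t x2. (real i - t, x2) \<in> layer P i \<longrightarrow> w (real i - t, x2) = w (real i + t, x2))"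

text \<open>Both sides of each interface can be mirrored onto each other; mirroring in one direction
  only would allow different finite element spaces on the two layers.\<close>

definition mirror_symmetric :: "layered_fem \<Rightarrow> bool" where
  "mirror_symmetric P \<longleftrightarrow>
     (\<forall>i\<in>{1..<layers P}. \<forall>l\<in>{i, Suc i}. \<forall>v\<in>Xh P.
        \<exists>w\<in>Xh P. (\<forall>x\<in>layer P l. w x = v x) \<and> mirrored_at P i w)"

definition fe_space :: "layered_fem \<Rightarrow> bool" where
  "fe_space P \<longleftrightarrow> conforming_functions P \<and> conforming_interfaces P \<and> mirror_symmetric P"

definition Vh_layer :: "layered_fem \<Rightarrow> nat \<Rightarrow> (plane \<Rightarrow> real) set" where
  "Vh_layer P i = {v \<in> Vh P. \<forall>x. x \<notin> layer P i \<longrightarrow> v x = 0}"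

definition Vh_Gamma :: "layered_fem \<Rightarrow> (plane \<Rightarrow> real) set" where
  "Vh_Gamma P =
     {v \<in> Vh P. \<forall>i\<in>{1..layers P}. \<forall>w\<in>Vh_layer P i. grad_inner (Omega P) v w = 0}"

section \<open>Traces and discrete harmonic extensions\<close>

text \<open>Functions on a set are represented by their extension by zero.\<close>

definition restr :: "plane set \<Rightarrow> (plane \<Rightarrow> real) \<Rightarrow> plane \<Rightarrow> real" where
  "restr S v = (\<lambda>x. if x \<in> S then v x else 0)"

text \<open>On the interfaces \<open>1, \<dots>, layers P - 1\<close> the spaces \<open>Xh\<close> and \<open>Vh\<close> have the same traces.\<close>

definition trace_space :: "layered_fem \<Rightarrow> nat \<Rightarrow> (plane \<Rightarrow> real) set" where
  "trace_space P j = restr (iface P j) ` Xh P"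

definition coords :: "layered_fem \<Rightarrow> nat \<Rightarrow> real Matrix.vec \<Rightarrow> (plane \<Rightarrow> real) \<Rightarrow> bool" where
  "coords P j \<alpha> g \<longleftrightarrow> \<alpha> \<in> carrier_vec (length (tbasis P j)) \<and>
     g = (\<lambda>x. \<Sum>k<length (tbasis P j). vec_index \<alpha> k * (tbasis P j ! k) x)"

definition trace_bases :: "layered_fem \<Rightarrow> bool" where
  "trace_bases P \<longleftrightarrow> (\<forall>j\<in>{1..layers P}. set (tbasis P j) \<subseteq> trace_space P j \<and>
     (\<forall>g\<in>trace_space P j. \<exists>!\<alpha>. coords P j \<alpha> g))"

text \<open>The discrete harmonic extension to layer \<open>i + 1\<close> that equals \<open>g\<close> on interface \<open>i + n\<close> and
  vanishes on the other one (\<open>n = 0, 1\<close>).\<close>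

definition Zh :: "layered_fem \<Rightarrow> nat \<Rightarrow> nat \<Rightarrow> (plane \<Rightarrow> real) \<Rightarrow> plane \<Rightarrow> real" where
  "Zh P n i g = (THE w. w \<in> restr (closure (layer P (Suc i))) ` Xh P \<and>
     (\<forall>k\<in>{0, 1}. \<forall>x\<in>iface P (i + k). w x = (if k = n then g x else 0)) \<and>
     (\<forall>v\<in>Vh_layer P (Suc i). grad_inner (layer P (Suc i)) w v = 0))"

definition Cmat :: "layered_fem \<Rightarrow> nat \<Rightarrow> nat \<Rightarrow> nat \<Rightarrow> real Matrix.mat" where
  "Cmat P i n m =
     (THE A. A \<in> carrier_mat (length (tbasis P (i + n))) (length (tbasis P (i + m))) \<and>
       (\<forall>g\<in>trace_space P (i + n). \<forall>h\<in>trace_space P (i + m). \<forall>\<alpha> \<beta>.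
          coords P (i + n) \<alpha> g \<longrightarrow> coords P (i + m) \<beta> h \<longrightarrow>
          scalar_prod \<alpha> (mult_mat_vec A \<beta>) =
          grad_inner (layer P (Suc i)) (Zh P n i g) (Zh P m i h)))"

section \<open>Cholesky factors and singular value decomposition\<close>

definition cholesky_factor :: "real Matrix.mat \<Rightarrow> real Matrix.mat \<Rightarrow> bool" where
  "cholesky_factor A R \<longleftrightarrow> R \<in> carrier_mat (dim_row A) (dim_row A) \<and> upper_triangular R \<and>
     (\<forall>k<dim_row R. R $$ (k, k) > 0) \<and> A = transpose_mat R * R"

definition is_svd ::
  "real Matrix.mat \<Rightarrow> real Matrix.mat \<Rightarrow> real Matrix.mat \<Rightarrow> real Matrix.mat \<Rightarrow> bool" where
  "is_svd A U S V \<longleftrightarrow>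
     U \<in> carrier_mat (dim_row A) (dim_row A) \<and> transpose_mat U * U = 1\<^sub>m (dim_row A) \<and>
     V \<in> carrier_mat (dim_col A) (dim_col A) \<and> transpose_mat V * V = 1\<^sub>m (dim_col A) \<and>
     S \<in> carrier_mat (dim_row A) (dim_col A) \<and>
     (\<forall>k<dim_row A. \<forall>l<dim_col A. k \<noteq> l \<longrightarrow> S $$ (k, l) = 0) \<and>
     (\<forall>k<min (dim_row A) (dim_col A). S $$ (k, k) \<ge> 0) \<and>
     (\<forall>k l. k \<le> l \<and> l < min (dim_row A) (dim_col A) \<longrightarrow> S $$ (l, l) \<le> S $$ (k, k)) \<and>
     A = U * S * transpose_mat V"

text \<open>The index \<open>k\<close> counts from 1.\<close>

definition sing_val :: "real Matrix.mat \<Rightarrow> nat \<Rightarrow> real" where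
  "sing_val S k = (if 1 \<le> k \<and> k \<le> min (dim_row S) (dim_col S) then S $$ (k - 1, k - 1) else 0)"

definition coupling_mat :: "layered_fem \<Rightarrow> nat \<Rightarrow> real Matrix.mat \<Rightarrow> real Matrix.mat \<Rightarrow> real Matrix.mat" where
  "coupling_mat P i R0 R1 =
     transpose_mat (the (mat_inverse R0)) * Cmat P i 0 1 * the (mat_inverse R1)"

definition svd_data :: "layered_fem \<Rightarrow> (nat \<Rightarrow> real Matrix.mat) \<Rightarrow> (nat \<Rightarrow> real Matrix.mat) \<Rightarrow>
    (nat \<Rightarrow> real Matrix.mat) \<Rightarrow> (nat \<Rightarrow> real Matrix.mat) \<Rightarrow> (nat \<Rightarrow> real Matrix.mat) \<Rightarrow> bool" where
  "svd_data P R0 R1 U S V \<longleftrightarrow> (\<forall>i\<in>{1..<layers P}.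
     cholesky_factor (Cmat P i 0 0) (R0 i) \<and> cholesky_factor (Cmat P i 1 1) (R1 i) \<and>
     is_svd (coupling_mat P i (R0 i) (R1 i)) (U i) (S i) (V i))"

section \<open>Slow and fast spaces\<close>

definition vec_span :: "nat \<Rightarrow> real Matrix.vec set \<Rightarrow> real Matrix.vec set" where
  "vec_span n W = LinearCombinations.module.span class_ring (module_vec TYPE(real) n) W"

definition Yh_slow :: "layered_fem \<Rightarrow> nat \<Rightarrow> nat \<Rightarrow> real Matrix.mat \<Rightarrow> real Matrix.mat \<Rightarrow> (plane \<Rightarrow> real) set" where
  "Yh_slow P i r R0 U = {g \<in> trace_space P i. \<exists>\<alpha>. coords P i \<alpha> g \<and>
     mult_mat_vec R0 \<alpha> \<in> vec_span (dim_row U) (set (take r (cols U)))}"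

definition Yh_fast :: "layered_fem \<Rightarrow> nat \<Rightarrow> nat \<Rightarrow> real Matrix.mat \<Rightarrow> real Matrix.mat \<Rightarrow> (plane \<Rightarrow> real) set" where
  "Yh_fast P i r R0 U = {g \<in> trace_space P i. \<exists>\<alpha>. coords P i \<alpha> g \<and>
     mult_mat_vec R0 \<alpha> \<in> vec_span (dim_row U) (set (drop r (cols U)))}"

definition Vh_iface :: "layered_fem \<Rightarrow> nat \<Rightarrow> (plane \<Rightarrow> real) set \<Rightarrow> (plane \<Rightarrow> real) set" where
  "Vh_iface P i Y = {v \<in> Vh_Gamma P. restr (iface P i) v \<in> Y \<and>
     (\<forall>j\<in>{1..<layers P}. j \<noteq> i \<longrightarrow> (\<forall>x\<in>iface P j. v x = 0))}"

definition Vh_fast_i :: "layered_fem \<Rightarrow> (nat \<Rightarrow> nat) \<Rightarrow> (nat \<Rightarrow> real Matrix.mat) \<Rightarrow>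
    (nat \<Rightarrow> real Matrix.mat) \<Rightarrow> nat \<Rightarrow> (plane \<Rightarrow> real) set" where
  "Vh_fast_i P r R0 U i = Vh_iface P i (Yh_fast P i (r i) (R0 i) (U i))"

definition Vh_slow_i :: "layered_fem \<Rightarrow> (nat \<Rightarrow> nat) \<Rightarrow> (nat \<Rightarrow> real Matrix.mat) \<Rightarrow>
    (nat \<Rightarrow> real Matrix.mat) \<Rightarrow> nat \<Rightarrow> (plane \<Rightarrow> real) set" where
  "Vh_slow_i P r R0 U i = Vh_iface P i (Yh_slow P i (r i) (R0 i) (U i))"

definition Vh_slow :: "layered_fem \<Rightarrow> (nat \<Rightarrow> nat) \<Rightarrow> (nat \<Rightarrow> real Matrix.mat) \<Rightarrow>
    (nat \<Rightarrow> real Matrix.mat) \<Rightarrow> (plane \<Rightarrow> real) set" where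
  "Vh_slow P r R0 U = {\<lambda>x. \<Sum>i\<in>{1..<layers P}. v i x | v.
     \<forall>i\<in>{1..<layers P}. v i \<in> Vh_slow_i P r R0 U i}"

section \<open>Energy form and discrete solutions\<close>

text \<open>A parameter vector is a function of which the values at \<open>1, \<dots>, layers P\<close> matter.\<close>

definition energy :: "layered_fem \<Rightarrow> (nat \<Rightarrow> real) \<Rightarrow> (plane \<Rightarrow> real) \<Rightarrow> (plane \<Rightarrow> real) \<Rightarrow> real" where
  "energy P y z v = (\<Sum>i\<in>{1..layers P}. y i * grad_inner (layer P i) z v)"

definition energy_norm :: "layered_fem \<Rightarrow> (nat \<Rightarrow> real) \<Rightarrow> (plane \<Rightarrow> real) \<Rightarrow> real" where
  "energy_norm P y v = sqrt (energy P y v v)"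

definition interface_solution :: "layered_fem \<Rightarrow> (plane \<Rightarrow> real) \<Rightarrow> (nat \<Rightarrow> real) \<Rightarrow> (plane \<Rightarrow> real) \<Rightarrow> bool" where
  "interface_solution P f y u \<longleftrightarrow> u \<in> Vh_Gamma P \<and>
     (\<forall>v\<in>Vh_Gamma P. energy P y u v = L2_inner (Omega P) f v)"

definition fast_solution :: "layered_fem \<Rightarrow> (nat \<Rightarrow> nat) \<Rightarrow> (nat \<Rightarrow> real Matrix.mat) \<Rightarrow>
    (nat \<Rightarrow> real Matrix.mat) \<Rightarrow> (plane \<Rightarrow> real) \<Rightarrow> nat \<Rightarrow> (plane \<Rightarrow> real) \<Rightarrow> bool" where
  "fast_solution P r R0 U f i w \<longleftrightarrow> w \<in> Vh_fast_i P r R0 U i \<and>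
     (\<forall>v\<in>Vh_fast_i P r R0 U i. grad_inner (Omega P) w v = L2_inner (Omega P) f v)"

definition slow_solution :: "layered_fem \<Rightarrow> (nat \<Rightarrow> nat) \<Rightarrow> (nat \<Rightarrow> real Matrix.mat) \<Rightarrow>
    (nat \<Rightarrow> real Matrix.mat) \<Rightarrow> (plane \<Rightarrow> real) \<Rightarrow> (nat \<Rightarrow> real) \<Rightarrow> (plane \<Rightarrow> real) \<Rightarrow> bool" where
  "slow_solution P r R0 U f y w \<longleftrightarrow> w \<in> Vh_slow P r R0 U \<and>
     (\<forall>v\<in>Vh_slow P r R0 U. energy P y w v = L2_inner (Omega P) f v)"

definition approx_solution :: "layered_fem \<Rightarrow> (nat \<Rightarrow> real) \<Rightarrow> (nat \<Rightarrow> plane \<Rightarrow> real) \<Rightarrow>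
    (plane \<Rightarrow> real) \<Rightarrow> plane \<Rightarrow> real" where
  "approx_solution P y wfast us =
     (\<lambda>x. (\<Sum>i\<in>{1..<layers P}. 2 / (y i + y (Suc i)) * wfast i x) + us x)"

end

theory Submission
  imports Defs
begin

text \<open>A discrete harmonic function is the sum of components that each have their trace on a single
  interface, and only components on neighbouring interfaces interact, through the layer between
  them. In singular vector coordinates this interaction is the diagonal matrix of singular values:
  \<open>\<sigma>\<^sub>1 < 1\<close> makes the sum of the component energies equivalent to the total energy, and a fast
  component sees its neighbours only up to the factor \<open>\<sigma>\<^sub>r\<^sub>+\<^sub>1\<close>. By mirror symmetry a component has the same energy
  on both sides of its interface, so slow and fast parts of one component are orthogonal for
  every parameter and the fast Galerkin problem on one interface scales with \<open>2 / (y\<^sub>i + y\<^sub>i\<^sub>+\<^sub>1)\<close>. Hence the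
  approximation decouples the exact Galerkin problem up to terms of relative size \<open>\<sigma>\<^sub>r\<^sub>+\<^sub>1\<close>.\<close>

section \<open>Test functions\<close>

text \<open>The central notions are given by descriptions, so each needs uniqueness before it can be
  computed with. \<open>grad\<close> is a Hilbert choice: its linearity and its behaviour under
  restriction and reflection rest on the a.e. uniqueness of weak gradients, hence on the fundamental
  lemma of the calculus of variations. \<open>Zh\<close> and \<open>Cmat\<close> are definite
  descriptions and rest on the definiteness of the gradient form on functions supported in one
  layer, hence on a Poincare-type argument; \<open>Cmat\<close> moreover uses the trace bases. The
  constant is n^2 * (1 / c + 1 / sqrt c) with n = N - 1 and c = 1 - \<sigma>1. Coercivity bounds
  every component of u by K = norm(u) / sqrt c. Each of the n fast errors is at most n * \<sigma>r *
  K, and the slow error is at most n^2 * \<sigma>r * K / sqrt c. The parameter y does not enter the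
  constant: neighbouring components meet on one layer only, and the square root of its weight goes
  to each of the two energy norms.\<close>

lemma C_diff_SucE:
  assumes "C_diff (Suc k) f"
  obtains f1 f2 where "\<And>x. (f has_derivative (\<lambda>h. fst h * f1 x + snd h * f2 x)) (at x)"
    "C_diff k f1" "C_diff k f2"
  using assms by auto

lemma C_diff_SucI:
  assumes "\<And>x. (f has_derivative (\<lambda>h. fst h * f1 x + snd h * f2 x)) (at x)"
    "C_diff k f1" "C_diff k f2"
  shows "C_diff (Suc k) f"
  using assms unfolding C_diff.simps by blast

lemma C_diff_continuous: "C_diff k f \<Longrightarrow> continuous_on UNIV f"
proof (cases k)
  case (Suc l)
  assume "C_diff k f"
  then obtain f1 f2 where "\<And>x. (f has_derivative (\<lambda>h. fst h * f1 x + snd h * f2 x)) (at x)"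
    unfolding Suc using C_diff_SucE by blast
  then show ?thesis
    by (intro continuous_at_imp_continuous_on ballI) (rule has_derivative_continuous)
qed simp

lemma C_diff_mono: "C_diff (Suc k) f \<Longrightarrow> C_diff k f"
proof (induction k arbitrary: f)
  case 0
  then show ?case using C_diff_continuous by (simp del: C_diff.simps(2))
next
  case (Suc k)
  obtain f1 f2 where f: "\<And>x. (f has_derivative (\<lambda>h. fst h * f1 x + snd h * f2 x)) (at x)"
    "C_diff (Suc k) f1" "C_diff (Suc k) f2" using C_diff_SucE[OF Suc.prems] by blast
  show ?case by (rule C_diff_SucI[OF f(1) Suc.IH[OF f(2)] Suc.IH[OF f(3)]])
qed

lemma C_diff_const: "C_diff k (\<lambda>x. c)"
proof (induction k arbitrary: c)
  case (Suc k)
  show ?case by (rule C_diff_SucI[OF _ Suc[of 0] Suc[of 0]]) simp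
qed auto

lemma C_diff_add: "C_diff k f \<Longrightarrow> C_diff k g \<Longrightarrow> C_diff k (\<lambda>x. f x + g x)"
proof (induction k arbitrary: f g)
  case 0
  then show ?case by (auto intro: continuous_on_add)
next
  case (Suc k)
  obtain f1 f2 where f: "\<And>x. (f has_derivative (\<lambda>h. fst h * f1 x + snd h * f2 x)) (at x)"
    "C_diff k f1" "C_diff k f2" using C_diff_SucE[OF Suc.prems(1)] by blast
  obtain g1 g2 where g: "\<And>x. (g has_derivative (\<lambda>h. fst h * g1 x + snd h * g2 x)) (at x)"
    "C_diff k g1" "C_diff k g2" using C_diff_SucE[OF Suc.prems(2)] by blast
  have "((\<lambda>x. f x + g x) has_derivative (\<lambda>h. fst h * (f1 x + g1 x) + snd h * (f2 x + g2 x))) (at x)" for x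
    by (rule has_derivative_eq_rhs[OF has_derivative_add[OF f(1) g(1)]]) (auto simp: algebra_simps)
  then show ?case using Suc.IH f g by (intro C_diff_SucI)
qed

lemma C_diff_mult: "C_diff k f \<Longrightarrow> C_diff k g \<Longrightarrow> C_diff k (\<lambda>x. f x * g x)"
proof (induction k arbitrary: f g)
  case 0
  then show ?case by (auto intro: continuous_on_mult)
next
  case (Suc k)
  obtain f1 f2 where f: "\<And>x. (f has_derivative (\<lambda>h. fst h * f1 x + snd h * f2 x)) (at x)"
    "C_diff k f1" "C_diff k f2" using C_diff_SucE[OF Suc.prems(1)] by blast
  obtain g1 g2 where g: "\<And>x. (g has_derivative (\<lambda>h. fst h * g1 x + snd h * g2 x)) (at x)"
    "C_diff k g1" "C_diff k g2" using C_diff_SucE[OF Suc.prems(2)] by blast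
  have "((\<lambda>x. f x * g x) has_derivative
     (\<lambda>h. fst h * (f x * g1 x + f1 x * g x) + snd h * (f x * g2 x + f2 x * g x))) (at x)" for x
    by (rule has_derivative_eq_rhs[OF has_derivative_mult[OF f(1) g(1)]]) (auto simp: algebra_simps)
  moreover have "C_diff k (\<lambda>x. f x * g1 x + f1 x * g x)" "C_diff k (\<lambda>x. f x * g2 x + f2 x * g x)"
    by (intro C_diff_add Suc.IH f g Suc.prems[THEN C_diff_mono])+
  ultimately show ?case by (rule C_diff_SucI)
qed

lemma C_diff_fst: "C_diff k fst"
proof (cases k)
  case (Suc l)
  show ?thesis unfolding Suc
    by (rule C_diff_SucI[OF _ C_diff_const[of l 1] C_diff_const[of l 0]])
      (auto intro!: derivative_eq_intros)
qed (auto intro!: continuous_intros)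

text \<open>Coefficients 1 and -1 give translations and reflections, and a coefficient 0 discards a
  coordinate. These serve the box bumps and the mirrored test functions.\<close>

lemma C_diff_compose_affine:
  assumes "C_diff k f"
  shows "C_diff k (\<lambda>x. f (a * fst x + b, c * snd x + d))"
  using assms
proof (induction k arbitrary: f)
  case 0
  then show ?case by (auto intro!: continuous_on_compose2[of UNIV f] continuous_intros)
next
  case (Suc k)
  obtain f1 f2 where f: "\<And>x. (f has_derivative (\<lambda>h. fst h * f1 x + snd h * f2 x)) (at x)"
    "C_diff k f1" "C_diff k f2" using C_diff_SucE[OF Suc.prems(1)] by blast
  let ?T = "\<lambda>x::plane. (a * fst x + b, c * snd x + d)"
  have "(?T has_derivative (\<lambda>h. (a * fst h, c * snd h))) (at x)" for x
    by (auto intro!: derivative_eq_intros)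
  from has_derivative_compose[OF this f(1)]
  have "((\<lambda>x. f (?T x)) has_derivative (\<lambda>h. fst h * (a * f1 (?T x)) + snd h * (c * f2 (?T x)))) (at x)" for x
    by (simp add: algebra_simps)
  moreover have "C_diff k (\<lambda>x. a * f1 (?T x))" "C_diff k (\<lambda>x. c * f2 (?T x))"
    using f Suc.IH C_diff_mult[OF C_diff_const] by blast+
  ultimately show ?case by (rule C_diff_SucI)
qed

subsection \<open>Bump functions\<close>

text \<open>The family of functions \<open>poly p (1 / t) * exp (- c / t)\<close>, extended by 0 to \<open>t \<le> 0\<close>, is
  closed under differentiation.\<close>

definition flat_fun :: "real \<Rightarrow> real poly \<Rightarrow> real \<Rightarrow> real" where
  "flat_fun c p t = (if t > 0 then poly p (1 / t) * exp (- c / t) else 0)"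

text \<open>With s = 1 / t the claim is the decay of a polynomial times exp (- c * s) at
  infinity.\<close>

lemma flat_fun_tendsto_0:
  fixes c :: real
  assumes "c > 0"
  shows "((\<lambda>t. poly p (1 / t) * exp (- c / t)) \<longlongrightarrow> 0) (at_right 0)"
proof -
  have *: "((\<lambda>s. poly p s * exp (- c * s)) \<longlongrightarrow> 0) at_top"
  proof -
    have "((\<lambda>s. s ^ i * exp (- c * s)) \<longlongrightarrow> 0) at_top" for i
    proof -
      have "filterlim (\<lambda>s. c * s) at_top at_top"
        by (rule filterlim_tendsto_pos_mult_at_top[OF tendsto_const assms filterlim_ident])
      from filterlim_compose[OF tendsto_power_div_exp_0 this]
      have "((\<lambda>s. inverse (c ^ i) * ((c * s) ^ i / exp (c * s))) \<longlongrightarrow> inverse (c ^ i) * 0) at_top"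
        by (intro tendsto_intros)
      then show ?thesis using assms by (simp add: power_mult_distrib exp_minus field_simps)
    qed
    then have "((\<lambda>s. \<Sum>i\<le>degree p. coeff p i * (s ^ i * exp (- c * s))) \<longlongrightarrow> (\<Sum>i\<le>degree p. coeff p i * 0)) at_top"
      by (intro tendsto_intros)
    then show ?thesis by (simp add: poly_altdef sum_distrib_right mult.assoc)
  qed
  have "((\<lambda>t. poly p (inverse t) * exp (- c * inverse t)) \<longlongrightarrow> 0) (at_right 0)"
    by (rule filterlim_compose[OF * filterlim_inverse_at_top_right])
  then show ?thesis by (simp add: field_simps)
qed

text \<open>By the chain rule, differentiation acts on the polynomial in X = 1 / t as p -> c X^2 p -
  X^2 p'. Only t = 0 calls for a limit.\<close>

lemma flat_fun_has_derivative:
  assumes "c > 0"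
  shows "(flat_fun c p has_real_derivative
    flat_fun c ([:0, 0, c:] * p - [:0, 0, 1:] * pderiv p) t) (at t)"
proof -
  let ?q = "[:0, 0, c:] * p - [:0, 0, 1:] * pderiv p"
  consider "t > 0" | "t < 0" | "t = 0" by linarith
  then show ?thesis
  proof cases
    case 1
    have "((\<lambda>t. poly p (1 / t) * exp (- c / t)) has_real_derivative
        poly ?q (1 / t) * exp (- c / t)) (at t)"
      using 1 by (auto intro!: derivative_eq_intros DERIV_chain'[OF _ poly_DERIV]
          simp: field_simps power2_eq_square)
    then show ?thesis
      using 1 by (auto simp: flat_fun_def
        elim: has_field_derivative_transform_within_open[of _ _ _ "{0<..}"])
  next
    case 2
    have "((\<lambda>t. 0) has_real_derivative 0) (at t)" by simp
    then have "(flat_fun c p has_real_derivative 0) (at t)"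
      by (rule has_field_derivative_transform_within_open[of _ _ _ "{..<0}"])
        (use 2 in \<open>auto simp: flat_fun_def\<close>)
    then show ?thesis using 2 by (simp add: flat_fun_def)
  next
    case 3
    have "((\<lambda>h. flat_fun c p h / h) \<longlongrightarrow> 0) (at_left 0)"
      by (rule tendsto_eventually) (auto simp: flat_fun_def eventually_at_left_field intro!: exI[of _ "-1"])
    \<comment> \<open>Division by \<open>h\<close> multiplies the polynomial by X, so the difference
      quotient is of the same type and tends to 0.\<close>
    moreover have "((\<lambda>h. flat_fun c p h / h) \<longlongrightarrow> 0) (at_right 0)"
    proof (rule Lim_transform_eventually[OF flat_fun_tendsto_0[OF assms, of "[:0, 1:] * p"]])
      show "\<forall>\<^sub>F x in at_right 0. poly ([:0, 1:] * p) (1 / x) * exp (- c / x) = flat_fun c p x / x"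
        unfolding eventually_at_right_field by (intro exI[of _ 1]) (auto simp: flat_fun_def)
    qed
    ultimately have "((\<lambda>h. flat_fun c p h / h) \<longlongrightarrow> 0) (at 0)"
      by (simp add: filterlim_split_at)
    then show ?thesis using 3 by (simp add: DERIV_def flat_fun_def)
  qed
qed

lemma C_diff_flat_fun:
  assumes "c > 0"
  shows "C_diff k (\<lambda>x. flat_fun c p (fst x))" "C_diff k (\<lambda>x. flat_fun c p (snd x))"
proof (induction k arbitrary: p)
  case 0
  have *: "continuous_on UNIV (flat_fun c p)" for p
    using flat_fun_has_derivative[OF assms] DERIV_isCont continuous_at_imp_continuous_on by blast
  { case 1 show ?case by (auto intro!: continuous_on_compose2[OF *] continuous_intros) }
  { case 2 show ?case by (auto intro!: continuous_on_compose2[OF *] continuous_intros) }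
next
  case (Suc k)
  let ?q = "\<lambda>p. [:0, 0, c:] * p - [:0, 0, 1:] * pderiv p"
  note d = flat_fun_has_derivative[OF assms, unfolded has_field_derivative_def]
  { case 1
    have "((\<lambda>x::plane. flat_fun c p (fst x)) has_derivative (\<lambda>h. fst h * flat_fun c (?q p) (fst x) + snd h * 0)) (at x)" for x
      by (rule has_derivative_eq_rhs[OF has_derivative_compose[OF _ d]]) (auto intro!: derivative_eq_intros)
    from C_diff_SucI[OF this Suc.IH(1)[of "?q p"] C_diff_const] show ?case . }
  { case 2
    have "((\<lambda>x::plane. flat_fun c p (snd x)) has_derivative (\<lambda>h. fst h * 0 + snd h * flat_fun c (?q p) (snd x))) (at x)" for x
      by (rule has_derivative_eq_rhs[OF has_derivative_compose[OF _ d]]) (auto intro!: derivative_eq_intros)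
    from C_diff_SucI[OF this C_diff_const Suc.IH(2)[of "?q p"]] show ?case . }
qed

text \<open>A product of four one-sided bumps, one for each side of the box. The decay rate 1 / (n +
  1) tends to 0, so the bumps tend to the indicator of the open box while staying bounded by
  1.\<close>

definition box_bump :: "plane \<Rightarrow> plane \<Rightarrow> nat \<Rightarrow> plane \<Rightarrow> real" where
  "box_bump a b n x = (let E = flat_fun (1 / real (Suc n)) 1 in
     (E (fst x - fst a) * E (fst b - fst x)) * (E (snd x - snd a) * E (snd b - snd x)))"

lemma C_diff_box_bump: "C_diff k (box_bump a b n)"
proof -
  have c: "1 / real (Suc n) > 0" by simp
  show ?thesis
    unfolding box_bump_def Let_def
    using C_diff_compose_affine[OF C_diff_flat_fun(1)[OF c], of k 1 1 "- fst a" 0 0]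
      C_diff_compose_affine[OF C_diff_flat_fun(1)[OF c], of k 1 "-1" "fst b" 0 0]
      C_diff_compose_affine[OF C_diff_flat_fun(2)[OF c], of k 1 0 0 1 "- snd a"]
      C_diff_compose_affine[OF C_diff_flat_fun(2)[OF c], of k 1 0 0 "-1" "snd b"]
    by (intro C_diff_mult) simp_all
qed

lemma box_bump_eq_0_iff: "box_bump a b n x = 0 \<longleftrightarrow> x \<notin> box a b"
  by (auto simp: box_bump_def Let_def flat_fun_def mem_box Basis_prod_def inner_prod_def)

lemma box_bump_bound: "norm (box_bump a b n x) \<le> 1"
proof -
  have *: "norm (flat_fun (1 / real (Suc n)) 1 t) \<le> 1" for t
    by (simp add: flat_fun_def)
  then show ?thesis
    unfolding box_bump_def Let_def norm_mult by (intro mult_le_one *) auto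
qed

lemma box_bump_tendsto: "(\<lambda>n. box_bump a b n x) \<longlonglongrightarrow> indicator (box a b) x"
proof (cases "x \<in> box a b")
  case True
  have *: "(\<lambda>n. flat_fun (1 / real (Suc n)) 1 t) \<longlonglongrightarrow> 1" if "t > 0" for t
  proof -
    have "(\<lambda>n. exp (- (inverse (real (Suc n)) / t))) \<longlonglongrightarrow> exp (- (0 / t))"
      by (intro tendsto_intros LIMSEQ_inverse_real_of_nat) (use that in auto)
    then show ?thesis using that by (simp add: flat_fun_def inverse_eq_divide)
  qed
  have "(\<lambda>n. box_bump a b n x) \<longlonglongrightarrow> (1 * 1) * (1 * 1)"
    unfolding box_bump_def Let_def using True
    by (intro tendsto_mult *) (auto simp: mem_box Basis_prod_def inner_prod_def)
  then show ?thesis using True by simp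
next
  case False
  then have "box_bump a b n x = 0" for n by (simp add: box_bump_eq_0_iff)
  with False show ?thesis by simp
qed

lemma test_function_box_bump:
  assumes "cbox a b \<subseteq> S"
  shows "test_function S (box_bump a b n)"
proof -
  have "closure {x. box_bump a b n x \<noteq> 0} \<subseteq> cbox a b"
    by (rule closure_minimal) (auto simp: box_bump_eq_0_iff box_subset_cbox intro: subsetD[OF box_subset_cbox])
  then show ?thesis
    using assms C_diff_box_bump
    by (auto simp: test_function_def box_bump_eq_0_iff)
qed

subsection \<open>Square integrable functions\<close>

lemma L2_on_iff:
  "L2_on S g \<longleftrightarrow> (\<lambda>x. indicator S x *\<^sub>R g x) \<in> borel_measurable lebesgue \<and>
     integrable lebesgue (\<lambda>x. (norm (indicator S x *\<^sub>R g x))\<^sup>2)"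
proof -
  have "(\<lambda>x. indicator S x *\<^sub>R (norm (g x))\<^sup>2) = (\<lambda>x. (norm (indicator S x *\<^sub>R g x))\<^sup>2)"
    by (auto simp: indicator_def)
  then show ?thesis by (simp add: L2_on_def set_borel_measurable_def set_integrable_def)
qed

lemma L2_on_inner_integrable:
  fixes g h :: "plane \<Rightarrow> 'b::euclidean_space"
  assumes "L2_on S g" "L2_on S h"
  shows "set_integrable lebesgue S (\<lambda>x. inner (g x) (h x))"
proof -
  let ?g = "\<lambda>x. indicator S x *\<^sub>R g x" and ?h = "\<lambda>x. indicator S x *\<^sub>R h x"
  have [measurable]: "?g \<in> borel_measurable lebesgue" "?h \<in> borel_measurable lebesgue"
    using assms by (auto simp: L2_on_iff)
  have "integrable lebesgue (\<lambda>x. (norm (?g x))\<^sup>2 + (norm (?h x))\<^sup>2)"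
    using assms by (auto simp: L2_on_iff)
  then have "integrable lebesgue (\<lambda>x. inner (?g x) (?h x))"
  proof (rule Bochner_Integration.integrable_bound)
    show "AE x in lebesgue. norm (inner (?g x) (?h x)) \<le> norm ((norm (?g x))\<^sup>2 + (norm (?h x))\<^sup>2)"
    proof (rule AE_I2)
      fix x
      have "norm (inner (?g x) (?h x)) \<le> norm (?g x) * norm (?h x)"
        unfolding real_norm_def by (rule Cauchy_Schwarz_ineq2)
      also have "\<dots> \<le> (norm (?g x))\<^sup>2 + (norm (?h x))\<^sup>2"
        using sum_squares_bound[of "norm (?g x)" "norm (?h x)"]
          mult_nonneg_nonneg[OF norm_ge_zero norm_ge_zero, of "?g x" "?h x"] by linarith
      finally show "norm (inner (?g x) (?h x)) \<le> norm ((norm (?g x))\<^sup>2 + (norm (?h x))\<^sup>2)"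
        by simp
    qed
  qed measurable
  moreover have "(\<lambda>x. inner (?g x) (?h x)) = (\<lambda>x. indicator S x *\<^sub>R inner (g x) (h x))"
    by (auto simp: indicator_def)
  ultimately show ?thesis by (simp add: set_integrable_def)
qed

lemma L2_on_mult_integrable:
  fixes g h :: "plane \<Rightarrow> real"
  assumes "L2_on S g" "L2_on S h"
  shows "set_integrable lebesgue S (\<lambda>x. g x * h x)"
  using L2_on_inner_integrable[OF assms] by simp

lemma L2_on_lincomb:
  fixes g h :: "plane \<Rightarrow> 'b::euclidean_space"
  assumes "L2_on S g" "L2_on S h"
  shows "L2_on S (\<lambda>x. a *\<^sub>R g x + b *\<^sub>R h x)"
proof -
  have m: "(\<lambda>x. a *\<^sub>R (indicator S x *\<^sub>R g x) + b *\<^sub>R (indicator S x *\<^sub>R h x)) \<in> borel_measurable lebesgue"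
    by (intro borel_measurable_add borel_measurable_scaleR[OF borel_measurable_const])
      (use assms in \<open>simp_all only: L2_on_iff\<close>)
  have i: "set_integrable lebesgue S (\<lambda>x. a\<^sup>2 * inner (g x) (g x) + (2 * a * b) * inner (g x) (h x) + b\<^sup>2 * inner (h x) (h x))"
    by (intro set_integral_add set_integrable_mult_right L2_on_inner_integrable assms)
  have "inner (a *\<^sub>R g x + b *\<^sub>R h x) (a *\<^sub>R g x + b *\<^sub>R h x) =
     a\<^sup>2 * inner (g x) (g x) + (2 * a * b) * inner (g x) (h x) + b\<^sup>2 * inner (h x) (h x)" for x
    by (simp add: inner_add_left inner_add_right power2_eq_square inner_commute algebra_simps)
  with i have "set_integrable lebesgue S (\<lambda>x. (norm (a *\<^sub>R g x + b *\<^sub>R h x))\<^sup>2)"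
    by (simp add: power2_norm_eq_inner)
  with m show ?thesis
    by (simp add: L2_on_def set_borel_measurable_def algebra_simps)
qed

lemma L2_on_zero: "L2_on S (\<lambda>x. 0)"
  by (simp add: L2_on_iff)

lemma L2_on_inner_const:
  fixes g :: "plane \<Rightarrow> 'b::euclidean_space"
  assumes "L2_on S g"
  shows "L2_on S (\<lambda>x. inner (g x) e)"
proof -
  let ?g = "\<lambda>x. indicator S x *\<^sub>R g x"
  have [measurable]: "?g \<in> borel_measurable lebesgue"
    using assms by (auto simp: L2_on_iff)
  have "integrable lebesgue (\<lambda>x. (norm e)\<^sup>2 * (norm (?g x))\<^sup>2)"
    using assms by (auto simp: L2_on_iff)
  then have "integrable lebesgue (\<lambda>x. (norm (inner (?g x) e))\<^sup>2)"
  proof (rule Bochner_Integration.integrable_bound)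
    show "AE x in lebesgue. norm ((norm (inner (?g x) e))\<^sup>2) \<le> norm ((norm e)\<^sup>2 * (norm (?g x))\<^sup>2)"
    proof (rule AE_I2)
      fix x
      have "\<bar>inner (?g x) e\<bar>\<^sup>2 \<le> (norm (?g x) * norm e)\<^sup>2"
        by (rule power_mono[OF Cauchy_Schwarz_ineq2]) simp
      then show "norm ((norm (inner (?g x) e))\<^sup>2) \<le> norm ((norm e)\<^sup>2 * (norm (?g x))\<^sup>2)"
        by (simp only: power_mult_distrib mult.commute real_norm_def abs_power2 power2_abs abs_mult)
    qed
  qed measurable
  moreover have "(\<lambda>x. inner (?g x) e) = (\<lambda>x. indicator S x *\<^sub>R inner (g x) e)"
    by auto
  moreover have "(\<lambda>x. inner (?g x) e) \<in> borel_measurable lebesgue" by measurable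
  ultimately show ?thesis unfolding L2_on_iff by metis
qed

lemma L2_on_subset:
  assumes "L2_on S g" "T \<in> sets lebesgue" "T \<subseteq> S"
  shows "L2_on T g"
proof -
  have "(\<lambda>x. indicator T x *\<^sub>R g x) = (\<lambda>x. indicator T x *\<^sub>R (indicator S x *\<^sub>R g x))"
    using assms(3) by (intro ext) (auto simp: indicator_def)
  moreover have "(\<lambda>x. indicator T x *\<^sub>R (indicator S x *\<^sub>R g x)) \<in> borel_measurable lebesgue"
    by (rule borel_measurable_scaleR[OF borel_measurable_indicator[OF assms(2)]])
      (use assms in \<open>simp add: L2_on_iff\<close>)
  ultimately show ?thesis
    using assms by (auto simp: L2_on_def set_borel_measurable_def intro: set_integrable_subset)
qed

lemma L2_on_continuous_compact:
  assumes "continuous_on UNIV g" "compact K" "\<And>x. x \<notin> K \<Longrightarrow> g x = 0" "S \<in> sets lebesgue"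
  shows "L2_on S g"
proof -
  have m: "g \<in> borel_measurable lebesgue"
    using assms(1) by (simp add: borel_measurable_continuous_onI measurable_completion)
  have "integrable lborel (\<lambda>x. indicator K x *\<^sub>R (norm (g x))\<^sup>2)"
    using assms by (intro borel_integrable_compact continuous_intros) (auto intro: continuous_on_subset)
  then have "integrable lebesgue (\<lambda>x. indicator K x *\<^sub>R (norm (g x))\<^sup>2)"
    by (metis borel_measurable_integrable integrable_completion measurable_lborel2)
  moreover have "(\<lambda>x. indicator K x *\<^sub>R (norm (g x))\<^sup>2) = (\<lambda>x. (norm (g x))\<^sup>2)"
    by (intro ext) (use assms(3) in \<open>auto simp: indicator_def simp del: split_paired_All\<close>)
  ultimately have "L2_on UNIV g" using m by (simp add: L2_on_iff)
  then show ?thesis using assms(4) by (rule L2_on_subset) simp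
qed

subsection \<open>The fundamental lemma of the calculus of variations\<close>

text \<open>The bumps converge boundedly to the indicator of the box, so dominated convergence
  carries the vanishing integrals over to it.\<close>

lemma integral_box_eq_0:
  fixes k :: "plane \<Rightarrow> real"
  assumes "open S" "L2_on S k"
    and k: "\<And>\<phi>. test_function S \<phi> \<Longrightarrow> (LINT x:S|lebesgue. k x * \<phi> x) = 0"
    and ab: "cbox a b \<subseteq> S"
  shows "set_integrable lebesgue (box a b) k" "(LINT x:box a b|lebesgue. k x) = 0"
proof -
  let ?k = "\<lambda>x. indicator S x * k x"
  \<comment> \<open>The majorant comes from \<bar>k\<bar> \<le> 1 + k^2 on the box: \<open>k\<close>
    is square integrable and the box has finite measure.\<close>
  let ?w = "\<lambda>x. indicator (box a b) x + (?k x)\<^sup>2 :: real"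
  have [measurable]: "?k \<in> borel_measurable lebesgue"
    using assms(2) by (auto simp: L2_on_iff)
  have w: "integrable lebesgue ?w"
  proof (rule Bochner_Integration.integrable_add)
    show "integrable lebesgue (indicator (box a b) :: plane \<Rightarrow> real)"
      using lmeasurable_box[of a b] by (simp add: fmeasurable_def)
    show "integrable lebesgue (\<lambda>x. (?k x)\<^sup>2)"
      using assms(2) by (simp add: L2_on_iff)
  qed
  have bm: "box_bump a b n \<in> borel_measurable lebesgue" for n
    using C_diff_continuous[OF C_diff_box_bump[of 0]]
    by (simp add: borel_measurable_continuous_onI measurable_completion)
  have bound: "norm (?k x * box_bump a b n x) \<le> ?w x" for x n
  proof (cases "x \<in> box a b")
    case True
    have "\<bar>?k x\<bar> * \<bar>box_bump a b n x\<bar> \<le> \<bar>?k x\<bar> * 1"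
      using box_bump_bound[of a b n x] by (intro mult_left_mono) auto
    also have "\<dots> \<le> 1 + (?k x)\<^sup>2"
      using sum_squares_bound[of 1 "\<bar>?k x\<bar>"] by simp
    finally show ?thesis using True by (simp add: abs_mult)
  next
    case False
    then have "box_bump a b n x = 0" by (simp add: box_bump_eq_0_iff)
    then show ?thesis by simp
  qed
  have lim: "(\<lambda>n. ?k x * box_bump a b n x) \<longlonglongrightarrow> indicator (box a b) x * k x" for x
  proof -
    have "(\<lambda>n. ?k x * box_bump a b n x) \<longlonglongrightarrow> ?k x * indicator (box a b) x"
      by (intro tendsto_mult tendsto_const box_bump_tendsto)
    moreover have "?k x * indicator (box a b) x = indicator (box a b) x * k x"
      using ab box_subset_cbox[of a b] by (auto simp: indicator_def)
    ultimately show ?thesis by simp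
  qed
  have meas: "(\<lambda>x. indicator (box a b) x * k x) \<in> borel_measurable lebesgue"
    by (rule borel_measurable_LIMSEQ_real[OF lim]) (use bm in measurable)
  have conv: "(\<lambda>n. integral\<^sup>L lebesgue (\<lambda>x. ?k x * box_bump a b n x)) \<longlonglongrightarrow>
      integral\<^sup>L lebesgue (\<lambda>x. indicator (box a b) x * k x)"
    by (rule integral_dominated_convergence[OF meas _ w])
      (use bm lim bound in \<open>auto intro!: borel_measurable_times\<close>)
  have "integral\<^sup>L lebesgue (\<lambda>x. ?k x * box_bump a b n x) = 0" for n
    using k[OF test_function_box_bump[OF ab, of n]]
    by (simp add: set_lebesgue_integral_def mult.assoc)
  with conv show "(LINT x:box a b|lebesgue. k x) = 0"
    by (simp add: set_lebesgue_integral_def LIMSEQ_const_iff)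
  show "set_integrable lebesgue (box a b) k"
    using integrable_dominated_convergence[OF meas _ w, of "\<lambda>n x. ?k x * box_bump a b n x"] bm lim bound
    by (auto simp: set_integrable_def intro!: borel_measurable_times)
qed

text \<open>The integrals of \<open>k\<close> vanish over boxes inside \<open>S\<close>. Within one
  such box a Dynkin argument extends this to Borel sets and completion to Lebesgue sets, and a
  density whose integrals all vanish is zero a.e. Countably many boxes exhaust
  \<open>S\<close>.\<close>

lemma fundamental_lemma_variations:
  fixes k :: "plane \<Rightarrow> real"
  assumes "open S" "L2_on S k"
    and k: "\<And>\<phi>. test_function S \<phi> \<Longrightarrow> (LINT x:S|lebesgue. k x * \<phi> x) = 0"
  shows "AE x in lebesgue. x \<in> S \<longrightarrow> k x = 0"
proof -
  have box0: "set_integrable lebesgue (box a b) k" "(LINT x:box a b|lebesgue. k x) = 0"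
    if "cbox a b \<subseteq> S" for a b
    by (rule integral_box_eq_0[OF assms(1,2)]; use k that in blast)+
  have box: "AE x in lebesgue. x \<in> box a b \<longrightarrow> k x = 0" if ab: "cbox a b \<subseteq> S" for a b
  proof -
    \<comment> \<open>Cut off at the fixed box, \<open>k\<close> is integrable on the whole plane,
      so that complements can be treated by subtraction.\<close>
    let ?F = "\<lambda>x. indicator (box a b) x * k x"
    have F: "integrable lebesgue ?F"
      using box0(1)[OF ab] by (simp add: set_integrable_def)
    then have FA: "set_integrable lebesgue A ?F" if "A \<in> sets lebesgue" for A
      using that by (auto simp: set_integrable_def intro: integrable_mult_indicator[where 'b = real, simplified])
    have F0: "integral\<^sup>L lebesgue ?F = 0"
      using box0(2)[OF ab] by (simp add: set_lebesgue_integral_def)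
    have borel: "(LINT x:A|lebesgue. ?F x) = 0" if "A \<in> sets borel" for A
    proof -
      have 1: "Int_stable (range (\<lambda>(a, b). box a b :: plane set))"
        by (auto simp: Int_stable_def box_Int_box)
      have 2: "range (\<lambda>(a, b). box a b :: plane set) \<subseteq> Pow UNIV" by auto
      have 3: "A \<in> sigma_sets UNIV (range (\<lambda>(a, b). box a b))"
        using that unfolding borel_eq_box by simp
      have sets: "B \<in> sets lebesgue" if "B \<in> sigma_sets UNIV (range (\<lambda>(a, b). box a b :: plane set))" for B
      proof -
        from that have "B \<in> sets borel" unfolding borel_eq_box by simp
        then show ?thesis by simp
      qed
      from 1 2 3 show ?thesis
      proof (induction rule: sigma_sets_induct_disjoint)
        case (basic A)
        then obtain c d where A: "A = box c d" by auto
        \<comment> \<open>A generator meets the fixed box in a box whose closure still lies in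
          \<open>S\<close>.\<close>
        let ?c = "\<Sum>i\<in>Basis. max (c\<bullet>i) (a\<bullet>i) *\<^sub>R i" and ?d = "\<Sum>i\<in>Basis. min (d\<bullet>i) (b\<bullet>i) *\<^sub>R i"
        have "cbox ?c ?d \<subseteq> cbox a b" by (auto simp: mem_box)
        with ab have "(LINT x:box ?c ?d|lebesgue. k x) = 0" by (intro box0(2)) auto
        then show ?case
          unfolding A box_Int_box[symmetric]
          by (simp add: set_lebesgue_integral_def indicator_inter_arith mult.assoc)
      next
        case (compl A)
        have "(LINT x:UNIV - A|lebesgue. ?F x) = integral\<^sup>L lebesgue (\<lambda>x. ?F x - indicator A x *\<^sub>R ?F x)"
          unfolding set_lebesgue_integral_def by (intro Bochner_Integration.integral_cong) (auto simp: indicator_def)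
        also have "\<dots> = 0"
          using compl(2) F0 F FA[OF sets[OF compl(1)]]
          by (subst Bochner_Integration.integral_diff) (auto simp: set_lebesgue_integral_def set_integrable_def)
        finally show ?case .
      next
        case (union A)
        have "\<And>i. A i \<in> sets lebesgue" using union(2) sets by auto
        then have "(LINT x:(\<Union>i. A i)|lebesgue. ?F x) = (\<Sum>i. (LINT x:(A i)|lebesgue. ?F x))"
          using union(1) by (intro lebesgue_integral_countable_add FA) (auto simp: disjoint_family_on_def)
        then show ?case using union(3) by simp
      qed (simp add: set_lebesgue_integral_def)
    qed
    have "AE x in lebesgue. ?F x = 0"
    proof (rule density_unique_real[OF F Bochner_Integration.integrable_zero])
      fix A :: "plane set" assume "A \<in> sets lebesgue"
      \<comment> \<open>A Lebesgue set is a Borel set up to a null set, which the integral does not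
        see.\<close>
      then obtain B N N' where A: "A = B \<union> N" "N \<subseteq> N'" "N' \<in> null_sets lborel" "B \<in> sets lborel"
        by (rule sets_completionE)
      have "AE x in lebesgue. x \<notin> N'"
        using A(3) by (metis AE_completion AE_not_in)
      then have "AE x in lebesgue. indicator A x *\<^sub>R ?F x = indicator B x *\<^sub>R ?F x"
        by eventually_elim (use A in \<open>auto simp: indicator_def\<close>)
      then have "(LINT x:A|lebesgue. ?F x) = (LINT x:B|lebesgue. ?F x)"
        unfolding set_lebesgue_integral_def using \<open>A \<in> sets lebesgue\<close> A(4) FA
        by (intro integral_cong_AE borel_measurable_integrable) (auto simp: set_integrable_def)
      then show "(LINT x:A|lebesgue. ?F x) = (LINT x:A|lebesgue. 0)" using borel A(4) by simp
    qed
    then show ?thesis by eventually_elim (auto simp: indicator_def)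
  qed
  \<comment> \<open>The countable cover of \<open>S\<close> used below consists of closed boxes;
    their frontiers are null.\<close>
  have cbox: "AE x in lebesgue. x \<in> cbox a b \<longrightarrow> k x = 0" if "cbox a b \<subseteq> S" for a b
  proof -
    have "AE x in lebesgue. x \<notin> cbox a b - box a b"
      using negligible_frontier_interval[of a b] negligible_iff_null_sets AE_not_in by blast
    with box[OF that] show ?thesis by eventually_elim auto
  qed
  obtain D where D: "countable D" "D \<subseteq> Pow S" "\<And>X. X \<in> D \<Longrightarrow> \<exists>a b. X = cbox a b" "\<Union>D = S"
    using open_countable_Union_open_cbox[OF assms(1)] by blast
  have "AE x in lebesgue. \<forall>X\<in>D. x \<in> X \<longrightarrow> k x = 0"
    unfolding AE_ball_countable[OF D(1)]
  proof
    fix X assume X: "X \<in> D"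
    then obtain a b where "X = cbox a b" using D(3) by blast
    with X D(2) cbox[of a b] show "AE x in lebesgue. x \<in> X \<longrightarrow> k x = 0" by blast
  qed
  then show ?thesis by eventually_elim (use D(4) in blast)
qed

subsection \<open>Weak gradients\<close>

lemma test_function_gradient:
  assumes "test_function S \<phi>"
  obtains f1 f2 where "\<And>x. (\<phi> has_derivative (\<lambda>h. fst h * f1 x + snd h * f2 x)) (at x)"
    "continuous_on UNIV f1" "continuous_on UNIV f2"
    "classical_gradient \<phi> = (\<lambda>x. (f1 x, f2 x))"
    "\<And>x. x \<notin> closure {x. \<phi> x \<noteq> 0} \<Longrightarrow> f1 x = 0 \<and> f2 x = 0"
proof -
  have "C_diff (Suc 0) \<phi>" using assms by (simp add: test_function_def)
  then obtain f1 f2 where f: "\<And>x. (\<phi> has_derivative (\<lambda>h. fst h * f1 x + snd h * f2 x)) (at x)"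
    "C_diff 0 f1" "C_diff 0 f2" using C_diff_SucE by blast
  have "frechet_derivative \<phi> (at x) = (\<lambda>h. fst h * f1 x + snd h * f2 x)" for x
    using frechet_derivative_at[OF f(1)] by simp
  then have cg: "classical_gradient \<phi> = (\<lambda>x. (f1 x, f2 x))"
    by (simp add: classical_gradient_def sum_Basis_prod_eq fun_eq_iff)
  have "f1 x = 0 \<and> f2 x = 0" if "x \<notin> closure {x. \<phi> x \<noteq> 0}" for x
  proof -
    have "((\<lambda>_. 0) has_derivative (\<lambda>h. fst h * f1 x + snd h * f2 x)) (at x)"
      by (rule has_derivative_transform_within_open[OF f(1), where s = "- closure {x. \<phi> x \<noteq> 0}"])
        (use that closure_subset[of "{x. \<phi> x \<noteq> 0}"] in blast)+
    moreover have "((\<lambda>_. 0 :: real) has_derivative (\<lambda>h. 0)) (at x)" by simp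
    ultimately have eq: "(\<lambda>h. fst h * f1 x + snd h * f2 x) = (\<lambda>h. 0)"
      by (rule has_derivative_unique)
    from fun_cong[OF eq, of "(1, 0)"] fun_cong[OF eq, of "(0, 1)"] show ?thesis by simp
  qed
  with f cg that show ?thesis by auto
qed

lemma L2_on_test_function:
  assumes "test_function U \<phi>" "S \<in> sets lebesgue"
  shows "L2_on S \<phi>" "L2_on S (classical_gradient \<phi>)"
proof -
  let ?K = "closure {x. \<phi> x \<noteq> 0}"
  have K: "compact ?K" "continuous_on UNIV \<phi>"
    using assms(1) unfolding test_function_def by (blast intro: C_diff_continuous[of 0])+
  show "L2_on S \<phi>"
    by (rule L2_on_continuous_compact[OF K(2,1) _ assms(2)]) (use closure_subset[of "{x. \<phi> x \<noteq> 0}"] in blast)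
  obtain f1 f2 where f: "\<And>x. (\<phi> has_derivative (\<lambda>h. fst h * f1 x + snd h * f2 x)) (at x)"
    "continuous_on UNIV f1" "continuous_on UNIV f2"
    "classical_gradient \<phi> = (\<lambda>x. (f1 x, f2 x))"
    "\<And>x. x \<notin> closure {x. \<phi> x \<noteq> 0} \<Longrightarrow> f1 x = 0 \<and> f2 x = 0"
    by (rule test_function_gradient[OF assms(1)]) (rule that; assumption)
  have "continuous_on UNIV (classical_gradient \<phi>)"
    unfolding f(4) by (intro continuous_on_Pair f(2,3))
  then show "L2_on S (classical_gradient \<phi>)"
    by (rule L2_on_continuous_compact[OF _ K(1) _ assms(2)]) (simp add: f(4,5) zero_prod_def)
qed

lemma test_function_mono: "test_function S \<phi> \<Longrightarrow> S \<subseteq> T \<Longrightarrow> test_function T \<phi>"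
  by (auto simp: test_function_def)

lemma set_integral_cong_simple:
  assumes "\<And>x. x \<in> S \<Longrightarrow> f x = g x"
  shows "set_lebesgue_integral M S f = set_lebesgue_integral M S g"
  unfolding set_lebesgue_integral_def
  using assms by (intro Bochner_Integration.integral_cong) (auto simp: indicator_def)

lemma is_weak_gradientD:
  assumes "is_weak_gradient S u g"
  shows "L2_on S g"
    and "test_function S \<phi> \<Longrightarrow> e \<in> Basis \<Longrightarrow>
      (LINT x:S|lebesgue. u x * inner (classical_gradient \<phi> x) e) = - (LINT x:S|lebesgue. inner (g x) e * \<phi> x)"
  using assms unfolding is_weak_gradient_def by blast+

lemma is_weak_gradient_cong:
  assumes "\<And>x. x \<in> S \<Longrightarrow> u x = v x"
  shows "is_weak_gradient S u g \<longleftrightarrow> is_weak_gradient S v g"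
proof -
  have "(LINT x:S|lebesgue. u x * f x) = (LINT x:S|lebesgue. v x * f x)" for f :: "plane \<Rightarrow> real"
    using assms by (intro set_integral_cong_simple) simp
  then show ?thesis unfolding is_weak_gradient_def by (simp only:)
qed

text \<open>The choice depends on the predicate \<open>is_weak_gradient\<close> alone, so equality
  of the functions on \<open>S\<close> gives the same gradient at every point, not only almost
  everywhere.\<close>

lemma grad_cong:
  assumes "\<And>x. x \<in> S \<Longrightarrow> u x = v x"
  shows "grad S u = grad S v"
proof -
  have "is_weak_gradient S u g = is_weak_gradient S v g" for g
    using assms by (rule is_weak_gradient_cong)
  then show ?thesis by (simp add: grad_def)
qed

lemma grad_inner_cong:
  assumes "\<And>x. x \<in> S \<Longrightarrow> u x = u' x" "\<And>x. x \<in> S \<Longrightarrow> v x = v' x"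
  shows "grad_inner S u v = grad_inner S u' v'"
proof -
  have "grad S u = grad S u'" using assms(1) by (rule grad_cong)
  moreover have "grad S v = grad S v'" using assms(2) by (rule grad_cong)
  ultimately show ?thesis by (simp add: grad_inner_def)
qed

lemma is_weak_gradient_lincomb:
  assumes "open S" "L2_on S u" "L2_on S v" "is_weak_gradient S u g" "is_weak_gradient S v h"
  shows "is_weak_gradient S (\<lambda>x. a * u x + b * v x) (\<lambda>x. a *\<^sub>R g x + b *\<^sub>R h x)"
  unfolding is_weak_gradient_def
proof (intro conjI allI impI ballI)
  have S: "S \<in> sets lebesgue" using assms(1) by simp
  have gh: "L2_on S g" "L2_on S h"
    using is_weak_gradientD(1)[OF assms(4)] is_weak_gradientD(1)[OF assms(5)] .
  then show "L2_on S (\<lambda>x. a *\<^sub>R g x + b *\<^sub>R h x)" by (rule L2_on_lincomb)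
  fix \<phi> and e :: plane assume \<phi>: "test_function S \<phi>" and e: "e \<in> Basis"
  let ?d = "\<lambda>x. inner (classical_gradient \<phi> x) e"
  note L2 = L2_on_test_function[OF \<phi> S]
  have d: "L2_on S ?d" using L2(2) by (rule L2_on_inner_const)
  have "(LINT x:S|lebesgue. (a * u x + b * v x) * ?d x) =
      (LINT x:S|lebesgue. a * (u x * ?d x) + b * (v x * ?d x))"
    by (simp add: algebra_simps)
  also have "\<dots> = a * (LINT x:S|lebesgue. u x * ?d x) + b * (LINT x:S|lebesgue. v x * ?d x)"
    using L2_on_mult_integrable[OF assms(2) d] L2_on_mult_integrable[OF assms(3) d]
    by (simp add: set_integral_add)
  also have "\<dots> = - (a * (LINT x:S|lebesgue. inner (g x) e * \<phi> x) + b * (LINT x:S|lebesgue. inner (h x) e * \<phi> x))"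
    by (simp add: is_weak_gradientD(2)[OF assms(4) \<phi> e] is_weak_gradientD(2)[OF assms(5) \<phi> e])
  also have "\<dots> = - (LINT x:S|lebesgue. a * (inner (g x) e * \<phi> x) + b * (inner (h x) e * \<phi> x))"
    using L2_on_mult_integrable[OF L2_on_inner_const[OF gh(1), of e] L2(1)]
      L2_on_mult_integrable[OF L2_on_inner_const[OF gh(2), of e] L2(1)]
    by (simp add: set_integral_add)
  finally show "(LINT x:S|lebesgue. (a * u x + b * v x) * ?d x) =
      - (LINT x:S|lebesgue. inner (a *\<^sub>R g x + b *\<^sub>R h x) e * \<phi> x)"
    by (simp add: algebra_simps)
qed

lemma is_weak_gradient_zero: "is_weak_gradient S (\<lambda>x. 0) (\<lambda>x. 0)"
  by (simp add: is_weak_gradient_def L2_on_zero)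

text \<open>Componentwise, the difference of two weak gradients annihilates all test functions. This
  makes the arbitrary choice in \<open>grad\<close> harmless under integrals.\<close>

lemma is_weak_gradient_unique:
  assumes S: "open S" and g: "is_weak_gradient S u g" and h: "is_weak_gradient S u h"
  shows "AE x in lebesgue. x \<in> S \<longrightarrow> g x = h x"
proof -
  have L: "S \<in> sets lebesgue" "L2_on S g" "L2_on S h"
    using S is_weak_gradientD(1)[OF g] is_weak_gradientD(1)[OF h] by auto
  have "AE x in lebesgue. x \<in> S \<longrightarrow> inner (g x) e - inner (h x) e = 0" if e: "e \<in> Basis" for e
  proof (rule fundamental_lemma_variations[OF S])
    show "L2_on S (\<lambda>x. inner (g x) e - inner (h x) e)"
      using L2_on_lincomb[OF L2_on_inner_const[OF L(2), of e] L2_on_inner_const[OF L(3), of e], of 1 "-1"]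
      by simp
    fix \<phi> assume \<phi>: "test_function S \<phi>"
    have "(LINT x:S|lebesgue. (inner (g x) e - inner (h x) e) * \<phi> x) =
       (LINT x:S|lebesgue. inner (g x) e * \<phi> x) - (LINT x:S|lebesgue. inner (h x) e * \<phi> x)"
      using L2_on_mult_integrable[OF L2_on_inner_const[OF L(2), of e] L2_on_test_function(1)[OF \<phi> L(1)]]
        L2_on_mult_integrable[OF L2_on_inner_const[OF L(3), of e] L2_on_test_function(1)[OF \<phi> L(1)]]
      by (simp add: set_integral_diff left_diff_distrib)
    also have "\<dots> = 0"
    proof -
      have "(LINT x:S|lebesgue. u x * inner (classical_gradient \<phi> x) e) = - (LINT x:S|lebesgue. inner (g x) e * \<phi> x)"
        by (rule is_weak_gradientD(2)[OF g \<phi> e])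
      moreover have "(LINT x:S|lebesgue. u x * inner (classical_gradient \<phi> x) e) = - (LINT x:S|lebesgue. inner (h x) e * \<phi> x)"
        by (rule is_weak_gradientD(2)[OF h \<phi> e])
      ultimately have "- (LINT x:S|lebesgue. inner (g x) e * \<phi> x) = - (LINT x:S|lebesgue. inner (h x) e * \<phi> x)"
        by (rule trans[OF sym])
      then show ?thesis by simp
    qed
    finally show "(LINT x:S|lebesgue. (inner (g x) e - inner (h x) e) * \<phi> x) = 0" .
  qed
  then have "AE x in lebesgue. \<forall>e\<in>Basis. x \<in> S \<longrightarrow> inner (g x) e - inner (h x) e = 0"
    unfolding AE_ball_countable[OF countable_finite[OF finite_Basis]] by (intro ballI)
  then show ?thesis
  proof eventually_elim
    case (elim x)
    show ?case unfolding euclidean_eq_iff[of "g x" "h x"] using elim by simp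
  qed
qed

text \<open>Any weak gradients may replace the chosen ones. Linearity, restriction and reflection of
  \<open>grad_inner\<close> thereby reduce to exhibiting a suitable weak gradient.\<close>

lemma grad_inner_eq:
  assumes S: "open S" and g: "is_weak_gradient S u g" and h: "is_weak_gradient S v h"
  shows "grad_inner S u v = (LINT x:S|lebesgue. inner (g x) (h x))"
proof -
  have G: "is_weak_gradient S u (grad S u)" "is_weak_gradient S v (grad S v)"
    unfolding grad_def by (rule someI[of _ g], fact, rule someI[of _ h], fact)
  have "AE x in lebesgue. x \<in> S \<longrightarrow> grad S u x = g x" "AE x in lebesgue. x \<in> S \<longrightarrow> grad S v x = h x"
    by (rule is_weak_gradient_unique[OF S]; fact)+
  then have "AE x in lebesgue. indicator S x *\<^sub>R inner (grad S u x) (grad S v x) = indicator S x *\<^sub>R inner (g x) (h x)"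
    by eventually_elim (auto simp: indicator_def)
  moreover have "set_integrable lebesgue S (\<lambda>x. inner (grad S u x) (grad S v x))"
    "set_integrable lebesgue S (\<lambda>x. inner (g x) (h x))"
    by (intro L2_on_inner_integrable is_weak_gradientD(1)[OF G(1)] is_weak_gradientD(1)[OF G(2)]
        is_weak_gradientD(1)[OF g] is_weak_gradientD(1)[OF h])+
  ultimately show ?thesis
    unfolding grad_inner_def set_lebesgue_integral_def set_integrable_def
    by (intro integral_cong_AE borel_measurable_integrable) auto
qed

lemma is_weak_gradient_grad: "u \<in> H1 S \<Longrightarrow> is_weak_gradient S u (grad S u)"
  unfolding H1_def grad_def mem_Collect_eq by (elim conjE) (erule someI_ex)

lemma H1_L2: "u \<in> H1 S \<Longrightarrow> L2_on S u" "u \<in> H1 S \<Longrightarrow> L2_on S (grad S u)"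
  using is_weak_gradientD(1)[OF is_weak_gradient_grad[of u S]] by (auto simp: H1_def)

lemma H1_lincomb:
  assumes "open S" "u \<in> H1 S" "v \<in> H1 S"
  shows "(\<lambda>x. a * u x + b * v x) \<in> H1 S"
  using is_weak_gradient_lincomb[OF assms(1) H1_L2(1)[OF assms(2)] H1_L2(1)[OF assms(3)]
      is_weak_gradient_grad[OF assms(2)] is_weak_gradient_grad[OF assms(3)], of a b]
    L2_on_lincomb[OF H1_L2(1)[OF assms(2)] H1_L2(1)[OF assms(3)], of a b]
  unfolding H1_def by auto

lemma H1_zero: "(\<lambda>x. 0) \<in> H1 S"
  unfolding H1_def mem_Collect_eq by (intro conjI L2_on_zero exI[of _ "\<lambda>x. 0"] is_weak_gradient_zero)

lemma grad_inner_commute: "grad_inner S u v = grad_inner S v u"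
  unfolding grad_inner_def by (simp add: inner_commute)

lemma grad_inner_lincomb:
  assumes S: "open S" and "u \<in> H1 S" "v \<in> H1 S" "w \<in> H1 S"
  shows "grad_inner S (\<lambda>x. a * u x + b * v x) w = a * grad_inner S u w + b * grad_inner S v w"
proof -
  note g = is_weak_gradient_grad[OF assms(2)] is_weak_gradient_grad[OF assms(3)] is_weak_gradient_grad[OF assms(4)]
  note L = H1_L2[OF assms(2)] H1_L2[OF assms(3)] H1_L2[OF assms(4)]
  have "grad_inner S (\<lambda>x. a * u x + b * v x) w =
     (LINT x:S|lebesgue. inner (a *\<^sub>R grad S u x + b *\<^sub>R grad S v x) (grad S w x))"
    by (rule grad_inner_eq[OF S is_weak_gradient_lincomb[OF S L(1,3) g(1,2)] g(3)])
  also have "\<dots> = (LINT x:S|lebesgue. a * inner (grad S u x) (grad S w x) + b * inner (grad S v x) (grad S w x))"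
    by (simp add: inner_add_left)
  also have "\<dots> = a * grad_inner S u w + b * grad_inner S v w"
    using L2_on_inner_integrable[OF L(2,6)] L2_on_inner_integrable[OF L(4,6)]
    by (simp add: set_integral_add grad_inner_def)
  finally show ?thesis .
qed

lemma grad_inner_nonneg: "grad_inner S u u \<ge> 0"
  unfolding grad_inner_def set_lebesgue_integral_def by (rule Bochner_Integration.integral_nonneg) auto

text \<open>A test function on \<open>T\<close> is also one on \<open>S\<close>, and both integrands
  vanish off \<open>T\<close>, so the integrals over \<open>T\<close> and over \<open>S\<close>
  agree.\<close>

lemma is_weak_gradient_subset:
  assumes T: "open T" "T \<subseteq> S" and g: "is_weak_gradient S u g"
  shows "is_weak_gradient T u g"
  unfolding is_weak_gradient_def
proof (intro conjI allI impI ballI)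
  show "L2_on T g"
    using is_weak_gradientD(1)[OF g] T by (auto intro: L2_on_subset)
  fix \<phi> and e :: plane assume \<phi>: "test_function T \<phi>" and e: "e \<in> Basis"
  have z: "\<phi> x = 0 \<and> classical_gradient \<phi> x = 0" if "x \<notin> T" for x
  proof -
    have "x \<notin> closure {x. \<phi> x \<noteq> 0}" using that \<phi> by (auto simp: test_function_def)
    moreover from this have "x \<notin> {x. \<phi> x \<noteq> 0}"
      using closure_subset[of "{x. \<phi> x \<noteq> 0}"] by blast
    moreover obtain f1 f2 where f: "\<And>x. (\<phi> has_derivative (\<lambda>h. fst h * f1 x + snd h * f2 x)) (at x)"
      "continuous_on UNIV f1" "continuous_on UNIV f2"
      "classical_gradient \<phi> = (\<lambda>x. (f1 x, f2 x))"
      "\<And>x. x \<notin> closure {x. \<phi> x \<noteq> 0} \<Longrightarrow> f1 x = 0 \<and> f2 x = 0"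
      by (rule test_function_gradient[OF \<phi>]) (rule that; assumption)
    ultimately show ?thesis by (simp add: f(4,5) zero_prod_def)
  qed
  have "(LINT x:T|lebesgue. f x) = (LINT x:S|lebesgue. f x)" if "\<And>x. x \<notin> T \<Longrightarrow> f x = 0" for f :: "plane \<Rightarrow> real"
    unfolding set_lebesgue_integral_def
    using that T(2) by (intro Bochner_Integration.integral_cong) (auto simp: indicator_def simp del: split_paired_All)
  with z show "(LINT x:T|lebesgue. u x * inner (classical_gradient \<phi> x) e) =
      - (LINT x:T|lebesgue. inner (g x) e * \<phi> x)"
    using is_weak_gradientD(2)[OF g test_function_mono[OF \<phi> T(2)] e] by simp
qed

lemma H1_subset:
  assumes "open T" "T \<subseteq> S" "u \<in> H1 S"
  shows "u \<in> H1 T"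
  using is_weak_gradient_subset[OF assms(1,2) is_weak_gradient_grad[OF assms(3)]]
    L2_on_subset[OF H1_L2(1)[OF assms(3)], of T] assms
  unfolding H1_def by auto

lemma grad_inner_subset:
  assumes "open T" "T \<subseteq> S" "u \<in> H1 S" "v \<in> H1 S"
  shows "grad_inner T u v = (LINT x:T|lebesgue. inner (grad S u x) (grad S v x))"
  by (intro grad_inner_eq is_weak_gradient_subset[of T S] is_weak_gradient_grad assms)

subsection \<open>Reflections\<close>

text \<open>The axis is the line x_1 = c / 2, so the reflection at interface \<open>i\<close> is
  \<open>mirror (2 * real i)\<close>.\<close>

definition mirror :: "real \<Rightarrow> plane \<Rightarrow> plane" where
  "mirror c x = (c - fst x, snd x)"

lemma mirror_mirror [simp]: "mirror c (mirror c x) = x"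
  by (simp add: mirror_def)

text \<open>The coordinatewise affine form to which the transformation rule for Lebesgue measure
  applies.\<close>

lemma mirror_affine:
  "mirror c = (\<lambda>x. (c, 0) + (\<Sum>j\<in>Basis. ((if j = (1, 0) then - 1 else 1) * inner x j) *\<^sub>R j))"
  by (auto simp: mirror_def sum_Basis_prod_eq fun_eq_iff)

lemma mirror_measurable: "mirror c \<in> lebesgue \<rightarrow>\<^sub>M lebesgue"
  unfolding mirror_affine by (rule lebesgue_affine_measurable) auto

lemma distr_mirror: "distr lebesgue lebesgue (mirror c) = lebesgue"
proof -
  have "(\<Prod>j\<in>(Basis :: plane set). \<bar>if j = (1, 0) then - 1 else 1 :: real\<bar>) = 1"
    by (rule prod.neutral) auto
  then show ?thesis
    using lebesgue_affine_euclidean[of "\<lambda>j::plane. if j = (1, 0) then - 1 else 1" "(c, 0)"]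
    unfolding mirror_affine[symmetric] by (simp add: density_1)
qed

lemma continuous_on_mirror: "continuous_on A (mirror c)"
  unfolding mirror_def by (intro continuous_intros)

lemma mirror_vimage: "mirror c -` S = mirror c ` S"
proof
  show "mirror c -` S \<subseteq> mirror c ` S"
  proof
    fix x assume "x \<in> mirror c -` S"
    then have "mirror c (mirror c x) \<in> mirror c ` S" by blast
    then show "x \<in> mirror c ` S" by simp
  qed
qed auto

text \<open>One inclusion is continuity; the other is the same inclusion for the mirrored set, since
  \<open>mirror c\<close> is an involution.\<close>

lemma closure_mirror: "closure (mirror c -` S) = mirror c -` closure S"
proof
  have sub: "closure (mirror c -` S) \<subseteq> mirror c -` closure S" for S
    by (intro closure_minimal vimage_mono closure_subset closed_vimage closed_closure continuous_on_mirror)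
  then show "closure (mirror c -` S) \<subseteq> mirror c -` closure S" .
  have "closure S \<subseteq> mirror c -` closure (mirror c -` S)"
    using sub[of "mirror c -` S"] by (simp add: vimage_def)
  then show "mirror c -` closure S \<subseteq> closure (mirror c -` S)"
    by (auto simp: vimage_def simp del: split_paired_All dest!: subsetD)
qed

lemma integral_mirror:
  fixes f :: "plane \<Rightarrow> 'b::euclidean_space"
  assumes "f \<in> borel_measurable lebesgue"
  shows "integral\<^sup>L lebesgue (\<lambda>x. f (mirror c x)) = integral\<^sup>L lebesgue f"
  using integral_distr[OF mirror_measurable assms] by (simp add: distr_mirror)

lemma integrable_mirror:
  fixes f :: "plane \<Rightarrow> 'b::euclidean_space"
  assumes "integrable lebesgue f"
  shows "integrable lebesgue (\<lambda>x. f (mirror c x))"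
  using integrable_distr[OF mirror_measurable, of c f] assms by (simp add: distr_mirror)

lemma indicator_mirror: "indicator (mirror c -` S) x = indicator S (mirror c x)"
  by (simp add: indicator_def)

lemma L2_on_mirror:
  assumes "L2_on S g"
  shows "L2_on (mirror c -` S) (\<lambda>x. g (mirror c x))"
proof -
  have g: "(\<lambda>x. indicator S x *\<^sub>R g x) \<in> borel_measurable lebesgue"
    "integrable lebesgue (\<lambda>x. (norm (indicator S x *\<^sub>R g x))\<^sup>2)"
    using assms unfolding L2_on_iff by auto
  show ?thesis
    unfolding L2_on_iff indicator_mirror
    using measurable_compose[OF mirror_measurable g(1)] integrable_mirror[OF g(2)] by blast
qed

lemma set_integral_mirror:
  fixes f :: "plane \<Rightarrow> real"
  assumes "set_integrable lebesgue S f"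
  shows "(LINT x:mirror c -` S|lebesgue. f (mirror c x)) = (LINT x:S|lebesgue. f x)"
  using integral_mirror[OF borel_measurable_integrable[OF assms[unfolded set_integrable_def]], of c]
  by (simp add: set_lebesgue_integral_def indicator_mirror)

text \<open>The differential of every \<open>mirror c\<close>. Gradients of mirrored functions pick
  it up, and as an isometry it leaves energies unchanged.\<close>

definition flip :: "plane \<Rightarrow> plane" where
  "flip v = (- fst v, snd v)"

lemma inner_flip_flip [simp]: "inner (flip v) (flip w) = inner v w"
  by (simp add: flip_def inner_prod_def)

lemma test_function_mirror:
  assumes "test_function (mirror c -` S) \<phi>"
  shows "test_function S (\<lambda>x. \<phi> (mirror c x))"
    and "classical_gradient (\<lambda>x. \<phi> (mirror c x)) x = flip (classical_gradient \<phi> (mirror c x))"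
proof -
  have "C_diff k (\<lambda>x. \<phi> (mirror c x))" for k
    using C_diff_compose_affine[of k \<phi> "-1" c 1 0] assms by (simp add: mirror_def test_function_def)
  moreover have cl: "closure {x. \<phi> (mirror c x) \<noteq> 0} = mirror c ` closure {x. \<phi> x \<noteq> 0}"
    using closure_mirror[of c "{x. \<phi> x \<noteq> 0}"] by (simp add: vimage_def flip: mirror_vimage)
  ultimately show "test_function S (\<lambda>x. \<phi> (mirror c x))"
    using assms compact_continuous_image[OF continuous_on_mirror, of "closure {x. \<phi> x \<noteq> 0}" c]
    unfolding test_function_def cl by auto
  obtain f1 f2 where f: "\<And>x. (\<phi> has_derivative (\<lambda>h. fst h * f1 x + snd h * f2 x)) (at x)"
    "continuous_on UNIV f1" "continuous_on UNIV f2"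
    "classical_gradient \<phi> = (\<lambda>x. (f1 x, f2 x))"
    "\<And>x. x \<notin> closure {x. \<phi> x \<noteq> 0} \<Longrightarrow> f1 x = 0 \<and> f2 x = 0"
    by (rule test_function_gradient[OF assms]) (rule that; assumption)
  have "(mirror c has_derivative (\<lambda>h. (- fst h, snd h))) (at x)" for x
    unfolding mirror_def by (auto intro!: derivative_eq_intros)
  from has_derivative_compose[OF this f(1)]
  have "((\<lambda>x. \<phi> (mirror c x)) has_derivative
     (\<lambda>h. - fst h * f1 (mirror c x) + snd h * f2 (mirror c x))) (at x)" for x by simp
  then have fd: "frechet_derivative (\<lambda>x. \<phi> (mirror c x)) (at x) =
     (\<lambda>h. - fst h * f1 (mirror c x) + snd h * f2 (mirror c x))" for x
    by (rule frechet_derivative_at[symmetric])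
  show "classical_gradient (\<lambda>x. \<phi> (mirror c x)) x = flip (classical_gradient \<phi> (mirror c x))"
    unfolding f(4) by (simp add: classical_gradient_def sum_Basis_prod_eq flip_def fd)
qed

lemma is_weak_gradient_mirror:
  assumes S: "open S" and u: "L2_on S u" and g: "is_weak_gradient S u g"
  shows "is_weak_gradient (mirror c -` S) (\<lambda>x. u (mirror c x)) (\<lambda>x. flip (g (mirror c x)))"
  unfolding is_weak_gradient_def
proof (intro conjI allI impI ballI)
  have L: "S \<in> sets lebesgue" "L2_on S g"
    using S is_weak_gradientD(1)[OF g] by auto
  have fl: "(\<lambda>x. indicator S x *\<^sub>R flip (g x)) = (\<lambda>x. flip (indicator S x *\<^sub>R g x))"
    by (auto simp: flip_def)
  have "continuous_on UNIV flip"
    unfolding flip_def by (intro continuous_intros)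
  then have "flip \<in> borel_measurable borel" by (rule borel_measurable_continuous_onI)
  moreover have "(\<lambda>x. indicator S x *\<^sub>R g x) \<in> borel_measurable lebesgue"
    using L(2) unfolding L2_on_iff by simp
  ultimately have "(\<lambda>x. indicator S x *\<^sub>R flip (g x)) \<in> borel_measurable lebesgue"
    unfolding fl by (intro measurable_compose[of _ lebesgue borel flip])
  moreover have "(norm (flip v))\<^sup>2 = (norm v)\<^sup>2" for v
    by (simp add: power2_norm_eq_inner)
  ultimately have fg: "L2_on S (\<lambda>x. flip (g x))"
    using L(2) by (simp add: L2_on_def set_borel_measurable_def)
  then show "L2_on (mirror c -` S) (\<lambda>x. flip (g (mirror c x)))" by (rule L2_on_mirror)
  fix \<phi> and e :: plane assume \<phi>: "test_function (mirror c -` S) \<phi>" and e: "e \<in> Basis"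
  \<comment> \<open>\<open>s\<close> is the eigenvalue of \<open>flip\<close> at \<open>e\<close>:
    -1 in the first coordinate direction, 1 in the second.\<close>
  obtain s where s: "\<And>w. inner (flip w) e = s * inner w e"
  proof (cases "e = (1, 0)")
    case True
    then show ?thesis using that[of "-1"] by (simp add: flip_def inner_prod_def)
  next
    case False
    with e have "e = (0, 1)" by (auto simp: Basis_prod_def)
    then show ?thesis using that[of 1] by (simp add: flip_def inner_prod_def)
  qed
  let ?\<psi> = "\<lambda>x. \<phi> (mirror c x)"
  note \<psi> = test_function_mirror[OF \<phi>]
  note L\<psi> = L2_on_test_function[OF \<psi>(1) L(1)]
  have cg: "classical_gradient \<phi> x = flip (classical_gradient ?\<psi> (mirror c x))" for x
    unfolding \<psi>(2) by (simp add: flip_def)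
  have "(LINT x:mirror c -` S|lebesgue. u (mirror c x) * inner (classical_gradient \<phi> x) e) =
     (LINT x:mirror c -` S|lebesgue. s * (u (mirror c x) * inner (classical_gradient ?\<psi> (mirror c x)) e))"
    unfolding cg s by (simp add: algebra_simps)
  also have "\<dots> = s * (LINT x:S|lebesgue. u x * inner (classical_gradient ?\<psi> x) e)"
    using set_integral_mirror[OF L2_on_mult_integrable[OF u L2_on_inner_const[OF L\<psi>(2), of e]], of c]
    by simp
  also have "\<dots> = - s * (LINT x:S|lebesgue. inner (g x) e * ?\<psi> x)"
    by (simp add: is_weak_gradientD(2)[OF g \<psi>(1) e])
  also have "\<dots> = - (s * (LINT x:mirror c -` S|lebesgue. inner (g (mirror c x)) e * \<phi> x))"
    using set_integral_mirror[OF L2_on_mult_integrable[OF L2_on_inner_const[OF L(2), of e] L\<psi>(1)], of c]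
    by simp
  also have "\<dots> = - (LINT x:mirror c -` S|lebesgue. s * (inner (g (mirror c x)) e * \<phi> x))"
    by simp
  finally show "(LINT x:mirror c -` S|lebesgue. u (mirror c x) * inner (classical_gradient \<phi> x) e) =
     - (LINT x:mirror c -` S|lebesgue. inner (flip (g (mirror c x))) e * \<phi> x)"
    unfolding s by (simp add: mult.assoc)
qed

lemma open_mirror: "open S \<Longrightarrow> open (mirror c -` S)"
  by (rule open_vimage[OF _ continuous_on_mirror])

lemma grad_inner_mirror:
  assumes S: "open S" and u: "u \<in> H1 S" and v: "v \<in> H1 S"
  shows "grad_inner (mirror c -` S) (\<lambda>x. u (mirror c x)) (\<lambda>x. v (mirror c x)) = grad_inner S u v"
proof -
  have "grad_inner (mirror c -` S) (\<lambda>x. u (mirror c x)) (\<lambda>x. v (mirror c x)) =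
     (LINT x:mirror c -` S|lebesgue. inner (flip (grad S u (mirror c x))) (flip (grad S v (mirror c x))))"
    by (intro grad_inner_eq open_mirror is_weak_gradient_mirror S H1_L2(1) is_weak_gradient_grad u v)
  also have "\<dots> = (LINT x:S|lebesgue. inner (grad S u x) (grad S v x))"
    using set_integral_mirror[OF L2_on_inner_integrable[OF H1_L2(2)[OF u] H1_L2(2)[OF v]], of c] by simp
  finally show ?thesis by (simp add: grad_inner_def)
qed

subsection \<open>The Poincare inequality\<close>

lemma grad_inner_eq_0_AE:
  assumes u: "u \<in> H1 S" and 0: "grad_inner S u u = 0"
  shows "AE x in lebesgue. x \<in> S \<longrightarrow> grad S u x = 0"
proof -
  have i: "integrable lebesgue (\<lambda>x. indicator S x *\<^sub>R inner (grad S u x) (grad S u x))"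
    using L2_on_inner_integrable[OF H1_L2(2)[OF u] H1_L2(2)[OF u]] by (simp add: set_integrable_def)
  have "AE x in lebesgue. indicator S x *\<^sub>R inner (grad S u x) (grad S u x) = 0"
    using 0 unfolding grad_inner_def set_lebesgue_integral_def
    by (subst (asm) integral_nonneg_eq_0_iff_AE[OF i]) auto
  then show ?thesis by eventually_elim (auto simp: indicator_def)
qed

text \<open>The part of \<open>S\<close> where \<open>u\<close> is nonzero is open and negligible,
  hence empty.\<close>

lemma continuous_AE_0:
  fixes u :: "plane \<Rightarrow> real"
  assumes S: "open S" and u: "continuous_on S u" and 0: "AE x in lebesgue. x \<in> S \<longrightarrow> u x = 0"
  shows "\<forall>x\<in>S. u x = 0"
proof -
  let ?A = "S \<inter> u -` (- {0})"
  have "open ?A" by (rule continuous_open_preimage[OF u S]) (simp add: open_Compl)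
  moreover have "negligible ?A"
  proof -
    obtain N where N: "\<And>x. x \<in> space lebesgue - N \<Longrightarrow> x \<in> S \<longrightarrow> u x = 0" "N \<in> null_sets lebesgue"
      using 0 by (rule AE_E3) (rule that)
    from N(1) have "?A \<subseteq> N" by auto
    then show ?thesis using N(2) negligible_iff_null_sets negligible_subset by blast
  qed
  ultimately have "?A = {}" using open_not_negligible by blast
  then show ?thesis by blast
qed

text \<open>Testing the weak gradient with \<open>x\<^sub>1 \<phi>\<close> for a test function \<open>\<phi>\<close> close to \<open>u\<close> gives
  \<open>\<integral> u \<phi> = - \<integral> u x\<^sub>1 \<partial>\<^sub>1\<phi>\<close>, and the right-hand side is small.\<close>

lemma H10_grad_0:
  assumes S: "open S" and strip: "\<And>x. x \<in> S \<Longrightarrow> \<bar>fst x\<bar> \<le> L"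
    and u: "u \<in> H10 S" and 0: "grad_inner S u u = 0"
  shows "AE x in lebesgue. x \<in> S \<longrightarrow> u x = 0"
proof -
  have Sm: "S \<in> sets lebesgue" using S by simp
  have uH: "u \<in> H1 S" using u by (simp add: H10_def)
  note Lu = H1_L2[OF uH]
  note G = grad_inner_eq_0_AE[OF uH 0]
  let ?I = "LINT x:S|lebesgue. (u x)\<^sup>2"
  have uu: "set_integrable lebesgue S (\<lambda>x. (u x)\<^sup>2)"
    using L2_on_mult_integrable[OF Lu(1) Lu(1)] by (simp add: power2_eq_square)
  have "?I \<le> 2 * ((1 + L\<^sup>2) * \<epsilon>)" if "\<epsilon> > 0" for \<epsilon>
  proof -
    obtain \<phi> where \<phi>: "test_function S \<phi>" and small: "(LINT x:S|lebesgue. (u x - \<phi> x)\<^sup>2) +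
        (LINT x:S|lebesgue. (norm (grad S u x - classical_gradient \<phi> x))\<^sup>2) < \<epsilon>"
      using u \<open>\<epsilon> > 0\<close> unfolding H10_def by blast
    obtain f1 f2 where f: "\<And>x. (\<phi> has_derivative (\<lambda>h. fst h * f1 x + snd h * f2 x)) (at x)"
      "continuous_on UNIV f1" "continuous_on UNIV f2"
      "classical_gradient \<phi> = (\<lambda>x. (f1 x, f2 x))"
      "\<And>x. x \<notin> closure {x. \<phi> x \<noteq> 0} \<Longrightarrow> f1 x = 0 \<and> f2 x = 0"
      by (rule test_function_gradient[OF \<phi>]) (rule that; assumption)
    let ?\<psi> = "\<lambda>x. fst x * \<phi> x" and ?e = "(1, 0) :: plane"
    have \<psi>: "test_function S ?\<psi>"
    proof -
      have "closure {x. ?\<psi> x \<noteq> 0} \<subseteq> closure {x. \<phi> x \<noteq> 0}"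
        by (rule closure_mono) auto
      moreover have "C_diff k ?\<psi>" for k
        using \<phi> by (intro C_diff_mult C_diff_fst) (simp add: test_function_def)
      ultimately show ?thesis
        using \<phi> bounded_subset[of "closure {x. \<phi> x \<noteq> 0}" "{x. ?\<psi> x \<noteq> 0}"] closure_subset[of "{x. ?\<psi> x \<noteq> 0}"]
        unfolding test_function_def compact_closure by (blast intro: bounded_closure)
    qed
    have "(?\<psi> has_derivative (\<lambda>h. fst h * (\<phi> x + fst x * f1 x) + snd h * (fst x * f2 x))) (at x)" for x
      by (rule has_derivative_eq_rhs[OF has_derivative_mult[OF has_derivative_fst[OF has_derivative_ident] f(1)]])
        (auto simp: algebra_simps)
    then have fd: "frechet_derivative ?\<psi> (at x) = (\<lambda>h. fst h * (\<phi> x + fst x * f1 x) + snd h * (fst x * f2 x))" for x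
      by (rule frechet_derivative_at[symmetric])
    have cg: "inner (classical_gradient ?\<psi> x) ?e = \<phi> x + fst x * f1 x" for x
      by (simp add: classical_gradient_def sum_Basis_prod_eq inner_prod_def fd)
    note L\<phi> = L2_on_test_function[OF \<phi> Sm] and L\<psi> = L2_on_test_function[OF \<psi> Sm]
    let ?d = "\<lambda>x. \<phi> x + fst x * f1 x"
    have ud: "set_integrable lebesgue S (\<lambda>x. u x * ?d x)"
      using L2_on_mult_integrable[OF Lu(1) L2_on_inner_const[OF L\<psi>(2), of ?e]] by (simp add: cg)
    have "(LINT x:S|lebesgue. u x * ?d x) = - (LINT x:S|lebesgue. inner (grad S u x) ?e * ?\<psi> x)"
      using is_weak_gradientD(2)[OF is_weak_gradient_grad[OF uH] \<psi>, of ?e] by (simp add: cg Basis_prod_def)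
    also have "(LINT x:S|lebesgue. inner (grad S u x) ?e * ?\<psi> x) = 0"
      unfolding set_lebesgue_integral_def
      by (rule integral_eq_zero_AE) (use G in eventually_elim, auto simp: indicator_def)
    finally have ud0: "(LINT x:S|lebesgue. u x * ?d x) = 0" by simp
    \<comment> \<open>Subtracting u * ?d from u^2 leaves u (u - \<phi>) - u x_1 f1. Young's
      inequality, with weight 1/4 on u^2 in each product, leaves only half of the left-hand integral
      to be absorbed. Since \<open>grad S u\<close> vanishes a.e., the gradient of \<phi> is itself
      the approximation error of the gradient.\<close>
    let ?b = "\<lambda>x. (u x)\<^sup>2 / 2 + (u x - \<phi> x)\<^sup>2 + L\<^sup>2 * (norm (grad S u x - classical_gradient \<phi> x))\<^sup>2"
    have i1: "set_integrable lebesgue S (\<lambda>x. (u x - \<phi> x)\<^sup>2)"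
      using L2_on_lincomb[OF Lu(1) L\<phi>(1), of 1 "-1"] by (simp add: L2_on_def)
    have i2: "set_integrable lebesgue S (\<lambda>x. (norm (grad S u x - classical_gradient \<phi> x))\<^sup>2)"
      using L2_on_lincomb[OF Lu(2) L\<phi>(2), of 1 "-1"] by (simp add: L2_on_def)
    have i3: "set_integrable lebesgue S ?b"
      using uu i1 i2 by (intro set_integral_add(1)) auto
    have "?I = (LINT x:S|lebesgue. (u x)\<^sup>2 - u x * ?d x)"
      using ud0 by (simp add: set_integral_diff(2)[OF uu ud])
    also have "\<dots> \<le> (LINT x:S|lebesgue. ?b x)"
      unfolding set_lebesgue_integral_def
    proof (rule integral_mono_AE)
      show "integrable lebesgue (\<lambda>x. indicator S x *\<^sub>R ((u x)\<^sup>2 - u x * ?d x))"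
        using set_integral_diff(1)[OF uu ud] by (simp add: set_integrable_def)
      show "integrable lebesgue (\<lambda>x. indicator S x *\<^sub>R ?b x)"
        using i3 by (simp add: set_integrable_def)
      show "AE x in lebesgue. indicator S x *\<^sub>R ((u x)\<^sup>2 - u x * ?d x) \<le> indicator S x *\<^sub>R ?b x"
        using G
      proof eventually_elim
        case (elim x)
        show ?case
        proof (cases "x \<in> S")
          case True
          have young: "a * b \<le> a\<^sup>2 / 4 + b\<^sup>2" for a b :: real
            using sum_squares_bound[of "a / 2" b] by (simp add: power2_eq_square)
          have "(u x)\<^sup>2 - u x * ?d x = u x * (u x - \<phi> x) + u x * - (fst x * f1 x)"
            by (simp add: algebra_simps power2_eq_square)
          also have "\<dots> \<le> ((u x)\<^sup>2 / 4 + (u x - \<phi> x)\<^sup>2) + ((u x)\<^sup>2 / 4 + (- (fst x * f1 x))\<^sup>2)"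
            by (intro add_mono young)
          also have "(- (fst x * f1 x))\<^sup>2 \<le> L\<^sup>2 * (norm (classical_gradient \<phi> x))\<^sup>2"
          proof -
            have "\<bar>fst x\<bar> ^ 2 \<le> L ^ 2" using strip[OF True] by (intro power_mono) auto
            moreover have "(f1 x)\<^sup>2 \<le> (norm (classical_gradient \<phi> x))\<^sup>2"
              by (simp add: f(4) norm_Pair)
            ultimately show ?thesis by (simp add: power_mult_distrib mult_mono)
          qed
          finally show ?thesis using True elim by simp
        qed simp
      qed
    qed
    also have "\<dots> = ?I / 2 + (LINT x:S|lebesgue. (u x - \<phi> x)\<^sup>2) +
        L\<^sup>2 * (LINT x:S|lebesgue. (norm (grad S u x - classical_gradient \<phi> x))\<^sup>2)"
      using uu i1 i2 by (simp add: set_integral_add)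
    also have "\<dots> \<le> ?I / 2 + (1 + L\<^sup>2) * \<epsilon>"
    proof -
      let ?A = "LINT x:S|lebesgue. (u x - \<phi> x)\<^sup>2"
        and ?B = "LINT x:S|lebesgue. (norm (grad S u x - classical_gradient \<phi> x))\<^sup>2"
      have "?A \<ge> 0" "?B \<ge> 0"
        unfolding set_lebesgue_integral_def by (auto intro!: Bochner_Integration.integral_nonneg)
      with small have "?A \<le> \<epsilon>" "?B \<le> \<epsilon>" by auto
      then have "?A + L\<^sup>2 * ?B \<le> \<epsilon> + L\<^sup>2 * \<epsilon>" by (intro add_mono mult_left_mono) auto
      then show ?thesis by (simp add: algebra_simps)
    qed
    finally show ?thesis by simp
  qed
  note bound = this
  have "?I \<le> 0"
  proof (rule field_le_epsilon)
    fix \<delta> :: real assume "\<delta> > 0"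
    have pos: "1 + L\<^sup>2 > 0" by (simp add: add_pos_nonneg)
    have "2 * ((1 + L\<^sup>2) * (\<delta> / (2 * (1 + L\<^sup>2)))) = \<delta>"
      using pos by (simp add: divide_simps)
    then show "?I \<le> 0 + \<delta>"
      using bound[of "\<delta> / (2 * (1 + L\<^sup>2))"] \<open>\<delta> > 0\<close> pos by simp
  qed
  moreover have "?I \<ge> 0"
    unfolding set_lebesgue_integral_def by (auto intro!: Bochner_Integration.integral_nonneg)
  ultimately have "integral\<^sup>L lebesgue (\<lambda>x. indicator S x *\<^sub>R (u x)\<^sup>2) = 0"
    unfolding set_lebesgue_integral_def by (rule antisym)
  then have "AE x in lebesgue. indicator S x *\<^sub>R (u x)\<^sup>2 = 0"
    using uu unfolding set_integrable_def by (subst (asm) integral_nonneg_eq_0_iff_AE) auto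
  then show ?thesis by eventually_elim (auto simp: indicator_def)
qed

section \<open>Positive semidefinite forms on function spaces\<close>

text \<open>Functions are combined pointwise inside a carrier \<open>H\<close>. The form is
  semidefinite only: a gradient form on one layer is blind to constants and to everything that lives
  on other layers. Instances are the gradient forms on open sets, layers and \<open>Omega P\<close>,
  and the energy form.\<close>

locale psd_form =
  fixes H :: "('x \<Rightarrow> real) set" and B :: "('x \<Rightarrow> real) \<Rightarrow> ('x \<Rightarrow> real) \<Rightarrow> real"
  assumes zero_mem: "(\<lambda>x. 0) \<in> H"
    and lincomb_mem: "\<And>u v a b. u \<in> H \<Longrightarrow> v \<in> H \<Longrightarrow> (\<lambda>x. a * u x + b * v x) \<in> H"
    and lincomb_left: "\<And>u v w a b. u \<in> H \<Longrightarrow> v \<in> H \<Longrightarrow> w \<in> H \<Longrightarrow>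
      B (\<lambda>x. a * u x + b * v x) w = a * B u w + b * B v w"
    and commute: "\<And>u v. u \<in> H \<Longrightarrow> v \<in> H \<Longrightarrow> B u v = B v u"
    and nonneg: "\<And>u. u \<in> H \<Longrightarrow> B u u \<ge> 0"
begin

lemma add_mem: "u \<in> H \<Longrightarrow> v \<in> H \<Longrightarrow> (\<lambda>x. u x + v x) \<in> H"
  using lincomb_mem[of u v 1 1] by simp

lemma diff_mem: "u \<in> H \<Longrightarrow> v \<in> H \<Longrightarrow> (\<lambda>x. u x - v x) \<in> H"
  using lincomb_mem[of u v 1 "-1"] by simp

lemma scale_mem: "u \<in> H \<Longrightarrow> (\<lambda>x. a * u x) \<in> H"
  using lincomb_mem[of u u a 0] by simp

lemma add_left: "u \<in> H \<Longrightarrow> v \<in> H \<Longrightarrow> w \<in> H \<Longrightarrow> B (\<lambda>x. u x + v x) w = B u w + B v w"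
  using lincomb_left[of u v w 1 1] by simp

lemma diff_left: "u \<in> H \<Longrightarrow> v \<in> H \<Longrightarrow> w \<in> H \<Longrightarrow> B (\<lambda>x. u x - v x) w = B u w - B v w"
  using lincomb_left[of u v w 1 "-1"] by simp

lemma scale_left: "u \<in> H \<Longrightarrow> w \<in> H \<Longrightarrow> B (\<lambda>x. a * u x) w = a * B u w"
  using lincomb_left[of u u w a 0] by simp

lemma zero_left: "w \<in> H \<Longrightarrow> B (\<lambda>x. 0) w = 0"
  using scale_left[of w w 0] by simp

lemma add_right: "u \<in> H \<Longrightarrow> v \<in> H \<Longrightarrow> w \<in> H \<Longrightarrow> B w (\<lambda>x. u x + v x) = B w u + B w v"
  using add_left[of u v w] commute[of w] by (simp add: add_mem)

lemma diff_right: "u \<in> H \<Longrightarrow> v \<in> H \<Longrightarrow> w \<in> H \<Longrightarrow> B w (\<lambda>x. u x - v x) = B w u - B w v"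
  using diff_left[of u v w] commute[of w] by (simp add: diff_mem)

lemma scale_right: "u \<in> H \<Longrightarrow> w \<in> H \<Longrightarrow> B w (\<lambda>x. a * u x) = a * B w u"
  using scale_left[of u w] commute[of w] by (simp add: scale_mem)

lemma sum_mem: "finite I \<Longrightarrow> (\<And>i. i \<in> I \<Longrightarrow> v i \<in> H) \<Longrightarrow> (\<lambda>x. \<Sum>i\<in>I. v i x) \<in> H"
  by (induction rule: finite_induct) (auto intro: zero_mem add_mem)

lemma sum_left:
  assumes "finite I" "\<And>i. i \<in> I \<Longrightarrow> v i \<in> H" "w \<in> H"
  shows "B (\<lambda>x. \<Sum>i\<in>I. v i x) w = (\<Sum>i\<in>I. B (v i) w)"
  using assms by (induction rule: finite_induct) (simp_all add: zero_left add_left sum_mem)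

lemma sum_right:
  assumes "finite I" "\<And>i. i \<in> I \<Longrightarrow> v i \<in> H" "w \<in> H"
  shows "B w (\<lambda>x. \<Sum>i\<in>I. v i x) = (\<Sum>i\<in>I. B w (v i))"
  using sum_left[OF assms] commute[OF assms(3)] assms by (simp add: sum_mem)

lemma Cauchy_Schwarz:
  assumes "u \<in> H" "v \<in> H"
  shows "\<bar>B u v\<bar> \<le> sqrt (B u u) * sqrt (B v v)"
proof -
  have q: "0 \<le> B u u + 2 * t * B u v + t\<^sup>2 * B v v" for t
  proof -
    have "0 \<le> B (\<lambda>x. u x + t * v x) (\<lambda>x. u x + t * v x)"
      using assms by (intro nonneg add_mem scale_mem)
    also have "\<dots> = B u u + 2 * t * B u v + t\<^sup>2 * B v v"
      using assms commute[OF assms(2,1)]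
      by (simp add: add_left add_right scale_left scale_right add_mem scale_mem power2_eq_square algebra_simps)
    finally show ?thesis .
  qed
  have "(B u v)\<^sup>2 \<le> B u u * B v v"
  proof (cases "B v v = 0")
    case True
    have q0: "0 \<le> B u u + 2 * t * B u v" for t using q[of t] True by simp
    \<comment> \<open>An affine function of \<open>t\<close> that never becomes negative is
      constant; the witness below would give it the value -1.\<close>
    have "B u v = 0"
    proof (rule ccontr)
      assume "B u v \<noteq> 0"
      then have "2 * (- (B u u + 1) / (2 * B u v)) * B u v = - (B u u + 1)" by simp
      then show False
        using q0[of "- (B u u + 1) / (2 * B u v)"] by linarith
    qed
    then show ?thesis using True by simp
  next
    case False
    then have pos: "B v v > 0" using nonneg[OF assms(2)] by simp
    then have "0 \<le> B u u - (B u v)\<^sup>2 / B v v"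
      using q[of "- B u v / B v v"] by (simp add: power2_eq_square field_simps)
    then show ?thesis using pos by (simp add: field_simps)
  qed
  then have "sqrt ((B u v)\<^sup>2) \<le> sqrt (B u u * B v v)" by (rule real_sqrt_le_mono)
  then show ?thesis by (simp add: real_sqrt_mult)
qed

lemma triangle:
  assumes "u \<in> H" "v \<in> H"
  shows "sqrt (B (\<lambda>x. u x + v x) (\<lambda>x. u x + v x)) \<le> sqrt (B u u) + sqrt (B v v)"
proof -
  have "B (\<lambda>x. u x + v x) (\<lambda>x. u x + v x) = B u u + 2 * B u v + B v v"
    using assms commute[OF assms(2,1)] by (simp add: add_left add_right add_mem)
  also have "\<dots> \<le> B u u + 2 * (sqrt (B u u) * sqrt (B v v)) + B v v"
    using Cauchy_Schwarz[OF assms] by linarith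
  also have "\<dots> = (sqrt (B u u) + sqrt (B v v))\<^sup>2"
    using nonneg assms by (simp add: power2_sum)
  finally show ?thesis
    using nonneg assms by (intro real_le_lsqrt) auto
qed

lemma triangle_sum:
  assumes "finite I" "\<And>i. i \<in> I \<Longrightarrow> v i \<in> H"
  shows "sqrt (B (\<lambda>x. \<Sum>i\<in>I. v i x) (\<lambda>x. \<Sum>i\<in>I. v i x)) \<le> (\<Sum>i\<in>I. sqrt (B (v i) (v i)))"
  using assms
proof (induction rule: finite_induct)
  case empty
  then show ?case by (simp add: zero_left zero_mem)
next
  case (insert i I)
  then have "sqrt (B (\<lambda>x. \<Sum>j\<in>insert i I. v j x) (\<lambda>x. \<Sum>j\<in>insert i I. v j x)) \<le>
      sqrt (B (v i) (v i)) + sqrt (B (\<lambda>x. \<Sum>j\<in>I. v j x) (\<lambda>x. \<Sum>j\<in>I. v j x))"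
    using triangle[of "v i" "\<lambda>x. \<Sum>j\<in>I. v j x"] by (simp add: sum_mem)
  with insert show ?case by simp
qed

text \<open>Gram-Schmidt for a semidefinite form and a possibly dependent family: the residual of
  \<open>w\<close> is corrected along the residual of the new vector \<open>v j\<close>.\<close>

lemma projection_exists:
  assumes "finite I" "\<And>i. i \<in> I \<Longrightarrow> v i \<in> H" "w \<in> H"
  shows "\<exists>c. \<forall>k\<in>I. B (\<lambda>x. w x - (\<Sum>i\<in>I. c i * v i x)) (v k) = 0"
  using assms
proof (induction arbitrary: w rule: finite_induct)
  case empty
  then show ?case by simp
next
  case (insert j I)
  have mem: "(\<lambda>x. \<Sum>i\<in>I. c i * v i x) \<in> H" for c
    using insert.prems by (intro sum_mem insert.hyps scale_mem) auto
  obtain c where c: "\<forall>k\<in>I. B (\<lambda>x. w x - (\<Sum>i\<in>I. c i * v i x)) (v k) = 0"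
    using insert.IH[of w] insert.prems by auto
  obtain d where d: "\<forall>k\<in>I. B (\<lambda>x. v j x - (\<Sum>i\<in>I. d i * v i x)) (v k) = 0"
    using insert.IH[of "v j"] insert.prems by auto
  let ?p = "\<lambda>x. w x - (\<Sum>i\<in>I. c i * v i x)" and ?q = "\<lambda>x. v j x - (\<Sum>i\<in>I. d i * v i x)"
  have p: "?p \<in> H" and q: "?q \<in> H" and vj: "v j \<in> H"
    using insert.prems by (auto intro!: diff_mem mem)
  \<comment> \<open>If \<open>?q\<close> is a null vector, division by zero gives t = 0, and
    Cauchy-Schwarz already makes \<open>?p\<close> orthogonal to \<open>?q\<close>.\<close>
  define t where "t = B ?p ?q / B ?q ?q"
  define e where "e i = (if i = j then t else c i - t * d i)" for i
  have e: "(\<lambda>x. w x - (\<Sum>i\<in>insert j I. e i * v i x)) = (\<lambda>x. ?p x - t * ?q x)"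
  proof
    fix x
    have "(\<Sum>i\<in>I. e i * v i x) = (\<Sum>i\<in>I. c i * v i x - t * (d i * v i x))"
      using insert.hyps by (intro sum.cong) (auto simp: e_def algebra_simps)
    then show "w x - (\<Sum>i\<in>insert j I. e i * v i x) = ?p x - t * ?q x"
      using insert.hyps by (simp add: e_def sum_subtractf sum_distrib_left[symmetric] algebra_simps)
  qed
  have tq: "(\<lambda>x. t * ?q x) \<in> H" using q by (rule scale_mem)
  have rI: "B (\<lambda>x. ?p x - t * ?q x) (v k) = 0" if "k \<in> I" for k
    using c d that insert.prems p q tq by (simp add: diff_left scale_left)
  have pq: "B ?p ?q = t * B ?q ?q"
  proof (cases "B ?q ?q = 0")
    case True
    then have "B ?p ?q = 0" using Cauchy_Schwarz[OF p q] by simp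
    with True show ?thesis by simp
  qed (simp add: t_def)
  have "B (\<lambda>x. ?p x - t * ?q x) ?q = 0"
    using p q tq pq by (simp add: diff_left scale_left)
  moreover have "B (\<lambda>x. ?p x - t * ?q x) (\<lambda>x. \<Sum>i\<in>I. d i * v i x) = 0"
  proof -
    have "B (\<lambda>x. ?p x - t * ?q x) (\<lambda>x. d i * v i x) = 0" if "i \<in> I" for i
      using rI[OF that] insert.prems that p tq by (simp add: scale_right diff_mem)
    then show ?thesis
      using insert.hyps insert.prems p tq by (subst sum_right) (auto intro: diff_mem scale_mem)
  qed
  ultimately have "B (\<lambda>x. ?p x - t * ?q x) (v j) = 0"
    using vj mem p tq by (simp add: diff_right diff_mem)
  with rI have "\<forall>k\<in>insert j I. B (\<lambda>x. w x - (\<Sum>i\<in>insert j I. e i * v i x)) (v k) = 0"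
    unfolding e by blast
  then show ?case by blast
qed

text \<open>The components \<open>s i\<close>, \<open>f i\<close> are the slow and fast parts of the exact solution, \<open>t i\<close> and
  \<open>w i\<close> those of the approximation. Fast functions are almost orthogonal to all components with
  other indices, so both Galerkin problems nearly decouple.\<close>

lemma slow_fast_estimate:
  assumes I: "finite I"
    and s: "\<And>i. i \<in> I \<Longrightarrow> s i \<in> S i" and t: "\<And>i. i \<in> I \<Longrightarrow> t i \<in> S i"
    and f: "\<And>i. i \<in> I \<Longrightarrow> f i \<in> F i" and w: "\<And>i. i \<in> I \<Longrightarrow> w i \<in> F i"
    and S_diff: "\<And>i p q. i \<in> I \<Longrightarrow> p \<in> S i \<Longrightarrow> q \<in> S i \<Longrightarrow> (\<lambda>x. p x - q x) \<in> S i"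
    and F_diff: "\<And>i p q. i \<in> I \<Longrightarrow> p \<in> F i \<Longrightarrow> q \<in> F i \<Longrightarrow> (\<lambda>x. p x - q x) \<in> F i"
    and W_add: "\<And>i p q. i \<in> I \<Longrightarrow> p \<in> S i \<Longrightarrow> q \<in> F i \<Longrightarrow> (\<lambda>x. p x + q x) \<in> W i"
    and SW: "\<And>i. i \<in> I \<Longrightarrow> S i \<subseteq> W i" and WH: "\<And>i. i \<in> I \<Longrightarrow> W i \<subseteq> H"
    and FH: "\<And>i. i \<in> I \<Longrightarrow> F i \<subseteq> H"
    and orth: "\<And>i p q. i \<in> I \<Longrightarrow> p \<in> S i \<Longrightarrow> q \<in> F i \<Longrightarrow> B p q = 0"
    and cross: "\<And>i j p q. i \<in> I \<Longrightarrow> j \<in> I \<Longrightarrow> i \<noteq> j \<Longrightarrow> p \<in> W i \<Longrightarrow> q \<in> F j \<Longrightarrow>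
      \<bar>B p q\<bar> \<le> \<sigma> * sqrt (B p p) * sqrt (B q q)"
    and \<sigma>: "\<sigma> \<ge> 0" and c: "c > 0"
    and coercive: "\<And>v. (\<And>i. i \<in> I \<Longrightarrow> v i \<in> W i) \<Longrightarrow>
      c * (\<Sum>i\<in>I. B (v i) (v i)) \<le> B (\<lambda>x. \<Sum>i\<in>I. v i x) (\<lambda>x. \<Sum>i\<in>I. v i x)"
    and u: "u = (\<lambda>x. \<Sum>i\<in>I. s i x + f i x)"
    and fast_eq: "\<And>i q. i \<in> I \<Longrightarrow> q \<in> F i \<Longrightarrow> B u q = B (w i) q"
    and slow_eq: "\<And>v. (\<And>i. i \<in> I \<Longrightarrow> v i \<in> S i) \<Longrightarrow>
      B u (\<lambda>x. \<Sum>i\<in>I. v i x) = B (\<lambda>x. \<Sum>i\<in>I. t i x) (\<lambda>x. \<Sum>i\<in>I. v i x)"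
    and e: "e = (\<lambda>x. u x - ((\<Sum>i\<in>I. w i x) + (\<Sum>i\<in>I. t i x)))"
  shows "sqrt (B e e) \<le> (real (card I))\<^sup>2 * (1 / c + 1 / sqrt c) * \<sigma> * sqrt (B u u)"
proof -
  let ?n = "real (card I)"
  let ?N = "\<lambda>v. sqrt (B v v)"
  have cancel: "a \<le> b" if "a * a \<le> b * a" "0 \<le> a" "0 \<le> b" for a b :: real
    using that by (cases "a = 0") (auto simp: mult_le_cancel_right)
  define v where "v i = (\<lambda>x. s i x + f i x)" for i
  define d where "d i = (\<lambda>x. s i x - t i x)" for i
  define g where "g i = (\<lambda>x. f i x - w i x)" for i
  define D where "D = (\<lambda>x. \<Sum>i\<in>I. d i x)"
  \<comment> \<open>A common bound for the norms of all components of \<open>u\<close>, since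
    coercivity controls each component energy by that of \<open>u\<close> up to 1 / c.\<close>
  define K where "K = ?N u / sqrt c"
  have vW: "v i \<in> W i" and dS: "d i \<in> S i" and gF: "g i \<in> F i" if "i \<in> I" for i
    unfolding v_def d_def g_def using that s t f w by (auto intro: W_add S_diff F_diff)
  have SH: "S i \<subseteq> H" if "i \<in> I" for i using SW WH that by blast
  have mem: "v i \<in> H" "d i \<in> H" "g i \<in> H" "s i \<in> H" "t i \<in> H" "f i \<in> H" "w i \<in> H" if "i \<in> I" for i
    using subsetD[OF WH vW] subsetD[OF SH dS] subsetD[OF FH gF] subsetD[OF SH s]
      subsetD[OF SH t] subsetD[OF FH f] subsetD[OF FH w] that by simp_all
  have uv: "u = (\<lambda>x. \<Sum>i\<in>I. v i x)" by (simp add: u v_def)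
  have uH: "u \<in> H" and DH: "D \<in> H"
    unfolding uv D_def using I mem by (auto intro!: sum_mem)
  have single: "?N (z i) \<le> ?N (\<lambda>x. \<Sum>i\<in>I. z i x) / sqrt c"
    if z: "\<And>i. i \<in> I \<Longrightarrow> z i \<in> W i" and i: "i \<in> I" for z i
  proof -
    have "c * B (z i) (z i) \<le> c * (\<Sum>i\<in>I. B (z i) (z i))"
      using c z WH nonneg by (intro mult_left_mono member_le_sum[OF i _ I]) auto
    also have "\<dots> \<le> B (\<lambda>x. \<Sum>i\<in>I. z i x) (\<lambda>x. \<Sum>i\<in>I. z i x)"
      by (rule coercive[OF z])
    finally have "sqrt (c * B (z i) (z i)) \<le> ?N (\<lambda>x. \<Sum>i\<in>I. z i x)" by (rule real_sqrt_le_mono)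
    then show ?thesis using c by (simp add: real_sqrt_mult field_simps)
  qed
  have vK: "?N (v i) \<le> K" if "i \<in> I" for i
    using single[of v i] vW that unfolding K_def uv by blast
  have dK: "?N (d i) \<le> ?N D / sqrt c" if "i \<in> I" for i
    using single[of d i] dS SW that unfolding D_def by blast
  have K0: "K \<ge> 0" using c nonneg[OF uH] by (simp add: K_def)
  have fK: "?N (f i) \<le> K" if "i \<in> I" for i
  proof -
    \<comment> \<open>Pythagoras: slow and fast parts are orthogonal, so the fast part is no larger
      than the component.\<close>
    have "B (v i) (v i) = B (s i) (s i) + 2 * B (s i) (f i) + B (f i) (f i)"
      unfolding v_def using mem[OF that] commute[of "f i" "s i"] by (simp add: add_left add_right add_mem)
    then have "B (f i) (f i) \<le> B (v i) (v i)"
      using orth[OF that s[OF that] f[OF that]] nonneg mem[OF that] by simp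
    then show ?thesis using vK[OF that] real_sqrt_le_mono order_trans by blast
  qed
  have gK: "?N (g i) \<le> ?n * \<sigma> * K" if i: "i \<in> I" for i
  proof -
    \<comment> \<open>\<open>u\<close> and \<open>w i\<close> have the same product with the fast
      error \<open>g i\<close>. The own component contributes \<open>B (f i) (g i)\<close> to the
      former, so the energy of \<open>g i\<close> is minus the sum of its products with the other
      components.\<close>
    have "B u (g i) = (\<Sum>j\<in>I. B (v j) (g i))"
      unfolding uv using I mem i by (intro sum_left) auto
    also have "\<dots> = B (v i) (g i) + (\<Sum>j\<in>I - {i}. B (v j) (g i))"
      by (rule sum.remove[OF I i])
    also have "B (v i) (g i) = B (f i) (g i)"
      unfolding v_def using mem[OF i] orth[OF i s[OF i] gF[OF i]] by (simp add: add_left)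
    finally have "B (g i) (g i) = - (\<Sum>j\<in>I - {i}. B (v j) (g i))"
      using fast_eq[OF i gF[OF i]] mem[OF i] diff_left[of "f i" "w i" "g i"] by (simp add: g_def)
    also have "\<dots> \<le> (\<Sum>j\<in>I - {i}. \<bar>B (v j) (g i)\<bar>)"
      using sum_abs[of "\<lambda>j. B (v j) (g i)" "I - {i}"] by linarith
    also have "\<dots> \<le> (\<Sum>j\<in>I - {i}. \<sigma> * K * ?N (g i))"
    proof (rule sum_mono)
      fix j assume j: "j \<in> I - {i}"
      then have "\<bar>B (v j) (g i)\<bar> \<le> \<sigma> * ?N (v j) * ?N (g i)"
        using i vW gF by (intro cross[of j i]) auto
      also have "\<dots> \<le> \<sigma> * K * ?N (g i)"
        using j \<sigma> vK nonneg[OF mem(3)[OF i]] by (intro mult_right_mono mult_left_mono) auto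
      finally show "\<bar>B (v j) (g i)\<bar> \<le> \<sigma> * K * ?N (g i)" .
    qed
    also have "\<dots> \<le> (\<Sum>j\<in>I. \<sigma> * K * ?N (g i))"
      using I \<sigma> K0 nonneg[OF mem(3)[OF i]] by (intro sum_mono2) auto
    finally have "?N (g i) * ?N (g i) \<le> ?n * \<sigma> * K * ?N (g i)"
      using nonneg[OF mem(3)[OF i]] by (simp add: mult.assoc)
    moreover have "0 \<le> ?n * \<sigma> * K" using \<sigma> K0 by simp
    ultimately show ?thesis
      by (rule cancel[OF _ real_sqrt_ge_zero[OF nonneg[OF mem(3)[OF i]]]])
  qed
  have DK: "?N D \<le> ?n\<^sup>2 * \<sigma> * K / sqrt c"
  proof -
    have fH: "(\<lambda>x. \<Sum>i\<in>I. f i x) \<in> H" and tH: "(\<lambda>x. \<Sum>i\<in>I. t i x) \<in> H"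
      using I mem by (auto intro!: sum_mem)
    \<comment> \<open>By the slow Galerkin equation, \<open>u\<close> minus the sum of the
      \<open>t i\<close> is orthogonal to \<open>D\<close>. So the energy of \<open>D\<close> is
      minus its product with the fast parts, where equal indices contribute nothing and different
      ones are small.\<close>
    have "u = (\<lambda>x. (D x + (\<Sum>i\<in>I. f i x)) + (\<Sum>i\<in>I. t i x))"
      by (auto simp: u D_def d_def sum.distrib sum_subtractf)
    then have "B u D = B D D + B (\<lambda>x. \<Sum>i\<in>I. f i x) D + B (\<lambda>x. \<Sum>i\<in>I. t i x) D"
      using DH fH tH by (simp add: add_left add_mem)
    moreover have "B u D = B (\<lambda>x. \<Sum>i\<in>I. t i x) D"
      unfolding D_def by (rule slow_eq[OF dS])
    ultimately have "B D D = - B (\<lambda>x. \<Sum>i\<in>I. f i x) D" by simp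
    also have "B (\<lambda>x. \<Sum>i\<in>I. f i x) D = (\<Sum>j\<in>I. B (f j) D)"
      using I mem DH by (intro sum_left) auto
    also have "- \<dots> \<le> (\<Sum>j\<in>I. \<bar>B (f j) D\<bar>)"
      using sum_abs[of "\<lambda>j. B (f j) D" I] by linarith
    also have "\<dots> \<le> (\<Sum>j\<in>I. ?n * (\<sigma> * K * (?N D / sqrt c)))"
    proof (rule sum_mono)
      fix j assume j: "j \<in> I"
      have "B (f j) D = (\<Sum>i\<in>I. B (f j) (d i))"
        unfolding D_def using I mem j by (intro sum_right) auto
      also have "\<bar>\<dots>\<bar> \<le> (\<Sum>i\<in>I. \<bar>B (f j) (d i)\<bar>)" by (rule sum_abs)
      also have "\<dots> \<le> (\<Sum>i\<in>I. \<sigma> * K * (?N D / sqrt c))"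
      proof (rule sum_mono)
        fix i assume i: "i \<in> I"
        have 0: "0 \<le> ?N (f j)" "0 \<le> ?N (d i)" "0 \<le> ?N D"
          using nonneg mem i j DH by auto
        have "B (f j) (d i) = B (d i) (f j)" by (rule commute[OF mem(6)[OF j] mem(2)[OF i]])
        moreover have "\<bar>B (d i) (f j)\<bar> \<le> \<sigma> * ?N (d i) * ?N (f j)"
        proof (cases "i = j")
          case True
          then show ?thesis using orth[OF j dS[OF j] f[OF j]] 0 \<sigma> by simp
        next
          case False
          then show ?thesis using i j dS f SW by (intro cross[of i j]) auto
        qed
        moreover have "\<sigma> * ?N (d i) * ?N (f j) \<le> \<sigma> * (?N D / sqrt c) * K"
          using \<sigma> 0 c dK[OF i] fK[OF j] by (intro mult_mono mult_left_mono) auto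
        ultimately show "\<bar>B (f j) (d i)\<bar> \<le> \<sigma> * K * (?N D / sqrt c)"
          by (simp add: mult_ac)
      qed
      finally show "\<bar>B (f j) D\<bar> \<le> ?n * (\<sigma> * K * (?N D / sqrt c))" by simp
    qed
    finally have "?N D * ?N D \<le> ?n\<^sup>2 * \<sigma> * K / sqrt c * ?N D"
      using nonneg[OF DH] by (simp add: power2_eq_square mult_ac)
    moreover have "0 \<le> ?n\<^sup>2 * \<sigma> * K / sqrt c" using \<sigma> K0 c by simp
    ultimately show ?thesis
      by (rule cancel[OF _ real_sqrt_ge_zero[OF nonneg[OF DH]]])
  qed
  have "e = (\<lambda>x. (\<Sum>i\<in>I. g i x) + D x)"
    by (auto simp: e u D_def d_def g_def sum.distrib sum_subtractf)
  then have "?N e \<le> ?N (\<lambda>x. \<Sum>i\<in>I. g i x) + ?N D"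
    using triangle[of "\<lambda>x. \<Sum>i\<in>I. g i x" D] DH I mem by (simp add: sum_mem)
  also have "\<dots> \<le> (\<Sum>i\<in>I. ?N (g i)) + ?N D"
    using triangle_sum[OF I, of g] mem by simp
  also have "\<dots> \<le> (\<Sum>i\<in>I. ?n * \<sigma> * K) + ?n\<^sup>2 * \<sigma> * K / sqrt c"
    using gK DK by (intro add_mono sum_mono) auto
  \<comment> \<open>Inserting \<open>K\<close> gives a factor 1 / sqrt c for the fast errors and 1 /
    c for the slow one.\<close>
  also have "\<dots> = ?n\<^sup>2 * (1 / c + 1 / sqrt c) * \<sigma> * ?N u"
    using c by (simp add: K_def power2_eq_square field_simps real_sqrt_mult_self)
  finally show ?thesis .
qed

end

section \<open>The layered domain\<close>

lemma negligible_vertical_line: "negligible {x :: plane. fst x = c}"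
proof -
  have "{x :: plane. fst x = c} = {x. inner x (1, 0) = c}"
    by (auto simp: inner_prod_def)
  then show ?thesis
    using negligible_standard_hyperplane[of "(1, 0) :: plane" c] by (simp add: Basis_prod_def)
qed

text \<open>Reflection starts from layer 1; \<open>layer P 0\<close> is an empty default and not its
  mirror image.\<close>

lemma layer_Suc: "i \<ge> 1 \<Longrightarrow> layer P (Suc i) = mirror (2 * real i) -` layer P i"
  by (cases i) (auto simp: mirror_def)

locale layered =
  fixes P :: layered_fem
  assumes geo: "geometry P" and layers_pos: "layers P \<ge> 1"
begin

abbreviation "N \<equiv> layers P"

lemma layer_1: "layer P 1 = {x. 0 < fst x \<and> fst x < 1 \<and> lower P (fst x) < snd x \<and> snd x < upper P (fst x)}"
  by auto

lemma layer_strip: "x \<in> layer P i \<Longrightarrow> real i - 1 < fst x \<and> fst x < real i"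
proof (induction i arbitrary: x)
  case (Suc i)
  show ?case
  proof (cases "i = 0")
    case True
    then show ?thesis using Suc.prems by auto
  next
    case False
    then have "mirror (2 * real i) x \<in> layer P i" using Suc.prems by (simp add: layer_Suc)
    from Suc.IH[OF this] show ?thesis by (simp add: mirror_def)
  qed
qed simp

lemma layer_disjoint: "x \<in> layer P i \<Longrightarrow> x \<in> layer P j \<Longrightarrow> i = j"
  using layer_strip[of x i] layer_strip[of x j] by linarith

lemma open_graph_side:
  assumes h: "continuous_on {0<..<1} h"
  shows "open {x :: plane. 0 < fst x \<and> fst x < 1 \<and> h (fst x) < snd x}"
    and "open {x :: plane. 0 < fst x \<and> fst x < 1 \<and> snd x < h (fst x)}"
proof -
  let ?S = "{0<..<1} \<times> UNIV :: plane set"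
  have c: "continuous_on ?S (\<lambda>x. snd x - h (fst x))"
    by (intro continuous_intros continuous_on_compose2[OF h]) auto
  have S: "open ?S" by (intro open_Times) auto
  have "open (?S \<inter> (\<lambda>x. snd x - h (fst x)) -` {0<..})"
    by (rule continuous_open_preimage[OF c S]) simp
  moreover have "?S \<inter> (\<lambda>x. snd x - h (fst x)) -` {0<..} = {x. 0 < fst x \<and> fst x < 1 \<and> h (fst x) < snd x}"
    by auto
  ultimately show "open {x :: plane. 0 < fst x \<and> fst x < 1 \<and> h (fst x) < snd x}" by simp
  have "open (?S \<inter> (\<lambda>x. snd x - h (fst x)) -` {..<0})"
    by (rule continuous_open_preimage[OF c S]) simp
  moreover have "?S \<inter> (\<lambda>x. snd x - h (fst x)) -` {..<0} = {x. 0 < fst x \<and> fst x < 1 \<and> snd x < h (fst x)}"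
    by auto
  ultimately show "open {x :: plane. 0 < fst x \<and> fst x < 1 \<and> snd x < h (fst x)}" by simp
qed

lemma cont: "continuous_on {0<..<1} (lower P)" "continuous_on {0<..<1} (upper P)"
  using geo by (auto simp: geometry_def)

lemma open_layer: "open (layer P i)"
proof (induction i)
  case (Suc i)
  show ?case
  proof (cases "i = 0")
    case True
    have "layer P 1 = {x. 0 < fst x \<and> fst x < 1 \<and> lower P (fst x) < snd x} \<inter>
        {x. 0 < fst x \<and> fst x < 1 \<and> snd x < upper P (fst x)}"
      unfolding layer_1 by blast
    then show ?thesis using True open_graph_side cont by (auto simp del: layer.simps)
  next
    case False
    then show ?thesis using Suc by (simp add: layer_Suc open_mirror)
  qed
qed simp

lemma closure_layer_strip:
  assumes "x \<in> closure (layer P i)"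
  shows "real i - 1 \<le> fst x \<and> fst x \<le> real i"
proof -
  have "closed ({real i - 1..real i} \<times> UNIV :: plane set)" by (intro closed_Times) auto
  then have "closure (layer P i) \<subseteq> {real i - 1..real i} \<times> UNIV"
    by (rule closure_minimal[rotated]) (use layer_strip in force)
  then show ?thesis using assms by auto
qed

lemma frontier_layer: "frontier (layer P i) = closure (layer P i) - layer P i"
  by (simp add: frontier_def interior_open open_layer)

text \<open>Points of the common line are fixed by the reflection that exchanges the two
  layers.\<close>

lemma closure_layer_line:
  assumes "i \<ge> 1" "fst x = real i"
  shows "x \<in> closure (layer P (Suc i)) \<longleftrightarrow> x \<in> closure (layer P i)"
proof -
  have "mirror (2 * real i) x = x" using assms(2) by (simp add: mirror_def prod_eq_iff)
  then show ?thesis using assms(1) by (simp add: layer_Suc closure_mirror)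
qed

text \<open>The interface can be seen from its left layer alone: the closures of two neighbouring
  layers meet only on their common line, and there they agree by reflection.\<close>

lemma iface_right:
  assumes "1 \<le> i" "i \<le> N"
  shows "iface P i = closure (layer P i) \<inter> {x. fst x = real i}"
proof -
  have nl: "x \<notin> layer P i" "x \<notin> layer P (Suc i)" if "fst x = real i" for x
    using layer_strip[of x i] layer_strip[of x "Suc i"] that by auto
  show ?thesis
  proof (cases "i < N")
    case True
    have "x \<in> iface P i \<longleftrightarrow> x \<in> closure (layer P i) \<inter> {x. fst x = real i}" for x
    proof
      assume "x \<in> iface P i"
      then have x: "x \<in> closure (layer P i)" "x \<in> closure (layer P (Suc i))"
        using True assms by (auto simp: iface_def frontier_layer)
      with closure_layer_strip[OF x(1)] closure_layer_strip[OF x(2)]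
      show "x \<in> closure (layer P i) \<inter> {x. fst x = real i}" by auto
    next
      assume x: "x \<in> closure (layer P i) \<inter> {x. fst x = real i}"
      then show "x \<in> iface P i"
        using True assms closure_layer_line[of i x] nl[of x] by (auto simp: iface_def frontier_layer)
    qed
    then show ?thesis by blast
  next
    case False
    then have "i = N" using assms by simp
    then show ?thesis using assms nl by (auto simp: iface_def frontier_layer)
  qed
qed

lemma iface_left:
  assumes "i < N"
  shows "iface P i = closure (layer P (Suc i)) \<inter> {x. fst x = real i}"
proof (cases "i = 0")
  case True
  have "x \<notin> layer P 1" if "fst x = 0" for x using layer_strip[of x 1] that by auto
  then show ?thesis using True by (auto simp: iface_def frontier_layer simp del: layer.simps)
next
  case False
  then have "x \<in> iface P i \<longleftrightarrow> x \<in> closure (layer P (Suc i)) \<inter> {x. fst x = real i}" for x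
    using iface_right[of i] assms closure_layer_line[of i x] by auto
  then show ?thesis by blast
qed

lemma iface_line: "i \<le> N \<Longrightarrow> x \<in> iface P i \<Longrightarrow> fst x = real i"
  using iface_right[of i] iface_left[of i] layers_pos by (cases "i = 0") auto

lemma iface_layer: "i \<le> N \<Longrightarrow> x \<in> iface P i \<Longrightarrow> x \<notin> layer P j"
proof
  assume "i \<le> N" "x \<in> iface P i" "x \<in> layer P j"
  then have "fst x = real i" "real j - 1 < fst x" "fst x < real j"
    using iface_line[of i x] layer_strip[of x j] by simp_all
  then show False by simp
qed

lemma iface_disjoint: "i \<le> N \<Longrightarrow> j \<le> N \<Longrightarrow> x \<in> iface P i \<Longrightarrow> x \<in> iface P j \<Longrightarrow> i = j"
  using iface_line[of i x] iface_line[of j x] by simp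

lemma mirror_iface:
  assumes "1 \<le> i" "i < N"
  shows "mirror (2 * real i) x \<in> iface P (i - 1) \<longleftrightarrow> x \<in> iface P (Suc i)"
proof -
  have "x \<in> iface P (Suc i) \<longleftrightarrow> mirror (2 * real i) x \<in> closure (layer P i) \<and> fst x = real (Suc i)"
    using assms iface_right[of "Suc i"] by (auto simp: layer_Suc closure_mirror simp del: layer.simps)
  moreover have "fst x = real (Suc i) \<longleftrightarrow> fst (mirror (2 * real i) x) = real (i - 1)"
    using assms by (auto simp: mirror_def of_nat_diff)
  ultimately show ?thesis using assms iface_left[of "i - 1"] by auto
qed

section \<open>The global domain and its covering by layers\<close>

lemma open_Omega: "open (Omega P)"
  by (simp add: Omega_def)

lemma layer_subset_Omega: "1 \<le> i \<Longrightarrow> i \<le> N \<Longrightarrow> layer P i \<subseteq> Omega P"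
  unfolding Omega_def by (rule interior_maximal[OF _ open_layer]) (use closure_subset in force)

text \<open>Small axis-parallel moves inside an open set turn weak bounds that hold on the whole set
  into strict ones.\<close>

lemma open_shift:
  fixes x :: plane
  assumes "open U" "x \<in> U"
  obtains d where "d > 0" "(fst x + d, snd x) \<in> U" "(fst x - d, snd x) \<in> U"
    "(fst x, snd x + d) \<in> U" "(fst x, snd x - d) \<in> U"
proof -
  obtain e where e: "e > 0" "ball x e \<subseteq> U" using assms open_contains_ball by blast
  let ?d = "e / 2"
  have "(fst x + ?d, snd x) \<in> ball x e" "(fst x - ?d, snd x) \<in> ball x e"
    "(fst x, snd x + ?d) \<in> ball x e" "(fst x, snd x - ?d) \<in> ball x e"
    using e(1) by (auto simp: dist_prod_def dist_real_def)
  with e show ?thesis by (intro that[of ?d]) auto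
qed

lemma Omega_strip:
  assumes "x \<in> Omega P"
  shows "0 < fst x" "fst x < real N"
proof -
  have b: "0 \<le> fst y \<and> fst y \<le> real N" if "y \<in> Omega P" for y
  proof -
    obtain i where i: "i \<in> {1..N}" "y \<in> closure (layer P i)"
      using \<open>y \<in> Omega P\<close> interior_subset unfolding Omega_def by blast
    have "1 \<le> real i" "real i \<le> real N" using i(1) by auto
    with closure_layer_strip[OF i(2)] show ?thesis by linarith
  qed
  obtain d where "d > 0" "(fst x + d, snd x) \<in> Omega P" "(fst x - d, snd x) \<in> Omega P"
    using open_shift[OF open_Omega assms] by blast
  with b[of "(fst x + d, snd x)"] b[of "(fst x - d, snd x)"]
  show "0 < fst x" "fst x < real N" by auto
qed

lemma iface_lateral: "x \<in> iface P 0 \<Longrightarrow> x \<notin> Omega P" "x \<in> iface P N \<Longrightarrow> x \<notin> Omega P"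
  using Omega_strip[of x] iface_line[of 0 x] iface_line[of N x] by auto

text \<open>In the interior of the strip, the closure of a layer adds the graphs of the two bounding
  functions only.\<close>

lemma open_subset_closure_layer:
  assumes "i \<ge> 1" "open U" "U \<subseteq> closure (layer P i)" "\<And>x. x \<in> U \<Longrightarrow> real i - 1 < fst x \<and> fst x < real i"
  shows "U \<subseteq> layer P i"
  using assms
proof (induction i arbitrary: U rule: dec_induct)
  case base
  have le: "lower P (fst y) \<le> snd y \<and> snd y \<le> upper P (fst y)" if "y \<in> U" for y
  proof -
    have y: "0 < fst y" "fst y < 1" "y \<in> closure (layer P 1)"
      using base.prems(3)[OF that] subsetD[OF base.prems(2) that] by auto
    \<comment> \<open>The open regions below and above the two graphs miss the layer, and hence also
      its closure.\<close>
    have "{x. 0 < fst x \<and> fst x < 1 \<and> snd x < lower P (fst x)} \<inter> layer P 1 = {}"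
      "{x. 0 < fst x \<and> fst x < 1 \<and> upper P (fst x) < snd x} \<inter> layer P 1 = {}"
      unfolding layer_1 by force+
    then have "{x. 0 < fst x \<and> fst x < 1 \<and> snd x < lower P (fst x)} \<inter> closure (layer P 1) = {}"
      "{x. 0 < fst x \<and> fst x < 1 \<and> upper P (fst x) < snd x} \<inter> closure (layer P 1) = {}"
      using open_graph_side[OF cont(1)] open_graph_side[OF cont(2)]
      by (simp_all add: open_Int_closure_eq_empty del: layer.simps)
    with y show ?thesis by force
  qed
  show ?case
  proof
    fix x assume x: "x \<in> U"
    obtain d where "d > 0" "(fst x, snd x + d) \<in> U" "(fst x, snd x - d) \<in> U"
      using open_shift[OF base.prems(1) x] by blast
    then have "lower P (fst x) < snd x" "snd x < upper P (fst x)"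
      using le[of "(fst x, snd x + d)"] le[of "(fst x, snd x - d)"] by auto
    then show "x \<in> layer P 1"
      unfolding layer_1 using base.prems(3)[OF x] by simp
  qed
next
  case (step i)
  let ?m = "mirror (2 * real i)"
  have i: "1 \<le> i" using step.hyps by simp
  have "?m -` U \<subseteq> layer P i"
  proof (rule step.IH)
    show "open (?m -` U)" using step.prems(1) by (rule open_mirror)
    show "?m -` U \<subseteq> closure (layer P i)"
    proof
      fix x assume "x \<in> ?m -` U"
      then have "?m x \<in> closure (layer P (Suc i))" using step.prems(2) by blast
      then show "x \<in> closure (layer P i)"
        by (simp add: layer_Suc[OF i] closure_mirror del: layer.simps)
    qed
    show "real i - 1 < fst x \<and> fst x < real i" if "x \<in> ?m -` U" for x
      using step.prems(3)[of "?m x"] that by (simp add: mirror_def)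
  qed
  then have "x \<in> layer P (Suc i)" if "x \<in> U" for x
    using that subsetD[of "?m -` U" "layer P i" "?m x"] by (simp add: layer_Suc[OF i] del: layer.simps)
  then show ?case by blast
qed

text \<open>A point off the integer lines lies in an open strip that meets the closure of one layer
  only, and an open part of this closure inside the strip belongs to the layer itself.\<close>

lemma Omega_cases:
  assumes "x \<in> Omega P"
  shows "(\<exists>i\<in>{1..N}. x \<in> layer P i) \<or> (\<exists>j\<le>N. fst x = real j)"
proof (cases "\<exists>j\<le>N. fst x = real j")
  case False
  \<comment> \<open>Layer \<open>i\<close> lies strictly between the lines i - 1 and i, hence the
    ceiling.\<close>
  define i where "i = nat \<lceil>fst x\<rceil>"
  have pos: "0 < fst x" "fst x < real N" using Omega_strip[OF assms] .
  have ri: "real i = of_int \<lceil>fst x\<rceil>" using pos by (simp add: i_def)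
  have iN: "i \<le> N" using pos by (simp add: i_def ceiling_le_iff nat_le_iff)
  have i1: "1 \<le> i" using pos by (simp add: i_def Suc_le_eq)
  have "fst x \<noteq> real i" using False iN by auto
  then have x: "real i - 1 < fst x" "fst x < real i" using ri ceiling_correct[of "fst x"] by linarith+
  let ?U = "Omega P \<inter> ({real i - 1<..<real i} \<times> UNIV)"
  have "?U \<subseteq> layer P i"
  proof (rule open_subset_closure_layer[OF i1])
    show "open ?U" by (intro open_Int open_Omega open_Times) auto
    show "?U \<subseteq> closure (layer P i)"
    proof
      fix y assume y: "y \<in> ?U"
      then obtain j where j: "j \<in> {1..N}" "y \<in> closure (layer P j)"
        using interior_subset unfolding Omega_def by blast
      have "real i - 1 < fst y" "fst y < real i" using y by auto
      with closure_layer_strip[OF j(2)] have "real j < real i + 1" "real i < real j + 1" by linarith+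
      then have "i = j" by linarith
      with j show "y \<in> closure (layer P i)" by simp
    qed
  qed auto
  moreover have "x \<in> ?U" using assms x by (cases x) auto
  ultimately show ?thesis using i1 iN by auto
qed simp

lemma AE_Omega_layers:
  "AE x in lebesgue. x \<in> Omega P \<longrightarrow> (\<exists>i\<in>{1..N}. x \<in> layer P i)"
proof -
  have "negligible (\<Union>j\<in>{..N}. {x :: plane. fst x = real j})"
    by (rule negligible_Union[OF finite_imageI]) (auto intro: negligible_vertical_line)
  then have "AE x in lebesgue. x \<notin> (\<Union>j\<in>{..N}. {x :: plane. fst x = real j})"
    using negligible_iff_null_sets AE_not_in by blast
  then show ?thesis
  proof eventually_elim
    case (elim x)
    then show ?case using Omega_cases[of x] by auto
  qed
qed

text \<open>The layers exhaust \<open>Omega P\<close> up to finitely many vertical lines, a null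
  set, and weak gradients restrict to open subsets.\<close>

lemma grad_inner_Omega:
  assumes u: "u \<in> H1 (Omega P)" and v: "v \<in> H1 (Omega P)"
  shows "grad_inner (Omega P) u v = (\<Sum>i\<in>{1..N}. grad_inner (layer P i) u v)"
proof -
  let ?f = "\<lambda>x. inner (grad (Omega P) u x) (grad (Omega P) v x)"
  have f: "set_integrable lebesgue (Omega P) ?f"
    by (intro L2_on_inner_integrable H1_L2 u v)
  have fi: "set_integrable lebesgue (layer P i) ?f" if "i \<in> {1..N}" for i
    using that by (intro set_integrable_subset[OF f] layer_subset_Omega) (auto simp: open_layer)
  have "AE x in lebesgue. indicator (Omega P) x *\<^sub>R ?f x = (\<Sum>i\<in>{1..N}. indicator (layer P i) x *\<^sub>R ?f x)"
    using AE_Omega_layers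
  proof eventually_elim
    case (elim x)
    show ?case
    proof (cases "x \<in> Omega P")
      case True
      then obtain i where i: "i \<in> {1..N}" "x \<in> layer P i" using elim by blast
      have "indicator (layer P j) x = (if j = i then 1 else 0 :: real)" for j
        using layer_disjoint[OF i(2), of j] i(2) by (cases "x \<in> layer P j") auto
      then have "(\<Sum>j\<in>{1..N}. indicator (layer P j) x *\<^sub>R ?f x) = (\<Sum>j\<in>{1..N}. if j = i then ?f x else 0)"
        by (intro sum.cong) auto
      then show ?thesis using i True by simp
    next
      case False
      then have "x \<notin> layer P i" if "i \<in> {1..N}" for i using that layer_subset_Omega[of i] by auto
      then show ?thesis using False by simp
    qed
  qed
  then have "grad_inner (Omega P) u v = integral\<^sup>L lebesgue (\<lambda>x. \<Sum>i\<in>{1..N}. indicator (layer P i) x *\<^sub>R ?f x)"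
    unfolding grad_inner_def set_lebesgue_integral_def using f fi
    by (intro integral_cong_AE borel_measurable_integrable Bochner_Integration.integrable_sum)
      (auto simp: set_integrable_def)
  also have "\<dots> = (\<Sum>i\<in>{1..N}. integral\<^sup>L lebesgue (\<lambda>x. indicator (layer P i) x *\<^sub>R ?f x))"
    using fi by (intro Bochner_Integration.integral_sum) (auto simp: set_integrable_def)
  also have "\<dots> = (\<Sum>i\<in>{1..N}. grad_inner (layer P i) u v)"
    using grad_inner_subset[OF open_layer layer_subset_Omega u v]
    by (intro sum.cong) (auto simp: set_lebesgue_integral_def)
  finally show ?thesis .
qed

end

section \<open>The finite element space\<close>

declare split_paired_All [simp del] split_paired_Ex [simp del]

lemma psd_form_grad_inner: "open S \<Longrightarrow> psd_form (H1 S) (grad_inner S)"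
  by unfold_locales
    (rule H1_zero H1_lincomb grad_inner_lincomb grad_inner_nonneg grad_inner_commute; assumption)+

lemma psd_form_subset:
  assumes "psd_form H B" "H' \<subseteq> H" "(\<lambda>x. 0) \<in> H'"
    and "\<And>u v a b. u \<in> H' \<Longrightarrow> v \<in> H' \<Longrightarrow> (\<lambda>x. a * u x + b * v x) \<in> H'"
  shows "psd_form H' B"
proof -
  interpret psd_form H B by fact
  show ?thesis
    using assms(2-4) by unfold_locales (auto intro!: lincomb_left commute nonneg)
qed

lemma iface_dofD:
  assumes "iface_dof P i k"
  shows "\<exists>x\<in>iface P i. shape P k x \<noteq> 0"
    and "x \<notin> layer P i \<Longrightarrow> x \<notin> iface P i \<Longrightarrow> x \<notin> layer P (Suc i) \<Longrightarrow> shape P k x = 0"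
  using assms unfolding iface_dof_def by blast+

locale layered_fe = layered +
  assumes fe: "fe_space P"
begin

abbreviation "K \<equiv> ndof P + nlat P"

lemma fun_spanI: "v = (\<lambda>x. \<Sum>k<n. c k * \<phi> k x) \<Longrightarrow> v \<in> fun_span n \<phi>"
  unfolding fun_span_def mem_Collect_eq by (intro exI[of _ c] conjI TrueI)

lemma fun_spanE:
  assumes "v \<in> fun_span n \<phi>"
  obtains c where "v = (\<lambda>x. \<Sum>k<n. c k * \<phi> k x)"
  using assms unfolding fun_span_def mem_Collect_eq by (elim exE conjE) (rule that)

lemma Xh_zero: "(\<lambda>x. 0) \<in> Xh P"
  unfolding Xh_def by (rule fun_spanI[of _ "\<lambda>_. 0"]) simp

lemma fun_span_lincomb:
  assumes "u \<in> fun_span n \<phi>" "v \<in> fun_span n \<phi>"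
  shows "(\<lambda>x. a * u x + b * v x) \<in> fun_span n \<phi>"
proof -
  obtain c where c: "u = (\<lambda>x. \<Sum>k<n. c k * \<phi> k x)" using assms(1) by (rule fun_spanE)
  obtain d where d: "v = (\<lambda>x. \<Sum>k<n. d k * \<phi> k x)" using assms(2) by (rule fun_spanE)
  from c d have "(\<lambda>x. a * u x + b * v x) = (\<lambda>x. \<Sum>k<n. (a * c k + b * d k) * \<phi> k x)"
    by (simp add: sum_distrib_left sum.distrib algebra_simps)
  then show ?thesis by (rule fun_spanI)
qed

lemmas Xh_lincomb = fun_span_lincomb[of _ K "shape P", folded Xh_def]
lemmas Vh_lincomb = fun_span_lincomb[of _ "ndof P" "shape P", folded Vh_def]

lemma fun_span_subset_sum:
  assumes "A \<subseteq> {..<n}"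
  shows "(\<lambda>x. \<Sum>k\<in>A. c k * \<phi> k x) \<in> fun_span n \<phi>"
proof -
  have "(\<lambda>x. \<Sum>k\<in>A. c k * \<phi> k x) = (\<lambda>x. \<Sum>k<n. (if k \<in> A then c k else 0) * \<phi> k x)"
    by (intro ext sum.mono_neutral_cong_left) (use assms in auto)
  then show ?thesis by (rule fun_spanI)
qed

lemma Vh_subset_Xh: "Vh P \<subseteq> Xh P"
proof
  fix v assume "v \<in> Vh P"
  then obtain c where "v = (\<lambda>x. \<Sum>k<ndof P. c k * shape P k x)" unfolding Vh_def by (rule fun_spanE)
  then show "v \<in> Xh P" unfolding Xh_def by (simp add: fun_span_subset_sum)
qed

lemma Vh_zero: "(\<lambda>x. 0) \<in> Vh P"
  using fun_span_subset_sum[of "{}" "ndof P" _ "shape P"] by (simp add: Vh_def)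

lemma shape_Xh: "k < K \<Longrightarrow> shape P k \<in> Xh P"
  using fun_span_subset_sum[of "{k}" K "\<lambda>_. 1" "shape P"] by (simp add: Xh_def)

lemma conf: "k < K \<Longrightarrow> continuous_on (closure (Omega P)) (shape P k)"
  "k < K \<Longrightarrow> shape P k \<in> H1 (Omega P)"
  "Vh P \<subseteq> H10 (Omega P)" "v \<in> Vh P \<Longrightarrow> x \<notin> Omega P \<Longrightarrow> v x = 0"
  using fe unfolding fe_space_def conforming_functions_def by blast+

lemma Xh_H1: "v \<in> Xh P \<Longrightarrow> v \<in> H1 (Omega P)"
proof -
  interpret psd_form "H1 (Omega P)" "grad_inner (Omega P)"
    by (rule psd_form_grad_inner[OF open_Omega])
  assume "v \<in> Xh P"
  then obtain c where v: "v = (\<lambda>x. \<Sum>k<K. c k * shape P k x)" unfolding Xh_def by (rule fun_spanE)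
  show ?thesis unfolding v by (intro sum_mem scale_mem conf) auto
qed

lemma Xh_continuous: "v \<in> Xh P \<Longrightarrow> continuous_on (closure (Omega P)) v"
proof -
  assume "v \<in> Xh P"
  then obtain c where v: "v = (\<lambda>x. \<Sum>k<K. c k * shape P k x)" unfolding Xh_def by (rule fun_spanE)
  show ?thesis unfolding v by (intro continuous_intros conf) auto
qed

text \<open>Degrees of freedom on the lateral lines count as interface ones of index 0 or
  \<open>N\<close>, so two cases cover all shape functions.\<close>

lemma dof_cases:
  assumes "k < K"
  obtains i where "i \<in> {1..N}" "layer_dof P i k" "k < ndof P" | i where "i \<le> N" "iface_dof P i k"
proof (cases "k < ndof P")
  case True
  then have "(\<exists>i\<in>{1..N}. layer_dof P i k) \<or> (\<exists>i\<in>{1..<N}. iface_dof P i k)"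
    using fe unfolding fe_space_def conforming_interfaces_def by blast
  then consider i where "i \<in> {1..N}" "layer_dof P i k" | i where "i \<in> {1..<N}" "iface_dof P i k"
    by blast
  then show ?thesis
  proof cases
    case (1 i)
    then show ?thesis using that(1) True by blast
  next
    case (2 i)
    then have "i \<le> N" by simp
    then show ?thesis using that(2) 2(2) by blast
  qed
next
  case False
  then have "k \<in> {ndof P..<K}" using assms by simp
  then have "iface_dof P 0 k \<or> iface_dof P N k"
    using fe unfolding fe_space_def conforming_interfaces_def by blast
  then show ?thesis using that(2)[of 0] that(2)[of N] by auto
qed

lemma layer_dof_zero: "layer_dof P i k \<Longrightarrow> x \<notin> layer P i \<Longrightarrow> shape P k x = 0"
  by (simp add: layer_dof_def)

lemma iface_dof_zero:
  assumes "iface_dof P i k" "i \<le> N" "j \<le> N" "j \<noteq> i" "x \<in> iface P j"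
  shows "shape P k x = 0"
  using iface_dofD(2)[OF assms(1)] iface_layer[OF assms(3,5)] iface_disjoint[OF assms(3,2,5)] assms(4)
  by blast

lemma iface_dof_unique: "iface_dof P i k \<Longrightarrow> iface_dof P j k \<Longrightarrow> i \<le> N \<Longrightarrow> j \<le> N \<Longrightarrow> i = j"
  using iface_dofD(1)[of P i k] iface_dof_zero[of j k i] by blast

lemma iface_dof_inner:
  assumes "iface_dof P i k" "k < K" "1 \<le> i" "i < N"
  shows "k < ndof P"
proof (rule ccontr)
  assume "\<not> k < ndof P"
  with assms(2) have "k \<in> {ndof P..<K}" by simp
  then have "iface_dof P 0 k \<or> iface_dof P N k"
    using fe unfolding fe_space_def conforming_interfaces_def by blast
  then show False
    using iface_dof_unique[OF assms(1), of 0] iface_dof_unique[OF assms(1), of N] assms by auto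
qed

lemma iface_dof_layer_dof: "iface_dof P i k \<Longrightarrow> i \<le> N \<Longrightarrow> \<not> layer_dof P j k"
  using iface_dofD(1)[of P i k] iface_layer[of i] layer_dof_zero[of j k] by blast

text \<open>All other shape functions vanish on interface \<open>j\<close>, being supported in open
  layers or near another interface.\<close>

lemma trace_sum:
  assumes "j \<le> N" "x \<in> iface P j"
  shows "(\<Sum>k<K. c k * shape P k x) = (\<Sum>k | k < K \<and> iface_dof P j k. c k * shape P k x)"
proof (rule sum.mono_neutral_right)
  show "\<forall>k\<in>{..<K} - {k. k < K \<and> iface_dof P j k}. c k * shape P k x = 0"
  proof
    fix k assume k: "k \<in> {..<K} - {k. k < K \<and> iface_dof P j k}"
    then have "k < K" by simp
    then have "shape P k x = 0"
    proof (cases rule: dof_cases)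
      case (1 i)
      then show ?thesis using iface_layer[OF assms] by (auto intro: layer_dof_zero)
    next
      case (2 i)
      then show ?thesis using k assms by (intro iface_dof_zero[of i k j]) auto
    qed
    then show "c k * shape P k x = 0" by simp
  qed
qed auto

lemma coeff_zero:
  assumes "j \<le> N" "\<And>x. x \<in> iface P j \<Longrightarrow> (\<Sum>k<K. c k * shape P k x) = 0" "k < K" "iface_dof P j k"
  shows "c k = 0"
proof -
  have "lin_indep_on (iface P j) {k. k < K \<and> iface_dof P j k} (shape P)"
    using fe assms(1) unfolding fe_space_def conforming_interfaces_def by blast
  moreover have "\<forall>x\<in>iface P j. (\<Sum>k | k < K \<and> iface_dof P j k. c k * shape P k x) = 0"
  proof
    fix x assume x: "x \<in> iface P j"
    show "(\<Sum>k | k < K \<and> iface_dof P j k. c k * shape P k x) = 0"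
      using assms(2)[OF x] unfolding trace_sum[OF assms(1) x] .
  qed
  ultimately show ?thesis using assms(3,4) unfolding lin_indep_on_def by blast
qed

text \<open>The interior degrees of freedom of a layer. For a layer index between 1 and
  \<open>N\<close>, their shape functions span \<open>Vh_layer P j\<close>; see
  \<open>bubble_Vh_layer\<close> and \<open>Vh_layer_repr\<close>.\<close>

definition bubbles :: "nat \<Rightarrow> nat set" where
  "bubbles j = {k. k < K \<and> layer_dof P j k}"

lemma finite_bubbles [simp]: "finite (bubbles j)"
  by (simp add: bubbles_def)

lemma bubbles_ndof: "k \<in> bubbles j \<Longrightarrow> k < ndof P"
proof -
  assume k: "k \<in> bubbles j"
  then have "k < K" by (simp add: bubbles_def)
  then show ?thesis
  proof (cases rule: dof_cases)
    case (2 i)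
    then show ?thesis using iface_dof_layer_dof[of i k j] k by (simp add: bubbles_def)
  qed
qed

lemma bubble_Vh_layer: "(\<lambda>x. \<Sum>k\<in>bubbles j. c k * shape P k x) \<in> Vh_layer P j"
proof -
  have "(\<lambda>x. \<Sum>k\<in>bubbles j. c k * shape P k x) \<in> Vh P"
    unfolding Vh_def using bubbles_ndof by (intro fun_span_subset_sum) blast
  moreover have "(\<Sum>k\<in>bubbles j. c k * shape P k x) = 0" if "x \<notin> layer P j" for x
    using that by (intro sum.neutral) (auto simp: bubbles_def layer_dof_zero)
  ultimately show ?thesis by (simp add: Vh_layer_def)
qed

lemma closure_layer_other: "x \<in> closure (layer P j) \<Longrightarrow> x \<in> layer P i \<Longrightarrow> i = j"
  using closure_layer_strip[of x j] layer_strip[of x i] by linarith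

text \<open>Independence of traces kills the coefficients of both adjacent interfaces, and of the
  remaining shape functions only the bubbles are nonzero on the closed layer. Agreement on the
  closed layer suits mirrored functions, which may be arbitrary elsewhere.\<close>

lemma bubble_repr:
  assumes j: "1 \<le> j" "j \<le> N" and v: "v \<in> Xh P"
    and 0: "\<And>x. x \<in> iface P (j - 1) \<Longrightarrow> v x = 0" "\<And>x. x \<in> iface P j \<Longrightarrow> v x = 0"
  shows "\<exists>c. \<forall>x\<in>closure (layer P j). (\<Sum>k\<in>bubbles j. c k * shape P k x) = v x"
proof -
  obtain c where c: "v = (\<lambda>x. \<Sum>k<K. c k * shape P k x)" using v unfolding Xh_def by (rule fun_spanE)
  have c0: "c k = 0" if "k < K" "iface_dof P i k" "i = j - 1 \<or> i = j" for k i
  proof -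
    have "(\<Sum>k<K. c k * shape P k x) = 0" if "x \<in> iface P i" for x
      using 0 that \<open>i = j - 1 \<or> i = j\<close> fun_cong[OF c, of x] by metis
    then show ?thesis using j that by (intro coeff_zero[of i c k]) auto
  qed
  have "(\<Sum>k\<in>bubbles j. c k * shape P k x) = v x" if x: "x \<in> closure (layer P j)" for x
    unfolding c
  proof (rule sum.mono_neutral_left)
    show "\<forall>k\<in>{..<K} - bubbles j. c k * shape P k x = 0"
    proof
      fix k assume k: "k \<in> {..<K} - bubbles j"
      then have kK: "k < K" by simp
      then show "c k * shape P k x = 0"
      proof (cases rule: dof_cases)
        case (1 i)
        then have "i \<noteq> j" using k by (auto simp: bubbles_def)
        then have "x \<notin> layer P i" using closure_layer_other[OF x] by blast
        then show ?thesis using 1 by (simp add: layer_dof_zero)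
      next
        case (2 i)
        show ?thesis
        proof (cases "i = j - 1 \<or> i = j")
          case True
          then show ?thesis using c0[OF kK 2(2)] by simp
        next
          case False
          then have "x \<notin> layer P i" "x \<notin> layer P (Suc i)"
            using closure_layer_other[OF x, of i] closure_layer_other[OF x, of "Suc i"] by auto
          moreover have "x \<notin> iface P i"
          proof
            assume "x \<in> iface P i"
            then have "fst x = real i" using iface_line 2(1) by blast
            with closure_layer_strip[OF x] have "real j \<le> real i + 1" "real i \<le> real j" by linarith+
            then have "j \<le> Suc i" "i \<le> j" by linarith+
            then show False using False by linarith
          qed
          ultimately show ?thesis using iface_dofD(2)[OF 2(2)] by simp
        qed
      qed
    qed
  qed (auto simp: bubbles_def)
  then show ?thesis by blast
qed

lemma Vh_layer_repr:
  assumes j: "1 \<le> j" "j \<le> N" and b: "b \<in> Vh_layer P j"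
  obtains c where "b = (\<lambda>x. \<Sum>k\<in>bubbles j. c k * shape P k x)"
proof -
  have b0: "b x = 0" if "x \<notin> layer P j" for x using b that by (simp add: Vh_layer_def)
  have "b \<in> Xh P" using b Vh_subset_Xh by (auto simp: Vh_layer_def)
  moreover have "b x = 0" if "x \<in> iface P (j - 1)" for x
    using b0 iface_layer[of "j - 1" x j] that j by auto
  moreover have "b x = 0" if "x \<in> iface P j" for x
    using b0 iface_layer[of j x j] that j by auto
  ultimately obtain c where c: "\<forall>x\<in>closure (layer P j). (\<Sum>k\<in>bubbles j. c k * shape P k x) = b x"
    using bubble_repr[OF j] by blast
  have "b x = (\<Sum>k\<in>bubbles j. c k * shape P k x)" for x
  proof (cases "x \<in> layer P j")
    case True
    then show ?thesis using c closure_subset[of "layer P j"] by auto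
  next
    case False
    then show ?thesis using b0 bubble_Vh_layer[of c j] by (simp add: Vh_layer_def)
  qed
  then show ?thesis using that[of c] by blast
qed

lemma Vh_layer_Xh: "b \<in> Vh_layer P j \<Longrightarrow> b \<in> Xh P"
  using Vh_subset_Xh by (auto simp: Vh_layer_def)

section \<open>Gradient forms on single layers\<close>

abbreviation B :: "nat \<Rightarrow> (plane \<Rightarrow> real) \<Rightarrow> (plane \<Rightarrow> real) \<Rightarrow> real" where
  "B j \<equiv> grad_inner (layer P j)"

lemma psd_form_layer:
  assumes "1 \<le> j" "j \<le> N"
  shows "psd_form (Xh P) (B j)"
  using Xh_H1 H1_subset[OF open_layer layer_subset_Omega[OF assms]]
  by (intro psd_form_subset[OF psd_form_grad_inner[OF open_layer]] Xh_zero Xh_lincomb subsetI) auto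

lemma psd_form_Omega: "psd_form (Xh P) (grad_inner (Omega P))"
  using Xh_H1 by (intro psd_form_subset[OF psd_form_grad_inner[OF open_Omega]] Xh_zero Xh_lincomb subsetI) auto

lemma B_zero:
  assumes "1 \<le> j" "j \<le> N" "u \<in> Xh P" "\<And>x. x \<in> layer P j \<Longrightarrow> v x = 0"
  shows "B j u v = 0" "B j v u = 0"
proof -
  interpret psd_form "Xh P" "B j" by (rule psd_form_layer[OF assms(1,2)])
  have "B j v u = B j (\<lambda>x. 0) u"
    using assms(4) by (intro grad_inner_cong) auto
  then show "B j v u = 0" using zero_left[OF assms(3)] by simp
  then show "B j u v = 0" by (simp add: grad_inner_commute)
qed

lemma B_Vh_layer:
  assumes "1 \<le> j" "j \<le> N" "v \<in> Xh P" "b \<in> Vh_layer P j"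
  shows "grad_inner (Omega P) v b = B j v b"
proof -
  have z: "b x = 0" if "x \<in> layer P i" "i \<noteq> j" for x i
    using assms(4) layer_disjoint[of x i j] that by (auto simp: Vh_layer_def)
  have "grad_inner (Omega P) v b = (\<Sum>i\<in>{1..N}. B i v b)"
    using assms Vh_layer_Xh Xh_H1 by (intro grad_inner_Omega) auto
  also have "\<dots> = (\<Sum>i\<in>{j}. B i v b)"
  proof (rule sum.mono_neutral_right)
    show "\<forall>i\<in>{1..N} - {j}. B i v b = 0"
    proof
      fix i assume i: "i \<in> {1..N} - {j}"
      then show "B i v b = 0" by (intro B_zero(1) z[where i = i] assms) auto
    qed
  qed (use assms in auto)
  finally show ?thesis by simp
qed

text \<open>Conformity gives membership in \<open>H10 (Omega P)\<close>, so the Poincare argument is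
  run on the whole domain; the energy of \<open>b\<close> there is its energy on the layer.
  Continuity turns zero a.e. into zero everywhere.\<close>

lemma Vh_layer_definite:
  assumes j: "1 \<le> j" "j \<le> N" and b: "b \<in> Vh_layer P j" and 0: "B j b b = 0"
  shows "b x = 0"
proof (cases "x \<in> Omega P")
  case True
  have bV: "b \<in> Vh P" using b by (simp add: Vh_layer_def)
  have "AE x in lebesgue. x \<in> Omega P \<longrightarrow> b x = 0"
  proof (rule H10_grad_0[OF open_Omega, of "real N"])
    show "b \<in> H10 (Omega P)" using bV conf(3) by blast
    show "grad_inner (Omega P) b b = 0"
      using B_Vh_layer[OF j Vh_layer_Xh[OF b] b] 0 by simp
  qed (use Omega_strip in force)
  moreover have "continuous_on (Omega P) b"
    using Xh_continuous[OF Vh_layer_Xh[OF b]] closure_subset continuous_on_subset by blast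
  ultimately show ?thesis using continuous_AE_0[OF open_Omega] True by blast
next
  case False
  then show ?thesis using b conf(4) by (simp add: Vh_layer_def)
qed

subsection \<open>Discrete harmonic functions\<close>

text \<open>Harmonicity on one layer is asked within \<open>Xh P\<close> rather than
  \<open>Vh P\<close>, because a mirror image, or an extension from the last interface, may be
  nonzero on a lateral line.\<close>

definition harmonic :: "nat \<Rightarrow> (plane \<Rightarrow> real) \<Rightarrow> bool" where
  "harmonic j v \<longleftrightarrow> v \<in> Xh P \<and> (\<forall>b\<in>Vh_layer P j. B j v b = 0)"

lemma harmonic_lincomb:
  assumes j: "1 \<le> j" "j \<le> N" and "harmonic j u" "harmonic j v"
  shows "harmonic j (\<lambda>x. a * u x + b * v x)"
proof -
  interpret psd_form "Xh P" "B j" by (rule psd_form_layer[OF j])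
  show ?thesis
    using assms(3,4) Vh_layer_Xh by (auto simp: harmonic_def Xh_lincomb lincomb_left)
qed

lemma harmonic_zero: "1 \<le> j \<Longrightarrow> j \<le> N \<Longrightarrow> harmonic j (\<lambda>x. 0)"
  using B_zero Vh_layer_Xh Xh_zero by (auto simp: harmonic_def)

text \<open>The difference has zero traces and is therefore a bubble on the closed layer. Tested
  against itself it has energy zero, so it vanishes.\<close>

lemma harmonic_unique:
  assumes j: "1 \<le> j" "j \<le> N" and u: "harmonic j u" and v: "harmonic j v"
    and eq: "\<And>x. x \<in> iface P (j - 1) \<Longrightarrow> u x = v x" "\<And>x. x \<in> iface P j \<Longrightarrow> u x = v x"
    and x: "x \<in> closure (layer P j)"
  shows "u x = v x"
proof -
  let ?d = "\<lambda>x. 1 * u x + (- 1) * v x"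
  have d: "harmonic j ?d" by (rule harmonic_lincomb[OF j u v])
  then have dX: "?d \<in> Xh P" by (simp only: harmonic_def)
  obtain c where c: "\<forall>x\<in>closure (layer P j). (\<Sum>k\<in>bubbles j. c k * shape P k x) = ?d x"
    using bubble_repr[OF j dX] eq by force
  let ?b = "\<lambda>x. \<Sum>k\<in>bubbles j. c k * shape P k x"
  have b: "?b \<in> Vh_layer P j" by (rule bubble_Vh_layer)
  have eq: "?b x = ?d x" if "x \<in> layer P j" for x
    using c that closure_subset by blast
  have "B j ?b ?b = B j ?d ?b" by (rule grad_inner_cong) (use eq in auto)
  also have "\<dots> = 0" using d b unfolding harmonic_def by blast
  finally have "?b x = 0" by (rule Vh_layer_definite[OF j b])
  then show ?thesis using c x by auto
qed

text \<open>Subtracting the projection onto the bubbles makes \<open>w\<close> harmonic and changes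
  it inside the layer only.\<close>

lemma harmonic_exists:
  assumes j: "1 \<le> j" "j \<le> N" and w: "w \<in> Xh P"
  obtains v where "harmonic j v" "\<And>x. x \<notin> layer P j \<Longrightarrow> v x = w x"
proof -
  interpret psd_form "Xh P" "B j" by (rule psd_form_layer[OF j])
  have sX: "shape P k \<in> Xh P" if "k \<in> bubbles j" for k
    using that by (auto simp: bubbles_def intro: shape_Xh)
  obtain c where c: "\<forall>k\<in>bubbles j. B j (\<lambda>x. w x - (\<Sum>i\<in>bubbles j. c i * shape P i x)) (shape P k) = 0"
    using projection_exists[where v = "shape P", OF finite_bubbles sX w] by blast
  let ?v = "\<lambda>x. w x - (\<Sum>i\<in>bubbles j. c i * shape P i x)"
  have vX: "?v \<in> Xh P"
    using w bubble_Vh_layer[of c j] Vh_layer_Xh by (intro diff_mem) auto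
  have "B j ?v b = 0" if b: "b \<in> Vh_layer P j" for b
  proof -
    obtain d where d: "b = (\<lambda>x. \<Sum>k\<in>bubbles j. d k * shape P k x)"
      using b by (rule Vh_layer_repr[OF j])
    have "B j ?v b = (\<Sum>k\<in>bubbles j. B j ?v (\<lambda>x. d k * shape P k x))"
      unfolding d using vX sX by (intro sum_right scale_mem) auto
    also have "\<dots> = 0"
      using c vX sX by (intro sum.neutral) (auto simp: scale_right)
    finally show ?thesis .
  qed
  moreover have "?v x = w x" if "x \<notin> layer P j" for x
    using bubble_Vh_layer[of c j] that by (simp add: Vh_layer_def)
  ultimately show ?thesis using vX that[of ?v] by (auto simp: harmonic_def)
qed

section \<open>Globally discrete harmonic functions\<close>

lemma Gamma_Vh: "v \<in> Vh_Gamma P \<Longrightarrow> v \<in> Vh P"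
  by (simp add: Vh_Gamma_def)

lemma Gamma_Xh: "v \<in> Vh_Gamma P \<Longrightarrow> v \<in> Xh P"
  using Gamma_Vh Vh_subset_Xh by blast

lemma Gamma_harmonic:
  assumes "1 \<le> j" "j \<le> N" "v \<in> Vh_Gamma P"
  shows "harmonic j v"
  unfolding harmonic_def
proof (intro conjI ballI)
  show "v \<in> Xh P" by (rule Gamma_Xh) fact
  fix b assume "b \<in> Vh_layer P j"
  then show "B j v b = 0"
    using assms B_Vh_layer[OF assms(1,2) \<open>v \<in> Xh P\<close>] by (auto simp: Vh_Gamma_def)
qed

lemma Gamma_lincomb:
  assumes "u \<in> Vh_Gamma P" "v \<in> Vh_Gamma P"
  shows "(\<lambda>x. a * u x + b * v x) \<in> Vh_Gamma P"
proof -
  interpret psd_form "Xh P" "grad_inner (Omega P)" by (rule psd_form_Omega)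
  have "grad_inner (Omega P) (\<lambda>x. a * u x + b * v x) w = 0" if "i \<in> {1..N}" "w \<in> Vh_layer P i" for i w
    using assms that Gamma_Xh Vh_layer_Xh by (subst lincomb_left) (auto simp: Vh_Gamma_def)
  then show ?thesis using assms by (simp add: Vh_Gamma_def Vh_lincomb)
qed

lemma Gamma_zero: "(\<lambda>x. 0) \<in> Vh_Gamma P"
proof -
  interpret psd_form "Xh P" "grad_inner (Omega P)" by (rule psd_form_Omega)
  show ?thesis using Vh_layer_Xh by (auto simp: Vh_Gamma_def Vh_zero zero_left)
qed

lemma Vh_lateral:
  assumes "v \<in> Vh P" "x \<in> iface P 0 \<or> x \<in> iface P N"
  shows "v x = 0"
  using iface_lateral[of x] conf(4)[OF assms(1)] assms(2) by blast

text \<open>Of \<open>w\<close> only the shape functions of interface \<open>i\<close> are kept, and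
  the projection onto the bubbles of all layers is subtracted. Bubbles vanish on every interface, so
  this correction leaves the traces alone.\<close>

lemma Gamma_exists:
  assumes i: "1 \<le> i" "i < N" and w: "w \<in> Xh P"
  obtains v where "v \<in> Vh_Gamma P" "\<And>x. x \<in> iface P i \<Longrightarrow> v x = w x"
    "\<And>j x. j \<le> N \<Longrightarrow> j \<noteq> i \<Longrightarrow> x \<in> iface P j \<Longrightarrow> v x = 0"
proof -
  interpret psd_form "Xh P" "grad_inner (Omega P)" by (rule psd_form_Omega)
  obtain c where c: "w = (\<lambda>x. \<Sum>k<K. c k * shape P k x)" using w unfolding Xh_def by (rule fun_spanE)
  let ?I = "{k. k < K \<and> iface_dof P i k}"
  let ?w = "\<lambda>x. \<Sum>k\<in>?I. c k * shape P k x"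
  \<comment> \<open>An inner interface carries no lateral shape functions, so this part lies in
    \<open>Vh P\<close> although \<open>w\<close> is only in \<open>Xh P\<close>.\<close>
  have wV: "?w \<in> Vh P"
    unfolding Vh_def using iface_dof_inner i by (intro fun_span_subset_sum) auto
  have w_i: "?w x = w x" if "x \<in> iface P i" for x
    unfolding c using trace_sum[of i x c] i that by simp
  have w_j: "?w x = 0" if "j \<le> N" "j \<noteq> i" "x \<in> iface P j" for j x
    using iface_dof_zero[of i _ j x] that i by (intro sum.neutral) auto
  let ?A = "\<Union>j\<in>{1..N}. bubbles j"
  have A: "finite ?A" by simp
  have AV: "k < ndof P" if "k \<in> ?A" for k using that bubbles_ndof by blast
  have sX: "shape P k \<in> Xh P" if "k \<in> ?A" for k using AV[OF that] by (intro shape_Xh) simp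
  have wX: "?w \<in> Xh P" using wV Vh_subset_Xh by blast
  obtain d where d: "\<forall>k\<in>?A. grad_inner (Omega P) (\<lambda>x. ?w x - (\<Sum>i\<in>?A. d i * shape P i x)) (shape P k) = 0"
    using projection_exists[where v = "shape P", OF A sX wX] by blast
  let ?b = "\<lambda>x. \<Sum>i\<in>?A. d i * shape P i x"
  let ?v = "\<lambda>x. ?w x - ?b x"
  have bV: "?b \<in> Vh P" unfolding Vh_def using AV by (intro fun_span_subset_sum) blast
  have vV: "?v \<in> Vh P" using Vh_lincomb[OF wV bV, of 1 "-1"] by simp
  then have vX: "?v \<in> Xh P" using Vh_subset_Xh by blast
  have "grad_inner (Omega P) ?v b = 0" if j: "j \<in> {1..N}" and b: "b \<in> Vh_layer P j" for j b
  proof -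
    obtain e where e: "b = (\<lambda>x. \<Sum>k\<in>bubbles j. e k * shape P k x)"
      using Vh_layer_repr[OF _ _ b] j by auto
    have "grad_inner (Omega P) ?v b = (\<Sum>k\<in>bubbles j. grad_inner (Omega P) ?v (\<lambda>x. e k * shape P k x))"
      unfolding e
    proof (rule sum_right[OF finite_bubbles _ vX])
      fix k assume "k \<in> bubbles j"
      then have "k \<in> ?A" using j by blast
      then show "(\<lambda>x. e k * shape P k x) \<in> Xh P" by (intro scale_mem sX)
    qed
    also have "\<dots> = 0"
    proof (rule sum.neutral, rule ballI)
      fix k assume "k \<in> bubbles j"
      then have k: "k \<in> ?A" using j by blast
      show "grad_inner (Omega P) ?v (\<lambda>x. e k * shape P k x) = 0"
        using scale_right[OF sX[OF k] vX] bspec[OF d k] by simp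
    qed
    finally show ?thesis .
  qed
  then have "?v \<in> Vh_Gamma P" using vV by (simp add: Vh_Gamma_def)
  moreover have b0: "?b x = 0" if "j \<le> N" "x \<in> iface P j" for j x
    using iface_layer[OF that] by (intro sum.neutral) (auto simp: bubbles_def layer_dof_zero)
  have "?v x = w x" if "x \<in> iface P i" for x
    using w_i[OF that] b0[of i x] i that by simp
  moreover have "?v x = 0" if "j \<le> N" "j \<noteq> i" "x \<in> iface P j" for j x
    using w_j[OF that] b0[OF that(1,3)] by simp
  ultimately show ?thesis using that[of ?v] by blast
qed

end

context layered_fe
begin

subsection \<open>Mirror symmetry\<close>

text \<open>\<open>2 * i + 1 - l\<close> is the other index of the pair \<open>i\<close>,
  \<open>Suc i\<close>, so one statement covers both directions of reflection.\<close>

lemma mirror_layer: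
  assumes i: "1 \<le> i" and l: "l \<in> {i, Suc i}"
  shows "mirror (2 * real i) -` layer P l = layer P (2 * i + 1 - l)"
    and "x \<in> closure (layer P (2 * i + 1 - l)) \<longleftrightarrow> mirror (2 * real i) x \<in> closure (layer P l)"
proof -
  show *: "mirror (2 * real i) -` layer P l = layer P (2 * i + 1 - l)"
  proof (cases "l = i")
    case True
    then have "2 * i + 1 - l = Suc i" by simp
    then show ?thesis using True layer_Suc[OF i] by simp
  next
    case False
    then have "l = Suc i" "2 * i + 1 - l = i" using l by auto
    then show ?thesis using layer_Suc[OF i, of P] by (simp add: vimage_def del: layer.simps)
  qed
  show "x \<in> closure (layer P (2 * i + 1 - l)) \<longleftrightarrow> mirror (2 * real i) x \<in> closure (layer P l)"
    unfolding *[symmetric] closure_mirror by simp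
qed

text \<open>Mirror symmetry speaks about open layers; continuity up to the boundary carries it to
  the closure, where the traces live.\<close>

lemma mirror_Xh:
  assumes i: "1 \<le> i" "i < N" and l: "l \<in> {i, Suc i}" and v: "v \<in> Xh P"
  obtains w where "w \<in> Xh P"
    "\<And>x. x \<in> closure (layer P (2 * i + 1 - l)) \<Longrightarrow> w x = v (mirror (2 * real i) x)"
proof -
  let ?m = "mirror (2 * real i)" and ?l = "2 * i + 1 - l"
  obtain w where w: "w \<in> Xh P" "\<forall>x\<in>layer P l. w x = v x" "mirrored_at P i w"
  proof -
    have "i \<in> {1..<N}" using i by simp
    then have "\<exists>w\<in>Xh P. (\<forall>x\<in>layer P l. w x = v x) \<and> mirrored_at P i w"
      using fe l v unfolding fe_space_def mirror_symmetric_def by blast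
    then show ?thesis using that by blast
  qed
  have mi: "w x = w (?m x)" if "x \<in> layer P i" for x
    using w(3)[unfolded mirrored_at_def, rule_format, of "real i - fst x" "snd x"] that
    by (simp add: mirror_def)
  have ml: "w x = w (?m x)" if "x \<in> layer P ?l" for x
  proof (cases "l = i")
    case True
    then have "?m x \<in> layer P i" using mirror_layer(1)[OF i(1) l] that by auto
    from mi[OF this] show ?thesis by simp
  next
    case False
    then have "?l = i" using l by auto
    then show ?thesis using mi that by simp
  qed
  have on_layer: "w x - v (?m x) = 0" if "x \<in> layer P ?l" for x
    using ml[OF that] w(2) that mirror_layer(1)[OF i(1) l] by auto
  have sub: "closure (layer P ?l) \<subseteq> closure (Omega P)" "closure (layer P l) \<subseteq> closure (Omega P)"
    using i l by (intro closure_mono layer_subset_Omega; auto)+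
  have "continuous_on (closure (layer P ?l)) (\<lambda>x. w x - v (?m x))"
  proof (intro continuous_on_diff)
    show "continuous_on (closure (layer P ?l)) w"
      using Xh_continuous[OF w(1)] sub(1) by (rule continuous_on_subset)
    show "continuous_on (closure (layer P ?l)) (\<lambda>x. v (?m x))"
      using mirror_layer(2)[OF i(1) l] sub(2)
      by (intro continuous_on_compose2[OF Xh_continuous[OF v] continuous_on_mirror]) blast
  qed
  note cont = this
  have "w x = v (?m x)" if "x \<in> closure (layer P ?l)" for x
  proof -
    have "w x - v (?m x) = 0"
      by (rule continuous_constant_on_closure[OF cont _ that]) (rule on_layer)
    then show ?thesis by simp
  qed
  with w(1) show ?thesis by (rule that)
qed

lemma B_mirror:
  assumes i: "1 \<le> i" "i < N" and l: "l \<in> {i, Suc i}" and v: "v1 \<in> Xh P" "v2 \<in> Xh P"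
    and w: "\<And>x. x \<in> layer P (2 * i + 1 - l) \<Longrightarrow> w1 x = v1 (mirror (2 * real i) x)"
      "\<And>x. x \<in> layer P (2 * i + 1 - l) \<Longrightarrow> w2 x = v2 (mirror (2 * real i) x)"
  shows "B (2 * i + 1 - l) w1 w2 = B l v1 v2"
proof -
  have "layer P l \<subseteq> Omega P" using i l by (intro layer_subset_Omega) auto
  then have "v1 \<in> H1 (layer P l)" "v2 \<in> H1 (layer P l)"
    using v Xh_H1 H1_subset open_layer by blast+
  from grad_inner_mirror[OF open_layer this, of "2 * real i"]
  show ?thesis
    unfolding mirror_layer(1)[OF i(1) l] using grad_inner_cong[OF w] by simp
qed

lemma mirror_on_iface: "fst x = real i \<Longrightarrow> mirror (2 * real i) x = x"
  by (simp add: mirror_def prod_eq_iff)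

lemma iface_closure:
  assumes "1 \<le> j" "j \<le> N" "x \<in> iface P (j - 1) \<or> x \<in> iface P j"
  shows "x \<in> closure (layer P j)"
  using assms iface_left[of "j - 1"] iface_right[of j] by auto

text \<open>Harmonicity is checked by mirroring the test function back: the image vanishes on both
  interfaces of layer \<open>l\<close>, so on that layer it is a bubble.\<close>

lemma mirror_harmonic:
  assumes i: "1 \<le> i" "i < N" and l: "l \<in> {i, Suc i}" and v: "harmonic l v"
  obtains w where "harmonic (2 * i + 1 - l) w"
    "\<And>x. x \<in> closure (layer P (2 * i + 1 - l)) \<Longrightarrow> w x = v (mirror (2 * real i) x)"
proof -
  let ?m = "mirror (2 * real i)" and ?l = "2 * i + 1 - l"
  have l': "?l \<in> {i, Suc i}" "2 * i + 1 - ?l = l" and lN: "1 \<le> l" "l \<le> N" "1 \<le> ?l" "?l \<le> N"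
    using l i by auto
  have vX: "v \<in> Xh P" using v by (simp add: harmonic_def)
  obtain w where w: "w \<in> Xh P" "\<And>x. x \<in> closure (layer P ?l) \<Longrightarrow> w x = v (?m x)"
    using mirror_Xh[OF i l vX] by blast
  have "B ?l w b = 0" if b: "b \<in> Vh_layer P ?l" for b
  proof -
    have b0: "b x = 0" if "x \<notin> layer P ?l" for x using b that by (simp add: Vh_layer_def)
    obtain b1 where b1: "b1 \<in> Xh P" "\<And>x. x \<in> closure (layer P l) \<Longrightarrow> b1 x = b (?m x)"
      using mirror_Xh[OF i l'(1) Vh_layer_Xh[OF b]] unfolding l'(2) by blast
    have b1_0: "b1 x = 0" if "x \<in> iface P (l - 1) \<or> x \<in> iface P l" for x
    proof -
      have "l - 1 \<le> N" using lN by simp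
      then have "x \<notin> layer P l" using that iface_layer[of "l - 1" x l] iface_layer[of l x l] lN by blast
      then have "?m x \<notin> layer P ?l"
        unfolding mirror_layer(1)[OF i(1) l, symmetric] vimage_eq mirror_mirror .
      then show ?thesis using b1(2)[OF iface_closure[OF lN(1,2) that]] b0 by simp
    qed
    then obtain c where c: "\<forall>x\<in>closure (layer P l). (\<Sum>k\<in>bubbles l. c k * shape P k x) = b1 x"
      using bubble_repr[OF lN(1,2) b1(1)] by blast
    \<comment> \<open>\<open>b1\<close> may be nonzero outside layer \<open>l\<close>, so it is
      replaced by the bubble that equals it on the closed layer and is an admissible test
      function.\<close>
    let ?b = "\<lambda>x. \<Sum>k\<in>bubbles l. c k * shape P k x"
    have bV: "?b \<in> Vh_layer P l" by (rule bubble_Vh_layer)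
    have "B ?l w b = B l v ?b"
    proof (rule B_mirror[OF i l vX Vh_layer_Xh[OF bV]])
      fix x assume x: "x \<in> layer P ?l"
      then have xc: "x \<in> closure (layer P ?l)" using closure_subset by blast
      then show "w x = v (?m x)" by (rule w(2))
      have "?m x \<in> closure (layer P l)" using mirror_layer(2)[OF i(1) l, of x] xc by simp
      with c b1(2)[OF this] show "b x = ?b (?m x)" by simp
    qed
    also have "\<dots> = 0" using v bV by (simp add: harmonic_def)
    finally show ?thesis .
  qed
  then have "harmonic ?l w" using w(1) by (simp add: harmonic_def)
  then show ?thesis using w(2) by (rule that)
qed

subsection \<open>Functions living on one interface\<close>

text \<open>The component space of interface \<open>i\<close>. On the two lateral lines its members
  vanish because they lie in \<open>Vh P\<close>.\<close>

definition Gi :: "nat \<Rightarrow> (plane \<Rightarrow> real) set" where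
  "Gi i = {v \<in> Vh_Gamma P. \<forall>j\<in>{1..<N}. j \<noteq> i \<longrightarrow> (\<forall>x\<in>iface P j. v x = 0)}"

lemma Gi_lincomb: "u \<in> Gi i \<Longrightarrow> v \<in> Gi i \<Longrightarrow> (\<lambda>x. a * u x + b * v x) \<in> Gi i"
  by (simp add: Gi_def Gamma_lincomb)

lemma Gi_Gamma: "v \<in> Gi i \<Longrightarrow> v \<in> Vh_Gamma P"
  by (simp add: Gi_def)

lemma Gi_iface:
  assumes "v \<in> Gi i" "j \<le> N" "j \<noteq> i" "x \<in> iface P j"
  shows "v x = 0"
proof (cases "j = 0 \<or> j = N")
  case True
  then show ?thesis using Vh_lateral[OF Gamma_Vh[OF Gi_Gamma[OF assms(1)]], of x] assms(4) by auto
next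
  case False
  then have "j \<in> {1..<N}" using assms by auto
  then show ?thesis using assms by (auto simp: Gi_def)
qed

text \<open>Both interfaces of such a layer carry zero trace, so uniqueness compares
  \<open>v\<close> with the harmonic function 0.\<close>

lemma Gi_layer_zero:
  assumes "v \<in> Gi i" "1 \<le> l" "l \<le> N" "l \<noteq> i" "l \<noteq> Suc i" "x \<in> closure (layer P l)"
  shows "v x = 0"
  by (rule harmonic_unique[OF assms(2,3) Gamma_harmonic[OF assms(2,3) Gi_Gamma[OF assms(1)]]
        harmonic_zero[OF assms(2,3)] _ _ assms(6)])
    (rule Gi_iface[OF assms(1)]; use assms in auto)+

text \<open>Mirroring the part on layer i + 1 gives a harmonic function on layer i with the same
  traces: unchanged on interface \<open>i\<close> and zero on the opposite one. Uniqueness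
  identifies the two, and therefore the energies on both sides agree.\<close>

lemma Gi_mirror:
  assumes i: "1 \<le> i" "i < N" and v: "v \<in> Gi i" and x: "x \<in> closure (layer P i)"
  shows "v x = v (mirror (2 * real i) x)"
proof -
  let ?m = "mirror (2 * real i)"
  have iN: "1 \<le> i" "i \<le> N" "1 \<le> Suc i" "Suc i \<le> N" using i by auto
  note h = Gamma_harmonic[OF _ _ Gi_Gamma[OF v]]
  have eq: "2 * i + 1 - Suc i = i" by simp
  obtain w where w: "harmonic i w" "\<And>x. x \<in> closure (layer P i) \<Longrightarrow> w x = v (?m x)"
    using mirror_harmonic[OF i _ h[OF iN(3,4)]] unfolding eq by blast
  have "v x = w x"
  proof (rule harmonic_unique[OF iN(1,2) h[OF iN(1,2)] w(1) _ _ x])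
    fix x assume x: "x \<in> iface P (i - 1)"
    have mx: "?m (?m x) \<in> iface P (i - 1)" using x by simp
    then have "?m x \<in> iface P (Suc i)" using mirror_iface[OF i, of "?m x"] by blast
    then have "v (?m x) = 0" using iN by (intro Gi_iface[OF v, of "Suc i"]) auto
    moreover have "v x = 0" using x iN by (intro Gi_iface[OF v, of "i - 1"]) auto
    ultimately show "v x = w x" using w(2)[OF iface_closure[OF iN(1,2)]] x by simp
  next
    fix x assume x: "x \<in> iface P i"
    then show "v x = w x"
      using w(2)[OF iface_closure[OF iN(1,2)]] mirror_on_iface[OF iface_line[OF iN(2) x]] by simp
  qed
  then show ?thesis using w(2)[OF x] by simp
qed

lemma Gi_B:
  assumes i: "1 \<le> i" "i < N" and "u \<in> Gi i" "v \<in> Gi i"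
  shows "B i u v = B (Suc i) u v"
proof -
  have "B (2 * i + 1 - Suc i) u v = B (Suc i) u v"
    using Gi_mirror[OF i assms(3)] Gi_mirror[OF i assms(4)] closure_subset[of "layer P i"] assms Gi_Gamma Gamma_Xh
    by (intro B_mirror[OF i]) (auto simp del: layer.simps)
  then show ?thesis by simp
qed

end

section \<open>Singular value decompositions in coordinates\<close>

lemma vec_span_eq:
  assumes "set ws \<subseteq> carrier_vec n"
  shows "vec_span n (set ws) = {mult_mat_vec (mat_of_cols n ws) (Matrix.vec (length ws) c) | c. True}"
proof -
  interpret idom_vec n "TYPE(real)" .
  have "vec_span n (set ws) = span_list ws"
    unfolding vec_span_def using span_list_as_span[OF assms] by simp
  also have "\<dots> = {lincomb_list c ws | c. True}"
    unfolding span_list_def by auto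
  also have "\<dots> = {mult_mat_vec (mat_of_cols n ws) (Matrix.vec (length ws) c) | c. True}"
    using lincomb_list_as_mat_mult[of ws] assms by (auto simp: subset_iff)
  finally show ?thesis .
qed

text \<open>The diagonal entries are bounded only where \<open>a\<close> is nonzero; this is how
  truncation replaces the largest singular value by a later one.\<close>

lemma scalar_prod_bound:
  fixes a b :: "nat \<Rightarrow> real"
  assumes "s \<ge> 0" "\<And>k. k < n \<Longrightarrow> a k \<noteq> 0 \<Longrightarrow> \<bar>d k\<bar> \<le> s"
  shows "\<bar>\<Sum>k<n. a k * d k * b k\<bar> \<le> s * (sqrt (\<Sum>k<n. (a k)\<^sup>2) * sqrt (\<Sum>k<n. (b k)\<^sup>2))"
proof -
  have "\<bar>\<Sum>k<n. a k * d k * b k\<bar> \<le> (\<Sum>k<n. \<bar>a k * d k * b k\<bar>)" by (rule sum_abs)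
  also have "\<dots> \<le> (\<Sum>k<n. s * (\<bar>a k\<bar> * \<bar>b k\<bar>))"
  proof (rule sum_mono)
    fix k assume "k \<in> {..<n}"
    then show "\<bar>a k * d k * b k\<bar> \<le> s * (\<bar>a k\<bar> * \<bar>b k\<bar>)"
      using assms(2)[of k] mult_right_mono[of "\<bar>d k\<bar>" s "\<bar>a k\<bar> * \<bar>b k\<bar>"]
      by (cases "a k = 0") (auto simp: abs_mult mult_ac)
  qed
  also have "\<dots> = s * (\<Sum>k<n. \<bar>a k\<bar> * \<bar>b k\<bar>)" by (simp add: sum_distrib_left)
  also have "\<dots> \<le> s * (sqrt (\<Sum>k<n. (a k)\<^sup>2) * sqrt (\<Sum>k<n. (b k)\<^sup>2))"
    using assms(1) L2_set_mult_ineq[of a b "{..<n}"] by (intro mult_left_mono) (auto simp: L2_set_def)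
  finally show ?thesis .
qed

section \<open>Cholesky factors and orthogonal changes of coordinates\<close>

lemma cholesky_inverse:
  assumes "cholesky_factor C R" "C \<in> carrier_mat n n"
  shows "R \<in> carrier_mat n n" "the (mat_inverse R) \<in> carrier_mat n n"
    "R * the (mat_inverse R) = 1\<^sub>m n" "the (mat_inverse R) * R = 1\<^sub>m n"
proof -
  show R: "R \<in> carrier_mat n n" using assms by (auto simp: cholesky_factor_def)
  have "det R = prod_list (diag_mat R)"
    by (rule det_upper_triangular[OF _ R]) (use assms in \<open>simp add: cholesky_factor_def\<close>)
  moreover have "0 \<notin> set (diag_mat R)"
  proof
    assume "0 \<in> set (diag_mat R)"
    then obtain k where "k < dim_row R" "R $$ (k, k) = 0" by (auto simp: diag_mat_def)
    moreover have "\<forall>k<dim_row R. R $$ (k, k) > 0" using assms(1) by (simp add: cholesky_factor_def)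
    ultimately show False by (metis less_irrefl)
  qed
  ultimately have "det R \<noteq> 0" by (simp add: prod_list_zero_iff)
  then have "R \<in> Units (ring_mat TYPE(real) n ())" by (rule det_non_zero_imp_unit[OF R])
  then obtain B where B: "mat_inverse R = Some B" using mat_inverse(1)[OF R, of "()"] by fastforce
  from mat_inverse(2)[OF R B]
  show "the (mat_inverse R) \<in> carrier_mat n n"
    "R * the (mat_inverse R) = 1\<^sub>m n" "the (mat_inverse R) * R = 1\<^sub>m n"
    by (simp_all add: B)
qed

lemma orthogonal_scalar_prod:
  fixes U :: "real Matrix.mat"
  assumes U: "U \<in> carrier_mat n n" "transpose_mat U * U = 1\<^sub>m n"
    and x: "x \<in> carrier_vec n" and y: "y \<in> carrier_vec n"
  shows "scalar_prod (mult_mat_vec (transpose_mat U) x) (mult_mat_vec (transpose_mat U) y) = scalar_prod x y"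
    and "mult_mat_vec U (mult_mat_vec (transpose_mat U) x) = x"
    and "mult_mat_vec (transpose_mat U) (mult_mat_vec U x) = x"
proof -
  have UT: "transpose_mat U \<in> carrier_mat n n" using U by simp
  have UU: "U * transpose_mat U = 1\<^sub>m n"
    by (rule mat_mult_left_right_inverse[OF UT U(1) U(2)])
  have 1: "mult_mat_vec U (mult_mat_vec (transpose_mat U) x) = x" if "x \<in> carrier_vec n" for x
    using assoc_mult_mat_vec[OF U(1) UT that] UU that by simp
  show "mult_mat_vec U (mult_mat_vec (transpose_mat U) x) = x" by (rule 1[OF x])
  show "mult_mat_vec (transpose_mat U) (mult_mat_vec U x) = x"
    using assoc_mult_mat_vec[OF UT U(1) x] U(2) x by simp
  have "scalar_prod (mult_mat_vec (transpose_mat U) x) (mult_mat_vec (transpose_mat U) y) =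
      scalar_prod x (mult_mat_vec U (mult_mat_vec (transpose_mat U) y))"
    using UT y by (intro transpose_vec_mult_scalar[OF U(1) _ x]) auto
  then show "scalar_prod (mult_mat_vec (transpose_mat U) x) (mult_mat_vec (transpose_mat U) y) = scalar_prod x y"
    using 1[OF y] by simp
qed

text \<open>\<open>R\<close> carries the form of \<open>C\<close> to the Euclidean product, which
  the orthogonal \<open>W\<close> preserves.\<close>

lemma cholesky_scalar_prod:
  assumes R: "cholesky_factor C R" and C: "C \<in> carrier_mat n n"
    and W: "W \<in> carrier_mat n n" "transpose_mat W * W = 1\<^sub>m n"
    and \<alpha>: "\<alpha> \<in> carrier_vec n" and \<beta>: "\<beta> \<in> carrier_vec n"
  shows "scalar_prod \<alpha> (mult_mat_vec C \<beta>) =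
    scalar_prod (mult_mat_vec (transpose_mat W) (mult_mat_vec R \<alpha>))
      (mult_mat_vec (transpose_mat W) (mult_mat_vec R \<beta>))"
proof -
  have Rc: "R \<in> carrier_mat n n" by (rule cholesky_inverse(1)[OF R C])
  have v: "mult_mat_vec R \<alpha> \<in> carrier_vec n" "mult_mat_vec R \<beta> \<in> carrier_vec n"
    using Rc \<alpha> \<beta> by auto
  have "C = transpose_mat R * R" using R by (simp add: cholesky_factor_def)
  then have "mult_mat_vec C \<beta> = mult_mat_vec (transpose_mat R) (mult_mat_vec R \<beta>)"
    using assoc_mult_mat_vec[of "transpose_mat R" n n R n \<beta>] Rc \<beta> by simp
  moreover have "scalar_prod \<alpha> (mult_mat_vec (transpose_mat R) (mult_mat_vec R \<beta>)) =
      scalar_prod (mult_mat_vec R \<alpha>) (mult_mat_vec R \<beta>)"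
    using transpose_vec_mult_scalar[of "transpose_mat R" n n "mult_mat_vec R \<beta>" \<alpha>] Rc \<alpha> v by simp
  ultimately show ?thesis using orthogonal_scalar_prod(1)[OF W v] by simp
qed

lemma orthogonal_col:
  fixes U :: "real Matrix.mat"
  assumes "U \<in> carrier_mat n n" "transpose_mat U * U = 1\<^sub>m n" "k < n" "l < n"
  shows "(\<Sum>i<n. U $$ (i, k) * U $$ (i, l)) = (if k = l then 1 else 0)"
proof -
  have "(transpose_mat U * U) $$ (k, l) = (\<Sum>i<n. U $$ (i, k) * U $$ (i, l))"
    using assms(1,3,4) by (simp add: scalar_prod_def lessThan_atLeast0)
  then show ?thesis using assms by simp
qed

text \<open>\<open>h\<close> enumerates the selected columns: the identity gives the leading ones, a
  shift by \<open>r\<close> the trailing ones. Orthonormality lets coefficients be read off by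
  \<open>transpose_mat U\<close>.\<close>

lemma mem_span_columns:
  fixes U :: "real Matrix.mat"
  assumes U: "U \<in> carrier_mat n n" "transpose_mat U * U = 1\<^sub>m n"
    and ws: "ws = map (\<lambda>j. col U (h j)) [0..<p]" and h: "\<And>j. j < p \<Longrightarrow> h j < n" "inj_on h {..<p}"
    and a: "a \<in> carrier_vec n"
  shows "mult_mat_vec U a \<in> vec_span n (set ws) \<longleftrightarrow> (\<forall>k<n. k \<notin> h ` {..<p} \<longrightarrow> vec_index a k = 0)"
proof -
  have wsc: "set ws \<subseteq> carrier_vec n" using U(1) by (auto simp: ws)
  have len: "length ws = p" by (simp add: ws)
  have Wc: "mult_mat_vec (mat_of_cols n ws) (Matrix.vec p c) \<in> carrier_vec n" for c
    by (rule mult_mat_vec_carrier[of _ _ p]) (simp_all add: len mat_of_cols_def)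
  have W: "vec_index (mult_mat_vec (mat_of_cols n ws) (Matrix.vec p c)) i = (\<Sum>j<p. U $$ (i, h j) * c j)"
    if "i < n" for i c
    using that h(1) U(1) by (simp add: mat_of_cols_def scalar_prod_def len lessThan_atLeast0 ws)
  have Ua: "vec_index (mult_mat_vec U a) i = (\<Sum>k<n. U $$ (i, k) * vec_index a k)" if "i < n" for i
    using that U(1) a by (simp add: scalar_prod_def lessThan_atLeast0)
  have Uac: "mult_mat_vec U a \<in> carrier_vec n" using U(1) a by simp
  show ?thesis
  proof
    assume "mult_mat_vec U a \<in> vec_span n (set ws)"
    then obtain c where c: "mult_mat_vec U a = mult_mat_vec (mat_of_cols n ws) (Matrix.vec p c)"
      unfolding vec_span_eq[OF wsc] len by auto
    show "\<forall>k<n. k \<notin> h ` {..<p} \<longrightarrow> vec_index a k = 0"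
    proof (intro allI impI)
      fix k assume k: "k < n" "k \<notin> h ` {..<p}"
      have "vec_index a k = vec_index (mult_mat_vec (transpose_mat U) (mult_mat_vec U a)) k"
        using orthogonal_scalar_prod(3)[OF U a a] by simp
      also have "\<dots> = (\<Sum>i<n. U $$ (i, k) * vec_index (mult_mat_vec U a) i)"
        using k U(1) Uac by (simp add: scalar_prod_def lessThan_atLeast0)
      also have "\<dots> = (\<Sum>i<n. \<Sum>j<p. c j * (U $$ (i, k) * U $$ (i, h j)))"
        unfolding c using W by (intro sum.cong) (simp_all add: sum_distrib_left mult_ac)
      also have "\<dots> = (\<Sum>j<p. c j * (\<Sum>i<n. U $$ (i, k) * U $$ (i, h j)))"
        by (subst sum.swap) (simp add: sum_distrib_left)
      also have "\<dots> = 0"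
        using k h(1) by (intro sum.neutral) (auto simp: orthogonal_col[OF U])
      finally show "vec_index a k = 0" .
    qed
  next
    assume 0: "\<forall>k<n. k \<notin> h ` {..<p} \<longrightarrow> vec_index a k = 0"
    have "mult_mat_vec U a = mult_mat_vec (mat_of_cols n ws) (Matrix.vec p (\<lambda>j. vec_index a (h j)))"
    proof (rule eq_vecI)
      fix i assume "i < dim_vec (mult_mat_vec (mat_of_cols n ws) (Matrix.vec p (\<lambda>j. vec_index a (h j))))"
      then have i: "i < n" using Wc by (metis carrier_vecD)
      have "(\<Sum>k<n. U $$ (i, k) * vec_index a k) = (\<Sum>k\<in>h ` {..<p}. U $$ (i, k) * vec_index a k)"
        using 0 h(1) by (intro sum.mono_neutral_right) auto
      then show "vec_index (mult_mat_vec U a) i =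
          vec_index (mult_mat_vec (mat_of_cols n ws) (Matrix.vec p (\<lambda>j. vec_index a (h j)))) i"
        unfolding Ua[OF i] W[OF i] by (simp add: sum.reindex[OF h(2)])
    qed (use Uac Wc in \<open>metis carrier_vecD\<close>)
    then show "mult_mat_vec U a \<in> vec_span n (set ws)"
      unfolding vec_span_eq[OF wsc] len by blast
  qed
qed

lemma mem_span_take:
  fixes U :: "real Matrix.mat"
  assumes U: "U \<in> carrier_mat n n" "transpose_mat U * U = 1\<^sub>m n" and a: "a \<in> carrier_vec n"
  shows "mult_mat_vec U a \<in> vec_span n (set (take r (cols U))) \<longleftrightarrow> (\<forall>k<n. r \<le> k \<longrightarrow> vec_index a k = 0)"
proof -
  have "take r (cols U) = map (\<lambda>j. col U (id j)) [0..<min r n]"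
    using U(1) by (intro nth_equalityI) auto
  from mem_span_columns[OF U this _ _ a] show ?thesis by auto
qed

lemma mem_span_drop:
  fixes U :: "real Matrix.mat"
  assumes U: "U \<in> carrier_mat n n" "transpose_mat U * U = 1\<^sub>m n" and a: "a \<in> carrier_vec n"
  shows "mult_mat_vec U a \<in> vec_span n (set (drop r (cols U))) \<longleftrightarrow> (\<forall>k<n. k < r \<longrightarrow> vec_index a k = 0)"
proof -
  have eq: "drop r (cols U) = map (\<lambda>j. col U (r + j)) [0..<n - r]"
    using U(1) by (intro nth_equalityI) auto
  have "k \<notin> (\<lambda>j. r + j) ` {..<n - r} \<longleftrightarrow> k < r" if "k < n" for k
  proof -
    have "k = r + (k - r)" "k - r < n - r" if "r \<le> k" using that \<open>k < n\<close> by auto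
    then show ?thesis by (cases "k < r") (auto simp: image_iff not_less intro!: bexI[of _ "k - r"])
  qed
  with mem_span_columns[OF U eq _ _ a] show ?thesis by auto
qed

lemma mult_mat_vec_index:
  fixes Q :: "real Matrix.mat"
  assumes "Q \<in> carrier_mat p q" "\<gamma> \<in> carrier_vec q" "k < p"
  shows "vec_index (mult_mat_vec Q \<gamma>) k = (\<Sum>l<q. Q $$ (k, l) * vec_index \<gamma> l)"
  using assms by (simp add: scalar_prod_def lessThan_atLeast0)

text \<open>The vector \<open>U\<^sup>T R\<^sub>0 \<alpha>\<close> collects the coordinates of a trace with respect to the left singular
  vectors, in which the energy of the discrete harmonic extension is the Euclidean norm.\<close>

locale svd_coords =
  fixes C00 C01 C11 R0 R1 U S V :: "real Matrix.mat" and n0 n1 :: nat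
  assumes C00: "C00 \<in> carrier_mat n0 n0" and C01: "C01 \<in> carrier_mat n0 n1" and C11: "C11 \<in> carrier_mat n1 n1"
    and R0: "cholesky_factor C00 R0" and R1: "cholesky_factor C11 R1"
    and svd: "is_svd (transpose_mat (the (mat_inverse R0)) * C01 * the (mat_inverse R1)) U S V"
begin

abbreviation "I0 \<equiv> the (mat_inverse R0)"
abbreviation "I1 \<equiv> the (mat_inverse R1)"

lemmas R0c = cholesky_inverse[OF R0 C00] and R1c = cholesky_inverse[OF R1 C11]

lemma U: "U \<in> carrier_mat n0 n0" "transpose_mat U * U = 1\<^sub>m n0"
  and V: "V \<in> carrier_mat n1 n1" "transpose_mat V * V = 1\<^sub>m n1"
  and S: "S \<in> carrier_mat n0 n1" "\<And>k l. k < n0 \<Longrightarrow> l < n1 \<Longrightarrow> k \<noteq> l \<Longrightarrow> S $$ (k, l) = 0"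
    "\<And>k. k < min n0 n1 \<Longrightarrow> S $$ (k, k) \<ge> 0"
    "\<And>k l. k \<le> l \<Longrightarrow> l < min n0 n1 \<Longrightarrow> S $$ (l, l) \<le> S $$ (k, k)"
  and M: "transpose_mat I0 * C01 * I1 = U * S * transpose_mat V"
  using svd R0c(2) R1c(2) C01 unfolding is_svd_def by auto

definition left :: "real Matrix.vec \<Rightarrow> real Matrix.vec" where
  "left \<alpha> = mult_mat_vec (transpose_mat U) (mult_mat_vec R0 \<alpha>)"

definition right :: "real Matrix.vec \<Rightarrow> real Matrix.vec" where
  "right \<beta> = mult_mat_vec (transpose_mat V) (mult_mat_vec R1 \<beta>)"

lemma left_carrier: "\<alpha> \<in> carrier_vec n0 \<Longrightarrow> left \<alpha> \<in> carrier_vec n0"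
  and right_carrier: "\<beta> \<in> carrier_vec n1 \<Longrightarrow> right \<beta> \<in> carrier_vec n1"
  using U(1) V(1) R0c(1) R1c(1) by (auto simp: left_def right_def intro!: mult_mat_vec_carrier)

lemma U_left: "\<alpha> \<in> carrier_vec n0 \<Longrightarrow> mult_mat_vec U (left \<alpha>) = mult_mat_vec R0 \<alpha>"
  unfolding left_def using R0c(1) by (intro orthogonal_scalar_prod(2)[OF U]) auto

lemma scalar_C00: "\<alpha> \<in> carrier_vec n0 \<Longrightarrow> \<beta> \<in> carrier_vec n0 \<Longrightarrow>
    scalar_prod \<alpha> (mult_mat_vec C00 \<beta>) = scalar_prod (left \<alpha>) (left \<beta>)"
  unfolding left_def by (rule cholesky_scalar_prod[OF R0 C00 U])

lemma scalar_C11: "\<alpha> \<in> carrier_vec n1 \<Longrightarrow> \<beta> \<in> carrier_vec n1 \<Longrightarrow>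
    scalar_prod \<alpha> (mult_mat_vec C11 \<beta>) = scalar_prod (right \<alpha>) (right \<beta>)"
  unfolding right_def by (rule cholesky_scalar_prod[OF R1 C11 V])

lemma C01_eq: "C01 = transpose_mat R0 * (U * S * transpose_mat V) * R1"
proof -
  have c: "transpose_mat R0 \<in> carrier_mat n0 n0" "transpose_mat I0 \<in> carrier_mat n0 n0"
    using R0c by auto
  have "transpose_mat R0 * transpose_mat I0 = transpose_mat (I0 * R0)"
    using R0c by (intro transpose_mult[symmetric]) auto
  then have RI: "transpose_mat R0 * transpose_mat I0 = 1\<^sub>m n0" using R0c(4) by simp
  have BC: "transpose_mat I0 * C01 \<in> carrier_mat n0 n1" using c C01 by auto
  have "transpose_mat R0 * (transpose_mat I0 * C01 * I1) * R1 =
      transpose_mat R0 * ((transpose_mat I0 * C01 * I1) * R1)"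
    using BC R1c(2) by (intro assoc_mult_mat[OF c(1) _ R1c(1)]) auto
  also have "(transpose_mat I0 * C01 * I1) * R1 = (transpose_mat I0 * C01) * (I1 * R1)"
    by (rule assoc_mult_mat[OF BC R1c(2,1)])
  also have "\<dots> = transpose_mat I0 * C01" unfolding R1c(4) by (rule right_mult_one_mat[OF BC])
  also have "transpose_mat R0 * (transpose_mat I0 * C01) = (transpose_mat R0 * transpose_mat I0) * C01"
    by (rule assoc_mult_mat[OF c C01, symmetric])
  also have "\<dots> = C01" unfolding RI by (rule left_mult_one_mat[OF C01])
  finally show ?thesis unfolding M by simp
qed

text \<open>The Cholesky and singular vector factors of \<open>C01\<close> are absorbed into the
  coordinates, which leaves the diagonal matrix of singular values. Being rectangular, it couples
  only the first \<open>min n0 n1\<close> coordinates.\<close>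

lemma scalar_C01:
  assumes "\<alpha> \<in> carrier_vec n0" "\<beta> \<in> carrier_vec n1"
  shows "scalar_prod \<alpha> (mult_mat_vec C01 \<beta>) =
    (\<Sum>k<min n0 n1. vec_index (left \<alpha>) k * S $$ (k, k) * vec_index (right \<beta>) k)"
proof -
  have v: "mult_mat_vec R0 \<alpha> \<in> carrier_vec n0" "mult_mat_vec R1 \<beta> \<in> carrier_vec n1"
    using R0c(1) R1c(1) assms by auto
  let ?M = "U * S * transpose_mat V"
  have Mc: "?M \<in> carrier_mat n0 n1" using U(1) S(1) V(1) by auto
  have Sr: "mult_mat_vec S (right \<beta>) \<in> carrier_vec n0" using S(1) right_carrier[OF assms(2)] by auto
  have "mult_mat_vec ?M (mult_mat_vec R1 \<beta>) = mult_mat_vec (U * S) (right \<beta>)"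
    unfolding right_def using U(1) S(1) V(1) v by (intro assoc_mult_mat_vec) auto
  also have "\<dots> = mult_mat_vec U (mult_mat_vec S (right \<beta>))"
    using U(1) S(1) right_carrier[OF assms(2)] by (intro assoc_mult_mat_vec) auto
  finally have Mb: "mult_mat_vec ?M (mult_mat_vec R1 \<beta>) = mult_mat_vec U (mult_mat_vec S (right \<beta>))" .
  have "mult_mat_vec C01 \<beta> = mult_mat_vec (transpose_mat R0 * ?M) (mult_mat_vec R1 \<beta>)"
  proof -
    have "transpose_mat R0 * ?M \<in> carrier_mat n0 n1" using R0c(1) Mc by auto
    then show ?thesis unfolding C01_eq by (rule assoc_mult_mat_vec[OF _ R1c(1) assms(2)])
  qed
  also have "\<dots> = mult_mat_vec (transpose_mat R0) (mult_mat_vec ?M (mult_mat_vec R1 \<beta>))"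
    using R0c(1) by (intro assoc_mult_mat_vec[OF _ Mc v(2), of _ n0]) simp
  finally have "scalar_prod \<alpha> (mult_mat_vec C01 \<beta>) =
      scalar_prod \<alpha> (mult_mat_vec (transpose_mat R0) (mult_mat_vec U (mult_mat_vec S (right \<beta>))))"
    unfolding Mb by simp
  also have "\<dots> = scalar_prod (mult_mat_vec R0 \<alpha>) (mult_mat_vec U (mult_mat_vec S (right \<beta>)))"
    using transpose_vec_mult_scalar[of "transpose_mat R0" n0 n0 "mult_mat_vec U (mult_mat_vec S (right \<beta>))" \<alpha>]
      R0c(1) assms U(1) Sr by simp
  also have "\<dots> = scalar_prod (left \<alpha>) (mult_mat_vec S (right \<beta>))"
    unfolding left_def using transpose_vec_mult_scalar[OF U(1) Sr v(1)] by simp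
  also have "\<dots> = (\<Sum>k<n0. vec_index (left \<alpha>) k * (\<Sum>l<n1. S $$ (k, l) * vec_index (right \<beta>) l))"
    using S(1) right_carrier[OF assms(2)] by (simp add: scalar_prod_def lessThan_atLeast0)
  also have "\<dots> = (\<Sum>k<n0. if k < n1 then vec_index (left \<alpha>) k * S $$ (k, k) * vec_index (right \<beta>) k else 0)"
  proof (rule sum.cong[OF refl])
    fix k assume k: "k \<in> {..<n0}"
    have "(\<Sum>l<n1. S $$ (k, l) * vec_index (right \<beta>) l) =
        (\<Sum>l<n1. if l = k then S $$ (k, k) * vec_index (right \<beta>) k else 0)"
      using k S(2) by (intro sum.cong) auto
    then show "vec_index (left \<alpha>) k * (\<Sum>l<n1. S $$ (k, l) * vec_index (right \<beta>) l) =
        (if k < n1 then vec_index (left \<alpha>) k * S $$ (k, k) * vec_index (right \<beta>) k else 0)"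
      by simp
  qed
  also have "\<dots> = (\<Sum>k<min n0 n1. vec_index (left \<alpha>) k * S $$ (k, k) * vec_index (right \<beta>) k)"
    by (rule sum.mono_neutral_cong_right) auto
  finally show ?thesis .
qed

lemma scalar_self: "a \<in> carrier_vec n \<Longrightarrow> scalar_prod a a = (\<Sum>k<n. (vec_index a k)\<^sup>2)" for a :: "real Matrix.vec"
  by (simp add: scalar_prod_def lessThan_atLeast0 power2_eq_square)

lemma sing_val_nonneg: "sing_val S k \<ge> 0"
  using S(1) S(3)[of "k - 1"] by (cases k) (auto simp: sing_val_def Suc_le_eq)

lemma C01_bound:
  assumes \<alpha>: "\<alpha> \<in> carrier_vec n0" and \<beta>: "\<beta> \<in> carrier_vec n1"
    and 0: "\<And>k. k < n0 \<Longrightarrow> k < r \<Longrightarrow> vec_index (left \<alpha>) k = 0"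
  shows "\<bar>scalar_prod \<alpha> (mult_mat_vec C01 \<beta>)\<bar> \<le> sing_val S (r + 1) *
    (sqrt (scalar_prod \<alpha> (mult_mat_vec C00 \<alpha>)) * sqrt (scalar_prod \<beta> (mult_mat_vec C11 \<beta>)))"
proof -
  let ?n = "min n0 n1"
  have "\<bar>scalar_prod \<alpha> (mult_mat_vec C01 \<beta>)\<bar> \<le> sing_val S (r + 1) *
    (sqrt (\<Sum>k<?n. (vec_index (left \<alpha>) k)\<^sup>2) * sqrt (\<Sum>k<?n. (vec_index (right \<beta>) k)\<^sup>2))"
    unfolding scalar_C01[OF \<alpha> \<beta>]
  proof (rule scalar_prod_bound[OF sing_val_nonneg])
    \<comment> \<open>Coordinates are counted from 0 and \<open>sing_val\<close> from 1, so the
      largest singular value from position \<open>r\<close> on is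
      \<open>sing_val S (r + 1)\<close>.\<close>
    fix k assume k: "k < ?n" "vec_index (left \<alpha>) k \<noteq> 0"
    then have "r \<le> k" using 0[of k] by (auto simp: not_less[symmetric])
    then show "\<bar>S $$ (k, k)\<bar> \<le> sing_val S (r + 1)"
      using k(1) S(1) S(3)[OF k(1)] S(4)[of r k] by (auto simp: sing_val_def)
  qed
  also have "\<dots> \<le> sing_val S (r + 1) *
    (sqrt (\<Sum>k<n0. (vec_index (left \<alpha>) k)\<^sup>2) * sqrt (\<Sum>k<n1. (vec_index (right \<beta>) k)\<^sup>2))"
    using sing_val_nonneg
    by (intro mult_left_mono mult_mono real_sqrt_le_mono sum_mono2) (auto intro!: sum_nonneg)
  finally show ?thesis
    unfolding scalar_C00[OF \<alpha> \<alpha>] scalar_C11[OF \<beta> \<beta>] scalar_self[OF left_carrier[OF \<alpha>]]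
      scalar_self[OF right_carrier[OF \<beta>]] .
qed

lemma slow_iff: "\<alpha> \<in> carrier_vec n0 \<Longrightarrow>
    mult_mat_vec R0 \<alpha> \<in> vec_span (dim_row U) (set (take r (cols U))) \<longleftrightarrow> (\<forall>k<n0. r \<le> k \<longrightarrow> vec_index (left \<alpha>) k = 0)"
  using mem_span_take[OF U left_carrier] U_left U(1) by (metis carrier_matD(1))

lemma fast_iff: "\<alpha> \<in> carrier_vec n0 \<Longrightarrow>
    mult_mat_vec R0 \<alpha> \<in> vec_span (dim_row U) (set (drop r (cols U))) \<longleftrightarrow> (\<forall>k<n0. k < r \<longrightarrow> vec_index (left \<alpha>) k = 0)"
  using mem_span_drop[OF U left_carrier] U_left U(1) by (metis carrier_matD(1))

lemma left_lincomb:
  assumes "\<alpha> \<in> carrier_vec n0" "\<beta> \<in> carrier_vec n0" "k < n0"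
  shows "vec_index (left (Matrix.vec n0 (\<lambda>k. a * vec_index \<alpha> k + b * vec_index \<beta> k))) k =
    a * vec_index (left \<alpha>) k + b * vec_index (left \<beta>) k"
proof -
  let ?Q = "transpose_mat U * R0"
  have Q: "?Q \<in> carrier_mat n0 n0" using U(1) R0c(1) by auto
  have "left \<gamma> = mult_mat_vec ?Q \<gamma>" if "\<gamma> \<in> carrier_vec n0" for \<gamma>
    unfolding left_def using U(1) by (intro assoc_mult_mat_vec[OF _ R0c(1) that, of _ n0, symmetric]) simp
  then have "vec_index (left \<gamma>) k = (\<Sum>l<n0. ?Q $$ (k, l) * vec_index \<gamma> l)" if "\<gamma> \<in> carrier_vec n0" for \<gamma>
    using mult_mat_vec_index[OF Q that assms(3)] that by simp
  then show ?thesis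
    using assms by (simp add: sum_distrib_left sum.distrib algebra_simps)
qed

lemma left_surj:
  assumes "a \<in> carrier_vec n0"
  obtains \<alpha> where "\<alpha> \<in> carrier_vec n0" "left \<alpha> = a"
proof -
  let ?\<alpha> = "mult_mat_vec I0 (mult_mat_vec U a)"
  have Ua: "mult_mat_vec U a \<in> carrier_vec n0" using U(1) assms by auto
  have c: "?\<alpha> \<in> carrier_vec n0" using R0c(2) Ua by auto
  have "mult_mat_vec R0 ?\<alpha> = mult_mat_vec U a"
    using assoc_mult_mat_vec[OF R0c(1,2) Ua] R0c(3) Ua by simp
  then have "left ?\<alpha> = a" unfolding left_def using orthogonal_scalar_prod(3)[OF U assms assms] by simp
  with c show ?thesis by (rule that)
qed

end

section \<open>Traces and discrete harmonic extensions\<close>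

locale layered_traces = layered_fe +
  assumes tb: "trace_bases P"
begin

abbreviation "nb j \<equiv> length (tbasis P j)"
abbreviation "tr j \<equiv> restr (iface P j)"

lemma coords_lincomb:
  assumes "coords P j \<alpha> g" "coords P j \<beta> h"
  shows "coords P j (Matrix.vec (nb j) (\<lambda>k. a * vec_index \<alpha> k + b * vec_index \<beta> k)) (\<lambda>x. a * g x + b * h x)"
  using assms by (auto simp: coords_def sum_distrib_left sum.distrib algebra_simps)

lemma tr_lincomb: "tr j (\<lambda>x. a * u x + b * v x) = (\<lambda>x. a * tr j u x + b * tr j v x)"
  by (auto simp: restr_def)

lemma trace_spaceI: "v \<in> Xh P \<Longrightarrow> tr j v \<in> trace_space P j"
  by (simp add: trace_space_def)

lemma coords_ex:
  assumes "1 \<le> j" "j \<le> N" "v \<in> Xh P"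
  obtains \<alpha> where "coords P j \<alpha> (tr j v)"
proof -
  have "j \<in> {1..N}" using assms by simp
  then have "\<exists>!\<alpha>. coords P j \<alpha> (tr j v)"
    using tb trace_spaceI[OF assms(3), of j] unfolding trace_bases_def by blast
  then show ?thesis using that by blast
qed

lemma tbasis_trace:
  assumes "1 \<le> j" "j \<le> N" "k < nb j"
  obtains w where "w \<in> Xh P" "tr j w = tbasis P j ! k"
proof -
  have "j \<in> {1..N}" using assms by simp
  then have "set (tbasis P j) \<subseteq> trace_space P j" using tb unfolding trace_bases_def by blast
  then have "tbasis P j ! k \<in> trace_space P j" using nth_mem[OF assms(3)] by blast
  then show ?thesis using that unfolding trace_space_def by (metis imageE)
qed

lemma sum_Xh: "finite I \<Longrightarrow> (\<And>k. k \<in> I \<Longrightarrow> v k \<in> Xh P) \<Longrightarrow> (\<lambda>x. \<Sum>k\<in>I. c k * v k x) \<in> Xh P"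
proof -
  interpret psd_form "Xh P" "grad_inner (Omega P)" by (rule psd_form_Omega)
  show "finite I \<Longrightarrow> (\<And>k. k \<in> I \<Longrightarrow> v k \<in> Xh P) \<Longrightarrow> (\<lambda>x. \<Sum>k\<in>I. c k * v k x) \<in> Xh P"
    by (intro sum_mem scale_mem)
qed

lemma coords_surj:
  assumes j: "1 \<le> j" "j \<le> N" and \<alpha>: "\<alpha> \<in> carrier_vec (nb j)"
  obtains w where "w \<in> Xh P" "coords P j \<alpha> (tr j w)"
proof -
  have "\<forall>k. \<exists>w. k < nb j \<longrightarrow> w \<in> Xh P \<and> tr j w = tbasis P j ! k"
    using tbasis_trace[OF j] by metis
  then obtain w where w: "\<And>k. k < nb j \<Longrightarrow> w k \<in> Xh P \<and> tr j (w k) = tbasis P j ! k" by metis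
  let ?w = "\<lambda>x. \<Sum>k<nb j. vec_index \<alpha> k * w k x"
  have "?w \<in> Xh P" using w by (intro sum_Xh) auto
  moreover have "tr j ?w = (\<lambda>x. \<Sum>k<nb j. vec_index \<alpha> k * tr j (w k) x)"
    by (auto simp: restr_def)
  then have "tr j ?w = (\<lambda>x. \<Sum>k<nb j. vec_index \<alpha> k * (tbasis P j ! k) x)"
    using w by simp
  then have "coords P j \<alpha> (tr j ?w)" using \<alpha> by (simp add: coords_def)
  ultimately show ?thesis by (rule that)
qed

lemma coords_unit:
  assumes "k < nb j"
  shows "coords P j (unit_vec (nb j) k) (tbasis P j ! k)"
proof -
  have "(\<Sum>l<nb j. vec_index (unit_vec (nb j) k) l * (tbasis P j ! l) x) = (tbasis P j ! k) x" for x
  proof -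
    have "(\<Sum>l<nb j. vec_index (unit_vec (nb j) k) l * (tbasis P j ! l) x) =
        (\<Sum>l<nb j. if l = k then (tbasis P j ! k) x else 0)"
      using assms by (intro sum.cong) auto
    then show ?thesis using assms by simp
  qed
  then show ?thesis by (simp add: coords_def)
qed

text \<open>\<open>extension i n v\<close>: on layer \<open>i + 1\<close>, \<open>v\<close> is the discrete harmonic extension of its trace on
  interface \<open>i + n\<close>.\<close>

definition extension :: "nat \<Rightarrow> nat \<Rightarrow> (plane \<Rightarrow> real) \<Rightarrow> bool" where
  "extension i n v \<longleftrightarrow> harmonic (Suc i) v \<and> (\<forall>x\<in>iface P (i + 1 - n). v x = 0)"

lemma extension_Xh: "extension i n v \<Longrightarrow> v \<in> Xh P"
  by (simp add: extension_def harmonic_def)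

lemma extension_sum:
  assumes "i < N" "finite I" "\<And>k. k \<in> I \<Longrightarrow> extension i n (v k)"
  shows "extension i n (\<lambda>x. \<Sum>k\<in>I. c k * v k x)"
proof -
  have j: "1 \<le> Suc i" "Suc i \<le> N" using assms(1) by auto
  interpret psd_form "Xh P" "B (Suc i)" by (rule psd_form_layer[OF j])
  have h: "v k \<in> Xh P" "\<And>b. b \<in> Vh_layer P (Suc i) \<Longrightarrow> B (Suc i) (v k) b = 0"
    "\<And>x. x \<in> iface P (i + 1 - n) \<Longrightarrow> v k x = 0" if "k \<in> I" for k
    using assms(3)[OF that] unfolding extension_def harmonic_def by blast+
  have "B (Suc i) (\<lambda>x. \<Sum>k\<in>I. c k * v k x) b = 0" if b: "b \<in> Vh_layer P (Suc i)" for b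
  proof -
    note bX = Vh_layer_Xh[OF b]
    have "B (Suc i) (\<lambda>x. \<Sum>k\<in>I. c k * v k x) b = (\<Sum>k\<in>I. B (Suc i) (\<lambda>x. c k * v k x) b)"
      by (rule sum_left[OF assms(2) _ bX]) (intro scale_mem h(1))
    also have "\<dots> = 0"
      using h(2)[OF _ b] by (intro sum.neutral ballI) (simp add: scale_left[OF h(1) bX])
    finally show ?thesis .
  qed
  moreover have "(\<Sum>k\<in>I. c k * v k x) = 0" if "x \<in> iface P (i + 1 - n)" for x
    using h(3) that by (intro sum.neutral) auto
  moreover have "(\<lambda>x. \<Sum>k\<in>I. c k * v k x) \<in> Xh P"
    by (intro sum_Xh[OF assms(2)] h(1))
  ultimately show ?thesis
    unfolding extension_def harmonic_def by blast
qed

text \<open>Keeping only the shape functions of interface i + n removes the trace on the opposite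
  interface; the harmonic correction inside the layer touches neither trace.\<close>

lemma extension_exists:
  assumes i: "i < N" and n: "n \<in> {0, 1}" and w: "w \<in> Xh P"
  obtains v where "extension i n v" "tr (i + n) v = tr (i + n) w"
proof -
  have j: "1 \<le> Suc i" "Suc i \<le> N" using i by auto
  have k: "i + n \<le> N" "i + 1 - n \<le> N" "i + 1 - n \<noteq> i + n" using i n by auto
  obtain c where c: "w = (\<lambda>x. \<Sum>k<K. c k * shape P k x)" using w unfolding Xh_def by (rule fun_spanE)
  let ?I = "{k. k < K \<and> iface_dof P (i + n) k}"
  let ?w = "\<lambda>x. \<Sum>k\<in>?I. c k * shape P k x"
  have wX: "?w \<in> Xh P" unfolding Xh_def by (intro fun_span_subset_sum) auto
  have w_i: "?w x = w x" if "x \<in> iface P (i + n)" for x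
    unfolding c using trace_sum[OF k(1) that, of c] by simp
  have w_j: "?w x = 0" if "x \<in> iface P (i + 1 - n)" for x
    using iface_dof_zero[OF _ k(1,2,3) that] by (intro sum.neutral) auto
  obtain v where v: "harmonic (Suc i) v" "\<And>x. x \<notin> layer P (Suc i) \<Longrightarrow> v x = ?w x"
    using harmonic_exists[OF j wX] by blast
  have "v x = 0" if "x \<in> iface P (i + 1 - n)" for x
    using v(2)[OF iface_layer[OF k(2) that]] w_j[OF that] by simp
  moreover have "v x = w x" if "x \<in> iface P (i + n)" for x
    using v(2)[OF iface_layer[OF k(1) that]] w_i[OF that] by simp
  then have "tr (i + n) v = tr (i + n) w" by (auto simp: restr_def)
  ultimately show ?thesis using v(1) that[of v] by (simp add: extension_def)
qed

lemma extension_unique: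
  assumes i: "i < N" and n: "n \<in> {0, 1}" and u: "extension i n u" and v: "extension i n v"
    and eq: "tr (i + n) u = tr (i + n) v" and x: "x \<in> closure (layer P (Suc i))"
  shows "u x = v x"
proof (rule harmonic_unique[OF _ _ _ _ _ _ x])
  have t: "u y = v y" if "y \<in> iface P (i + n)" for y
    using fun_cong[OF eq, of y] that by (simp add: restr_def)
  have z: "u y = v y" if "y \<in> iface P (i + 1 - n)" for y
    using u v that by (simp add: extension_def)
  show "u y = v y" if "y \<in> iface P (Suc i - 1)" for y
    using t[of y] z[of y] n that by auto
  show "u y = v y" if "y \<in> iface P (Suc i)" for y
    using t[of y] z[of y] n that by auto
qed (use i u v in \<open>auto simp: extension_def\<close>)

text \<open>Uniqueness of the discrete harmonic extension makes the definite description denote.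
  Later arguments can work with representatives in \<open>Xh P\<close>, which have an algebra,
  instead of with \<open>Zh\<close>.\<close>

lemma Zh_extension:
  assumes i: "1 \<le> i" "i < N" and n: "n \<in> {0, 1}" and v: "extension i n v"
  shows "Zh P n i (tr (i + n) v) = restr (closure (layer P (Suc i))) v"
  unfolding Zh_def
proof (rule the_equality)
  let ?cl = "closure (layer P (Suc i))"
  have j: "1 \<le> Suc i" "Suc i \<le> N" using i by auto
  have icl: "x \<in> ?cl" if "k \<in> {0, 1}" "x \<in> iface P (i + k)" for k x
    using iface_closure[OF j, of x] that by auto
  have lcl: "x \<in> ?cl" if "x \<in> layer P (Suc i)" for x
    using that closure_subset[of "layer P (Suc i)"] by blast
  have vX: "v \<in> Xh P" using v by (rule extension_Xh)
  have v0: "v x = 0" if "x \<in> iface P (i + k)" "k \<in> {0, 1}" "k \<noteq> n" for k x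
  proof -
    have "i + k = i + 1 - n" using that n by auto
    then show ?thesis using v that by (simp add: extension_def)
  qed
  show "restr ?cl v \<in> restr ?cl ` Xh P \<and>
    (\<forall>k\<in>{0, 1}. \<forall>x\<in>iface P (i + k). restr ?cl v x = (if k = n then tr (i + n) v x else 0)) \<and>
    (\<forall>b\<in>Vh_layer P (Suc i). B (Suc i) (restr ?cl v) b = 0)"
  proof (intro conjI ballI)
    show "restr ?cl v \<in> restr ?cl ` Xh P" using vX by blast
    show "restr ?cl v x = (if k = n then tr (i + n) v x else 0)" if "k \<in> {0, 1}" "x \<in> iface P (i + k)" for k x
      using icl[OF that] v0[OF that(2,1)] that(2) by (cases "k = n") (simp_all add: restr_def)
    fix b assume "b \<in> Vh_layer P (Suc i)"
    moreover have "B (Suc i) (restr ?cl v) b = B (Suc i) v b"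
      using lcl by (intro grad_inner_cong) (auto simp: restr_def)
    ultimately show "B (Suc i) (restr ?cl v) b = 0"
      using v by (simp add: extension_def harmonic_def)
  qed
  fix w
  assume w: "w \<in> restr ?cl ` Xh P \<and>
    (\<forall>k\<in>{0, 1}. \<forall>x\<in>iface P (i + k). w x = (if k = n then tr (i + n) v x else 0)) \<and>
    (\<forall>b\<in>Vh_layer P (Suc i). B (Suc i) w b = 0)"
  then obtain u where u: "u \<in> Xh P" "w = restr ?cl u" by blast
  have wi: "w x = (if k = n then tr (i + n) v x else 0)" if "k \<in> {0, 1}" "x \<in> iface P (i + k)" for k x
    using w that by blast
  have ui: "u x = (if k = n then v x else 0)" if "k \<in> {0, 1}" "x \<in> iface P (i + k)" for k x
    using wi[OF that] icl[OF that] that(2) by (auto simp: u(2) restr_def)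
  have "B (Suc i) u b = B (Suc i) w b" for b
    unfolding u(2) using lcl by (intro grad_inner_cong) (auto simp: restr_def)
  then have "harmonic (Suc i) u" using w u(1) by (simp add: harmonic_def)
  moreover have "u x = 0" if "x \<in> iface P (i + 1 - n)" for x
    using ui[of "1 - n" x] n that by auto
  ultimately have u_ext: "extension i n u" by (simp add: extension_def)
  have "u x = v x" if "x \<in> iface P (i + n)" for x using ui[OF n that] by simp
  then have "tr (i + n) u = tr (i + n) v" by (auto simp: restr_def)
  from extension_unique[OF i(2) n u_ext v this]
  show "w = restr ?cl v" unfolding u(2) by (auto simp: restr_def)
qed

lemma extension_expand:
  assumes i: "i < N" and n: "n \<in> {0, 1}" and v: "extension i n v" and \<alpha>: "coords P (i + n) \<alpha> (tr (i + n) v)"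
    and z: "\<And>k. k < nb (i + n) \<Longrightarrow> extension i n (z k) \<and> tr (i + n) (z k) = tbasis P (i + n) ! k"
    and x: "x \<in> closure (layer P (Suc i))"
  shows "v x = (\<Sum>k<nb (i + n). vec_index \<alpha> k * z k x)"
proof (rule extension_unique[OF i n v _ _ x])
  show "extension i n (\<lambda>x. \<Sum>k<nb (i + n). vec_index \<alpha> k * z k x)"
    using z by (intro extension_sum[OF i]) auto
  have "tr (i + n) (\<lambda>x. \<Sum>k<nb (i + n). vec_index \<alpha> k * z k x) =
      (\<lambda>x. \<Sum>k<nb (i + n). vec_index \<alpha> k * tr (i + n) (z k) x)"
    by (auto simp: restr_def)
  then show "tr (i + n) v = tr (i + n) (\<lambda>x. \<Sum>k<nb (i + n). vec_index \<alpha> k * z k x)"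
    using \<alpha> z by (simp add: coords_def)
qed

lemma extension_basis:
  assumes i: "i < N" "1 \<le> i + n" and n: "n \<in> {0, 1}"
  obtains z where "\<And>k. k < nb (i + n) \<Longrightarrow> extension i n (z k) \<and> tr (i + n) (z k) = tbasis P (i + n) ! k"
proof -
  have "\<exists>v. k < nb (i + n) \<longrightarrow> extension i n v \<and> tr (i + n) v = tbasis P (i + n) ! k" for k
  proof (cases "k < nb (i + n)")
    case True
    have "i + n \<le> N" using i n by auto
    then obtain w where w: "w \<in> Xh P" "tr (i + n) w = tbasis P (i + n) ! k"
      using tbasis_trace[OF i(2) _ True] by blast
    obtain v where "extension i n v" "tr (i + n) v = tr (i + n) w"
      by (rule extension_exists[OF i(1) n w(1)])
    then show ?thesis using w(2) by metis
  qed simp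
  then show ?thesis using that by metis
qed

lemma scalar_prod_mat:
  fixes A :: "real Matrix.mat"
  assumes "A \<in> carrier_mat p q" "\<alpha> \<in> carrier_vec p" "\<beta> \<in> carrier_vec q"
  shows "scalar_prod \<alpha> (mult_mat_vec A \<beta>) = (\<Sum>k<p. \<Sum>l<q. vec_index \<alpha> k * A $$ (k, l) * vec_index \<beta> l)"
  using assms by (simp add: scalar_prod_def lessThan_atLeast0 sum_distrib_left mult_ac)

lemma scalar_prod_unit:
  fixes A :: "real Matrix.mat"
  assumes "A \<in> carrier_mat p q" "k < p" "l < q"
  shows "scalar_prod (unit_vec p k) (mult_mat_vec A (unit_vec q l)) = A $$ (k, l)"
  using assms by simp

text \<open>The Gram matrix of the extended basis traces meets the description by bilinearity, and
  unit coordinate vectors determine each entry.\<close>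

lemma Cmat_energy:
  assumes i: "1 \<le> i" "i < N" and n: "n \<in> {0, 1}" and m: "m \<in> {0, 1}"
  shows "Cmat P i n m \<in> carrier_mat (nb (i + n)) (nb (i + m))"
    and "\<And>v w \<alpha> \<beta>. extension i n v \<Longrightarrow> extension i m w \<Longrightarrow> coords P (i + n) \<alpha> (tr (i + n) v) \<Longrightarrow>
      coords P (i + m) \<beta> (tr (i + m) w) \<Longrightarrow>
      scalar_prod \<alpha> (mult_mat_vec (Cmat P i n m) \<beta>) = B (Suc i) v w"
proof -
  let ?p = "nb (i + n)" and ?q = "nb (i + m)" and ?cl = "closure (layer P (Suc i))"
  have j: "1 \<le> Suc i" "Suc i \<le> N" using i by auto
  interpret psd_form "Xh P" "B (Suc i)" by (rule psd_form_layer[OF j])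
  have lcl: "x \<in> ?cl" if "x \<in> layer P (Suc i)" for x
    using that closure_subset[of "layer P (Suc i)"] by blast
  obtain z where z: "\<And>k. k < ?p \<Longrightarrow> extension i n (z k) \<and> tr (i + n) (z k) = tbasis P (i + n) ! k"
    using extension_basis[OF i(2) _ n] i(1) by auto
  obtain y where y: "\<And>k. k < ?q \<Longrightarrow> extension i m (y k) \<and> tr (i + m) (y k) = tbasis P (i + m) ! k"
    using extension_basis[OF i(2) _ m] i(1) by auto
  have zX: "z k \<in> Xh P" if "k < ?p" for k using z[OF that] extension_Xh by blast
  have yX: "y k \<in> Xh P" if "k < ?q" for k using y[OF that] extension_Xh by blast
  define A where "A = Matrix.mat ?p ?q (\<lambda>(k, l). B (Suc i) (z k) (y l))"
  have Ac: "A \<in> carrier_mat ?p ?q" by (simp add: A_def)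
  have A: "scalar_prod \<alpha> (mult_mat_vec A \<beta>) = B (Suc i) v w"
    if v: "extension i n v" and w: "extension i m w" and \<alpha>: "coords P (i + n) \<alpha> (tr (i + n) v)"
      and \<beta>: "coords P (i + m) \<beta> (tr (i + m) w)" for v w \<alpha> \<beta>
  proof -
    let ?v = "\<lambda>x. \<Sum>k<?p. vec_index \<alpha> k * z k x" and ?w = "\<lambda>x. \<Sum>l<?q. vec_index \<beta> l * y l x"
    have wX: "?w \<in> Xh P" using yX by (intro sum_Xh) auto
    have "B (Suc i) v w = B (Suc i) ?v ?w"
      by (rule grad_inner_cong)
        (rule extension_expand[OF i(2) n v \<alpha> z lcl] extension_expand[OF i(2) m w \<beta> y lcl]; assumption)+
    also have "\<dots> = (\<Sum>k<?p. B (Suc i) (\<lambda>x. vec_index \<alpha> k * z k x) ?w)"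
      using zX by (intro sum_left[OF _ _ wX] scale_mem) auto
    also have "\<dots> = (\<Sum>k<?p. vec_index \<alpha> k * (\<Sum>l<?q. vec_index \<beta> l * B (Suc i) (z k) (y l)))"
    proof (rule sum.cong[OF refl])
      fix k assume "k \<in> {..<?p}"
      then have k: "z k \<in> Xh P" using zX by simp
      have "B (Suc i) (\<lambda>x. vec_index \<alpha> k * z k x) ?w = vec_index \<alpha> k * B (Suc i) (z k) ?w"
        by (rule scale_left[OF k wX])
      also have "B (Suc i) (z k) ?w = (\<Sum>l<?q. B (Suc i) (z k) (\<lambda>x. vec_index \<beta> l * y l x))"
        using yX by (intro sum_right[OF _ _ k] scale_mem) auto
      also have "\<dots> = (\<Sum>l<?q. vec_index \<beta> l * B (Suc i) (z k) (y l))"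
        using yX by (intro sum.cong) (auto simp: scale_right[OF _ k])
      finally show "B (Suc i) (\<lambda>x. vec_index \<alpha> k * z k x) ?w =
          vec_index \<alpha> k * (\<Sum>l<?q. vec_index \<beta> l * B (Suc i) (z k) (y l))" .
    qed
    also have "\<dots> = (\<Sum>k<?p. \<Sum>l<?q. vec_index \<alpha> k * A $$ (k, l) * vec_index \<beta> l)"
      by (intro sum.cong) (auto simp: A_def sum_distrib_left mult_ac)
    also have "\<dots> = scalar_prod \<alpha> (mult_mat_vec A \<beta>)"
      using \<alpha> \<beta> by (intro scalar_prod_mat[OF Ac, symmetric]) (auto simp: coords_def)
    finally show ?thesis by simp
  qed
  have Zh: "grad_inner (layer P (Suc i)) (Zh P n i (tr (i + n) v)) (Zh P m i (tr (i + m) w)) = B (Suc i) v w"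
    if v: "extension i n v" and w: "extension i m w" for v w
    unfolding Zh_extension[OF i n v] Zh_extension[OF i m w]
    using lcl by (intro grad_inner_cong) (auto simp: restr_def)
  have "Cmat P i n m = A"
    unfolding Cmat_def
  proof (rule the_equality)
    show "A \<in> carrier_mat ?p ?q \<and>
       (\<forall>g\<in>trace_space P (i + n). \<forall>h\<in>trace_space P (i + m). \<forall>\<alpha> \<beta>.
          coords P (i + n) \<alpha> g \<longrightarrow> coords P (i + m) \<beta> h \<longrightarrow>
          scalar_prod \<alpha> (mult_mat_vec A \<beta>) =
          grad_inner (layer P (Suc i)) (Zh P n i g) (Zh P m i h))"
    proof (intro conjI Ac ballI allI impI)
      fix g h \<alpha> \<beta>
      assume g: "g \<in> trace_space P (i + n)" and h: "h \<in> trace_space P (i + m)"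
        and \<alpha>: "coords P (i + n) \<alpha> g" and \<beta>: "coords P (i + m) \<beta> h"
      obtain g' where g': "g' \<in> Xh P" "g = tr (i + n) g'" using g unfolding trace_space_def by blast
      obtain h' where h': "h' \<in> Xh P" "h = tr (i + m) h'" using h unfolding trace_space_def by blast
      obtain v where v: "extension i n v" "tr (i + n) v = g"
        using extension_exists[OF i(2) n g'(1)] unfolding g'(2)[symmetric] by blast
      obtain w where w: "extension i m w" "tr (i + m) w = h"
        using extension_exists[OF i(2) m h'(1)] unfolding h'(2)[symmetric] by blast
      show "scalar_prod \<alpha> (mult_mat_vec A \<beta>) = grad_inner (layer P (Suc i)) (Zh P n i g) (Zh P m i h)"
        using A[OF v(1) w(1)] Zh[OF v(1) w(1)] \<alpha> \<beta> unfolding v(2) w(2) by simp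
    qed
    fix A'
    assume A': "A' \<in> carrier_mat ?p ?q \<and>
       (\<forall>g\<in>trace_space P (i + n). \<forall>h\<in>trace_space P (i + m). \<forall>\<alpha> \<beta>.
          coords P (i + n) \<alpha> g \<longrightarrow> coords P (i + m) \<beta> h \<longrightarrow>
          scalar_prod \<alpha> (mult_mat_vec A' \<beta>) =
          grad_inner (layer P (Suc i)) (Zh P n i g) (Zh P m i h))"
    show "A' = A"
    proof (rule eq_matI)
      fix k l assume "k < dim_row A" "l < dim_col A"
      then have kl: "k < ?p" "l < ?q" using Ac by auto
      have "tbasis P (i + n) ! k \<in> trace_space P (i + n)"
        using z[OF kl(1)] trace_spaceI[OF zX[OF kl(1)], of "i + n"] by simp
      moreover have "tbasis P (i + m) ! l \<in> trace_space P (i + m)"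
        using y[OF kl(2)] trace_spaceI[OF yX[OF kl(2)], of "i + m"] by simp
      ultimately have "scalar_prod (unit_vec ?p k) (mult_mat_vec A' (unit_vec ?q l)) =
          grad_inner (layer P (Suc i)) (Zh P n i (tbasis P (i + n) ! k)) (Zh P m i (tbasis P (i + m) ! l))"
        using A' coords_unit[OF kl(1)] coords_unit[OF kl(2)] by blast
      also have "\<dots> = B (Suc i) (z k) (y l)"
        using Zh[of "z k" "y l"] z[OF kl(1)] y[OF kl(2)] by simp
      finally show "A' $$ (k, l) = A $$ (k, l)"
        using scalar_prod_unit[of A' ?p ?q k l] A' kl by (simp add: A_def)
    qed (use A' Ac in auto)
  qed
  then show "Cmat P i n m \<in> carrier_mat ?p ?q"
    "\<And>v w \<alpha> \<beta>. extension i n v \<Longrightarrow> extension i m w \<Longrightarrow> coords P (i + n) \<alpha> (tr (i + n) v) \<Longrightarrow>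
      coords P (i + m) \<beta> (tr (i + m) w) \<Longrightarrow>
      scalar_prod \<alpha> (mult_mat_vec (Cmat P i n m) \<beta>) = B (Suc i) v w"
    using Ac A by simp_all
qed

end

section \<open>Slow and fast interface functions\<close>

text \<open>Each layer meets at most two components and each component lives on two layers. This
  evaluates both kinds of sums, also where an index falls out of range.\<close>

lemma sum_two:
  fixes G :: "nat \<Rightarrow> real"
  assumes "finite I" "a \<noteq> b" "\<And>i. i \<in> I \<Longrightarrow> i \<noteq> a \<Longrightarrow> i \<noteq> b \<Longrightarrow> G i = 0"
  shows "(\<Sum>i\<in>I. G i) = (if a \<in> I then G a else 0) + (if b \<in> I then G b else 0)"
proof -
  have "(\<Sum>i\<in>I. G i) = (\<Sum>i\<in>I. (if i = a then G i else 0) + (if i = b then G i else 0))"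
    using assms(2,3) by (intro sum.cong) auto
  then show ?thesis using assms(1) by (simp add: sum.distrib)
qed

locale layered_svd = layered_traces +
  fixes R0 R1 U S V :: "nat \<Rightarrow> real Matrix.mat" and r :: "nat \<Rightarrow> nat"
  assumes svd: "svd_data P R0 R1 U S V"
begin

lemma svd_coords:
  assumes "1 \<le> i" "i < N"
  shows "svd_coords (Cmat P i 0 0) (Cmat P i 0 1) (Cmat P i 1 1) (R0 i) (R1 i) (U i) (S i) (V i) (nb i) (nb (Suc i))"
proof
  show "Cmat P i 0 0 \<in> carrier_mat (nb i) (nb i)" "Cmat P i 0 1 \<in> carrier_mat (nb i) (nb (Suc i))"
    "Cmat P i 1 1 \<in> carrier_mat (nb (Suc i)) (nb (Suc i))"
    using Cmat_energy(1)[OF assms, of 0 0] Cmat_energy(1)[OF assms, of 0 1] Cmat_energy(1)[OF assms, of 1 1]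
    by simp_all
  have "i \<in> {1..<N}" using assms by simp
  then show "cholesky_factor (Cmat P i 0 0) (R0 i)" "cholesky_factor (Cmat P i 1 1) (R1 i)"
    "is_svd (transpose_mat (the (mat_inverse (R0 i))) * Cmat P i 0 1 * the (mat_inverse (R1 i))) (U i) (S i) (V i)"
    using svd unfolding svd_data_def coupling_mat_def by blast+
qed

abbreviation "lsv i \<equiv> svd_coords.left (R0 i) (U i)"

text \<open>In singular coordinates, membership in a span of columns becomes vanishing of
  coordinates. They are counted from 0, so the slow ones are those below \<open>r i\<close>.\<close>

definition slow :: "nat \<Rightarrow> (plane \<Rightarrow> real) set" where
  "slow i = {v \<in> Gi i. \<exists>\<alpha>. coords P i \<alpha> (tr i v) \<and> (\<forall>k<nb i. r i \<le> k \<longrightarrow> vec_index (lsv i \<alpha>) k = 0)}"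

definition fast :: "nat \<Rightarrow> (plane \<Rightarrow> real) set" where
  "fast i = {v \<in> Gi i. \<exists>\<alpha>. coords P i \<alpha> (tr i v) \<and> (\<forall>k<nb i. k < r i \<longrightarrow> vec_index (lsv i \<alpha>) k = 0)}"

lemma Gi_Xh: "v \<in> Gi i \<Longrightarrow> v \<in> Xh P"
  using Gi_Gamma Gamma_Xh by blast

lemma slow_eq:
  assumes "1 \<le> i" "i < N"
  shows "Vh_slow_i P r R0 U i = slow i"
proof -
  interpret svd_coords "Cmat P i 0 0" "Cmat P i 0 1" "Cmat P i 1 1" "R0 i" "R1 i" "U i" "S i" "V i" "nb i" "nb (Suc i)"
    by (rule svd_coords[OF assms])
  have "coords P i \<alpha> g \<Longrightarrow> \<alpha> \<in> carrier_vec (nb i)" for \<alpha> g by (simp add: coords_def)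
  then have "v \<in> Vh_slow_i P r R0 U i \<longleftrightarrow> v \<in> slow i" for v
    unfolding Vh_slow_i_def Vh_iface_def Yh_slow_def slow_def Gi_def mem_Collect_eq
    using slow_iff trace_spaceI[OF Gamma_Xh, of v i] by blast
  then show ?thesis by blast
qed

lemma fast_eq:
  assumes "1 \<le> i" "i < N"
  shows "Vh_fast_i P r R0 U i = fast i"
proof -
  interpret svd_coords "Cmat P i 0 0" "Cmat P i 0 1" "Cmat P i 1 1" "R0 i" "R1 i" "U i" "S i" "V i" "nb i" "nb (Suc i)"
    by (rule svd_coords[OF assms])
  have "coords P i \<alpha> g \<Longrightarrow> \<alpha> \<in> carrier_vec (nb i)" for \<alpha> g by (simp add: coords_def)
  then have "v \<in> Vh_fast_i P r R0 U i \<longleftrightarrow> v \<in> fast i" for v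
    unfolding Vh_fast_i_def Vh_iface_def Yh_fast_def fast_def Gi_def mem_Collect_eq
    using fast_iff trace_spaceI[OF Gamma_Xh, of v i] by blast
  then show ?thesis by blast
qed

lemma slow_Gi: "v \<in> slow i \<Longrightarrow> v \<in> Gi i"
  and fast_Gi: "v \<in> fast i \<Longrightarrow> v \<in> Gi i"
  by (simp_all add: slow_def fast_def)

lemma slow_fast_lincomb:
  assumes i: "1 \<le> i" "i < N"
  shows "u \<in> slow i \<Longrightarrow> v \<in> slow i \<Longrightarrow> (\<lambda>x. a * u x + b * v x) \<in> slow i"
    and "u \<in> fast i \<Longrightarrow> v \<in> fast i \<Longrightarrow> (\<lambda>x. a * u x + b * v x) \<in> fast i"
proof -
  interpret svd_coords "Cmat P i 0 0" "Cmat P i 0 1" "Cmat P i 1 1" "R0 i" "R1 i" "U i" "S i" "V i" "nb i" "nb (Suc i)"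
    by (rule svd_coords[OF i])
  \<comment> \<open>\<open>Q\<close> marks the coordinates that must vanish, so one argument serves
    both spaces.\<close>
  have *: "\<exists>\<gamma>. coords P i \<gamma> (tr i (\<lambda>x. a * u x + b * v x)) \<and> (\<forall>k<nb i. Q k \<longrightarrow> vec_index (lsv i \<gamma>) k = 0)"
    if \<alpha>: "coords P i \<alpha> (tr i u)" "\<forall>k<nb i. Q k \<longrightarrow> vec_index (lsv i \<alpha>) k = 0"
      and \<beta>: "coords P i \<beta> (tr i v)" "\<forall>k<nb i. Q k \<longrightarrow> vec_index (lsv i \<beta>) k = 0" for \<alpha> \<beta> Q
  proof -
    have c: "\<alpha> \<in> carrier_vec (nb i)" "\<beta> \<in> carrier_vec (nb i)"
      using \<alpha>(1) \<beta>(1) by (simp_all add: coords_def)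
    have "coords P i (Matrix.vec (nb i) (\<lambda>k. a * vec_index \<alpha> k + b * vec_index \<beta> k)) (tr i (\<lambda>x. a * u x + b * v x))"
      unfolding tr_lincomb by (rule coords_lincomb[OF \<alpha>(1) \<beta>(1)])
    moreover have "\<forall>k<nb i. Q k \<longrightarrow> vec_index (lsv i (Matrix.vec (nb i) (\<lambda>k. a * vec_index \<alpha> k + b * vec_index \<beta> k))) k = 0"
      using left_lincomb[OF c] \<alpha>(2) \<beta>(2) by simp
    ultimately show ?thesis by blast
  qed
  show "(\<lambda>x. a * u x + b * v x) \<in> slow i" if uv: "u \<in> slow i" "v \<in> slow i"
  proof -
    obtain \<alpha> where \<alpha>: "coords P i \<alpha> (tr i u)" "\<forall>k<nb i. r i \<le> k \<longrightarrow> vec_index (lsv i \<alpha>) k = 0"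
      using uv(1) unfolding slow_def by blast
    obtain \<beta> where \<beta>: "coords P i \<beta> (tr i v)" "\<forall>k<nb i. r i \<le> k \<longrightarrow> vec_index (lsv i \<beta>) k = 0"
      using uv(2) unfolding slow_def by blast
    show ?thesis
      unfolding slow_def mem_Collect_eq
      using Gi_lincomb[OF slow_Gi[OF uv(1)] slow_Gi[OF uv(2)]] *[OF \<alpha> \<beta>] by blast
  qed
  show "(\<lambda>x. a * u x + b * v x) \<in> fast i" if uv: "u \<in> fast i" "v \<in> fast i"
  proof -
    obtain \<alpha> where \<alpha>: "coords P i \<alpha> (tr i u)" "\<forall>k<nb i. k < r i \<longrightarrow> vec_index (lsv i \<alpha>) k = 0"
      using uv(1) unfolding fast_def by blast
    obtain \<beta> where \<beta>: "coords P i \<beta> (tr i v)" "\<forall>k<nb i. k < r i \<longrightarrow> vec_index (lsv i \<beta>) k = 0"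
      using uv(2) unfolding fast_def by blast
    show ?thesis
      unfolding fast_def mem_Collect_eq
      using Gi_lincomb[OF fast_Gi[OF uv(1)] fast_Gi[OF uv(2)]] *[OF \<alpha> \<beta>] by blast
  qed
qed

text \<open>Truncating the singular coordinates of the trace gives a slow trace, whose discrete
  harmonic extension is \<open>s\<close>; what is left has only fast coordinates.\<close>

lemma slow_fast_decomposition:
  assumes i: "1 \<le> i" "i < N" and v: "v \<in> Gi i"
  obtains s f where "s \<in> slow i" "f \<in> fast i" "v = (\<lambda>x. s x + f x)"
proof -
  interpret svd_coords "Cmat P i 0 0" "Cmat P i 0 1" "Cmat P i 1 1" "R0 i" "R1 i" "U i" "S i" "V i" "nb i" "nb (Suc i)"
    by (rule svd_coords[OF i])
  have iN: "i \<le> N" using i by simp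
  obtain \<alpha> where \<alpha>: "coords P i \<alpha> (tr i v)" by (rule coords_ex[OF i(1) iN Gi_Xh[OF v]])
  have \<alpha>c: "\<alpha> \<in> carrier_vec (nb i)" using \<alpha> by (simp add: coords_def)
  let ?a = "Matrix.vec (nb i) (\<lambda>k. if r i \<le> k then 0 else vec_index (lsv i \<alpha>) k)"
  obtain \<beta> where \<beta>: "\<beta> \<in> carrier_vec (nb i)" "lsv i \<beta> = ?a"
    by (rule left_surj[of ?a]) simp_all
  obtain w where w: "w \<in> Xh P" "coords P i \<beta> (tr i w)" by (rule coords_surj[OF i(1) iN \<beta>(1)])
  obtain s where s: "s \<in> Vh_Gamma P" "\<And>x. x \<in> iface P i \<Longrightarrow> s x = w x"
    "\<And>j x. j \<le> N \<Longrightarrow> j \<noteq> i \<Longrightarrow> x \<in> iface P j \<Longrightarrow> s x = 0"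
    using Gamma_exists[OF i w(1)] by blast
  have "s x = 0" if "j \<in> {1..<N}" "j \<noteq> i" "x \<in> iface P j" for j x
    using s(3)[of j x] that by simp
  then have sG: "s \<in> Gi i" using s(1) unfolding Gi_def by blast
  have "tr i s = tr i w" using s(2) by (auto simp: restr_def)
  then have s\<beta>: "coords P i \<beta> (tr i s)" using w(2) by simp
  have "s \<in> slow i"
    unfolding slow_def mem_Collect_eq using sG s\<beta> \<beta>(2) by (intro conjI exI[of _ \<beta>]) auto
  moreover have "(\<lambda>x. 1 * v x + (- 1) * s x) \<in> fast i"
  proof -
    let ?\<gamma> = "Matrix.vec (nb i) (\<lambda>k. 1 * vec_index \<alpha> k + (- 1) * vec_index \<beta> k)"
    have "coords P i ?\<gamma> (tr i (\<lambda>x. 1 * v x + (- 1) * s x))"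
      unfolding tr_lincomb by (rule coords_lincomb[OF \<alpha> s\<beta>])
    moreover have "vec_index (lsv i ?\<gamma>) k = 0" if "k < nb i" "k < r i" for k
      using left_lincomb[OF \<alpha>c \<beta>(1) that(1), of 1 "-1"] \<beta>(2) that by simp
    moreover have "(\<lambda>x. 1 * v x + (- 1) * s x) \<in> Gi i" by (rule Gi_lincomb[OF v sG])
    ultimately show ?thesis unfolding fast_def by blast
  qed
  moreover have "v = (\<lambda>x. s x + (1 * v x + (- 1) * s x))" by simp
  ultimately show ?thesis by (rule that)
qed

section \<open>Interaction of components through one layer\<close>

lemma Gi_extension:
  assumes "1 \<le> i" "i < N" "v \<in> Gi i"
  shows "extension i 0 v"
proof -
  have "harmonic (Suc i) v" using assms by (intro Gamma_harmonic Gi_Gamma[OF assms(3)]) auto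
  moreover have "v x = 0" if "x \<in> iface P (i + 1)" for x
    using assms that by (intro Gi_iface[OF assms(3), of "i + 1" x]) auto
  ultimately show ?thesis by (simp add: extension_def)
qed

lemma Gi_extension_Suc:
  assumes "1 \<le> i" "Suc i < N" "v \<in> Gi (Suc i)"
  shows "extension i 1 v"
proof -
  have "harmonic (Suc i) v" using assms by (intro Gamma_harmonic Gi_Gamma[OF assms(3)]) auto
  moreover have "v x = 0" if "x \<in> iface P i" for x
    using assms that by (intro Gi_iface[OF assms(3), of i x]) auto
  ultimately show ?thesis by (simp add: extension_def)
qed

text \<open>On layer i + 1 the energy is the Euclidean product of singular coordinates, and those of
  \<open>s\<close> and \<open>f\<close> have disjoint supports. Mirror symmetry gives layer i.
  Orthogonality on each layer makes it independent of the weights.\<close>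

lemma slow_fast_orthogonal:
  assumes i: "1 \<le> i" "i < N" and s: "s \<in> slow i" and f: "f \<in> fast i"
  shows "B (Suc i) s f = 0" "B i s f = 0"
proof -
  interpret svd_coords "Cmat P i 0 0" "Cmat P i 0 1" "Cmat P i 1 1" "R0 i" "R1 i" "U i" "S i" "V i" "nb i" "nb (Suc i)"
    by (rule svd_coords[OF i])
  obtain \<alpha> where \<alpha>: "coords P i \<alpha> (tr i s)" "\<forall>k<nb i. r i \<le> k \<longrightarrow> vec_index (lsv i \<alpha>) k = 0"
    using s unfolding slow_def by blast
  obtain \<beta> where \<beta>: "coords P i \<beta> (tr i f)" "\<forall>k<nb i. k < r i \<longrightarrow> vec_index (lsv i \<beta>) k = 0"
    using f unfolding fast_def by blast
  have c: "\<alpha> \<in> carrier_vec (nb i)" "\<beta> \<in> carrier_vec (nb i)"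
    using \<alpha>(1) \<beta>(1) by (simp_all add: coords_def)
  have "B (Suc i) s f = scalar_prod \<alpha> (mult_mat_vec (Cmat P i 0 0) \<beta>)"
    using Cmat_energy(2)[OF i, of 0 0 s f \<alpha> \<beta>] Gi_extension[OF i slow_Gi[OF s]] Gi_extension[OF i fast_Gi[OF f]]
      \<alpha>(1) \<beta>(1) by simp
  also have "\<dots> = scalar_prod (lsv i \<alpha>) (lsv i \<beta>)" by (rule scalar_C00[OF c])
  also have "\<dots> = (\<Sum>k<nb i. vec_index (lsv i \<alpha>) k * vec_index (lsv i \<beta>) k)"
    using left_carrier[OF c(2)] by (simp add: scalar_prod_def lessThan_atLeast0)
  also have "\<dots> = 0"
  proof (rule sum.neutral, rule ballI)
    fix k assume "k \<in> {..<nb i}"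
    then show "vec_index (lsv i \<alpha>) k * vec_index (lsv i \<beta>) k = 0"
      using \<alpha>(2) \<beta>(2) by (cases "k < r i") auto
  qed
  finally show 0: "B (Suc i) s f = 0" .
  show "B i s f = 0" using Gi_B[OF i slow_Gi[OF s] fast_Gi[OF f]] 0 by simp
qed

text \<open>\<rho> = 0 gives the full coupling and \<rho> = \<open>r i\<close> that of fast
  functions. It is stated for \<open>extension\<close> rather than \<open>Gi\<close> because it is
  also applied to mirror images, which are harmonic on one layer only.\<close>

lemma extension_bound:
  assumes i: "1 \<le> i" "i < N" and p: "extension i 0 p" and q: "extension i 1 q"
    and \<alpha>: "coords P i \<alpha> (tr i p)" "\<And>k. k < nb i \<Longrightarrow> k < \<rho> \<Longrightarrow> vec_index (lsv i \<alpha>) k = 0"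
  shows "\<bar>B (Suc i) p q\<bar> \<le> sing_val (S i) (\<rho> + 1) * (sqrt (B (Suc i) p p) * sqrt (B (Suc i) q q))"
proof -
  interpret svd_coords "Cmat P i 0 0" "Cmat P i 0 1" "Cmat P i 1 1" "R0 i" "R1 i" "U i" "S i" "V i" "nb i" "nb (Suc i)"
    by (rule svd_coords[OF i])
  obtain \<beta> where \<beta>: "coords P (Suc i) \<beta> (tr (Suc i) q)"
    using coords_ex[of "Suc i", OF _ _ extension_Xh[OF q]] i by auto
  have c: "\<alpha> \<in> carrier_vec (nb i)" "\<beta> \<in> carrier_vec (nb (Suc i))"
    using \<alpha>(1) \<beta>(1) by (simp_all add: coords_def)
  have "scalar_prod \<alpha> (mult_mat_vec (Cmat P i 0 1) \<beta>) = B (Suc i) p q"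
    using Cmat_energy(2)[OF i, of 0 1 p q \<alpha> \<beta>] p q \<alpha>(1) \<beta> by simp
  moreover have "scalar_prod \<alpha> (mult_mat_vec (Cmat P i 0 0) \<alpha>) = B (Suc i) p p"
    using Cmat_energy(2)[OF i, of 0 0 p p \<alpha> \<alpha>] p \<alpha>(1) by simp
  moreover have "scalar_prod \<beta> (mult_mat_vec (Cmat P i 1 1) \<beta>) = B (Suc i) q q"
    using Cmat_energy(2)[OF i, of 1 1 q q \<beta> \<beta>] q \<beta> by simp
  ultimately show ?thesis using C01_bound[OF c \<alpha>(2)] by simp
qed

lemma sing_val_nonneg: "1 \<le> i \<Longrightarrow> i < N \<Longrightarrow> sing_val (S i) k \<ge> 0"
  using svd_coords.sing_val_nonneg[OF svd_coords] .

lemma layer_bound: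
  assumes i: "1 \<le> i" "Suc i < N" and p: "p \<in> Gi i" and q: "q \<in> Gi (Suc i)"
  shows "\<bar>B (Suc i) p q\<bar> \<le> sing_val (S i) 1 * (sqrt (B (Suc i) p p) * sqrt (B (Suc i) q q))"
proof -
  have iN: "i < N" "i \<le> N" using i by auto
  obtain \<alpha> where \<alpha>: "coords P i \<alpha> (tr i p)" by (rule coords_ex[OF i(1) iN(2) Gi_Xh[OF p]])
  show ?thesis
    using extension_bound[OF i(1) iN(1) Gi_extension[OF i(1) iN(1) p] Gi_extension_Suc[OF i q] \<alpha>, of 0] by simp
qed

lemma layer_bound_fast:
  assumes i: "1 \<le> i" "Suc i < N" and p: "p \<in> fast i" and q: "q \<in> Gi (Suc i)"
  shows "\<bar>B (Suc i) p q\<bar> \<le> sing_val (S i) (r i + 1) * (sqrt (B (Suc i) p p) * sqrt (B (Suc i) q q))"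
proof -
  have iN: "i < N" using i by auto
  obtain \<alpha> where \<alpha>: "coords P i \<alpha> (tr i p)" "\<forall>k<nb i. k < r i \<longrightarrow> vec_index (lsv i \<alpha>) k = 0"
    using p unfolding fast_def by blast
  show ?thesis
    using extension_bound[OF i(1) iN Gi_extension[OF i(1) iN fast_Gi[OF p]] Gi_extension_Suc[OF i q] \<alpha>(1), of "r i"] \<alpha>(2)
    by simp
qed

text \<open>The fast space of interface \<open>i + 1\<close> is defined through layer \<open>i + 2\<close>; the mirror image at this
  interface carries the estimate over to layer \<open>i + 1\<close>.\<close>

lemma layer_bound_fast_Suc:
  assumes i: "1 \<le> i" "Suc i < N" and p: "p \<in> Gi i" and q: "q \<in> fast (Suc i)"
  shows "\<bar>B (Suc i) p q\<bar> \<le> sing_val (S (Suc i)) (r (Suc i) + 1) * (sqrt (B (Suc i) p p) * sqrt (B (Suc i) q q))"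
proof -
  let ?j = "Suc i"
  let ?m = "mirror (2 * real ?j)"
  have j: "1 \<le> ?j" "?j < N" "?j \<le> N" and l: "?j \<in> {?j, Suc ?j}" and l': "2 * ?j + 1 - ?j = Suc ?j"
    using i by auto
  note qG = fast_Gi[OF q]
  have ph: "harmonic ?j p" by (rule Gamma_harmonic[OF j(1,3) Gi_Gamma[OF p]])
  \<comment> \<open>Only \<open>p\<close> has to be moved to layer i + 2; \<open>q\<close> lives on
    interface i + 1 and is its own mirror image.\<close>
  obtain w where w: "harmonic (Suc ?j) w" "\<And>x. x \<in> closure (layer P (Suc ?j)) \<Longrightarrow> w x = p (?m x)"
    using mirror_harmonic[OF j(1,2) l ph] unfolding l' by blast
  have wl: "w x = p (?m x)" if "x \<in> layer P (Suc ?j)" for x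
    using w(2)[of x] that closure_subset[of "layer P (Suc ?j)"] by blast
  have ql: "q x = q (?m x)" if "x \<in> layer P (Suc ?j)" for x
  proof -
    have "?m x \<in> layer P ?j" using that layer_Suc[OF j(1), of P] by blast
    then have "?m x \<in> closure (layer P ?j)" using closure_subset by blast
    from Gi_mirror[OF j(1,2) qG this] show ?thesis by simp
  qed
  note X = Gi_Xh[OF p] Gi_Xh[OF qG]
  have eq: "B (Suc ?j) w q = B ?j p q" "B (Suc ?j) w w = B ?j p p" "B (Suc ?j) q q = B ?j q q"
    using B_mirror[OF j(1,2) l X, of w q] B_mirror[OF j(1,2) l X(1,1), of w w] B_mirror[OF j(1,2) l X(2,2), of q q]
      wl ql unfolding l' by blast+
  have "w x = 0" if x: "x \<in> iface P ?j" for x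
  proof -
    have "x \<in> closure (layer P (Suc ?j))" using iface_closure[of "Suc ?j" x] j x by simp
    from w(2)[OF this] have "w x = p x" using mirror_on_iface[OF iface_line[OF j(3) x]] by simp
    also have "\<dots> = 0" using x j by (intro Gi_iface[OF p, of ?j]) auto
    finally show ?thesis .
  qed
  then have we: "extension ?j 1 w" using w(1) by (simp add: extension_def)
  obtain \<alpha> where \<alpha>: "coords P ?j \<alpha> (tr ?j q)" "\<forall>k<nb ?j. k < r ?j \<longrightarrow> vec_index (lsv ?j \<alpha>) k = 0"
    using q unfolding fast_def by blast
  have "\<bar>B (Suc ?j) q w\<bar> \<le> sing_val (S ?j) (r ?j + 1) * (sqrt (B (Suc ?j) q q) * sqrt (B (Suc ?j) w w))"
    using extension_bound[OF j(1,2) Gi_extension[OF j(1,2) qG] we \<alpha>(1), of "r ?j"] \<alpha>(2) by simp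
  then show ?thesis using eq by (simp add: grad_inner_commute mult.commute)
qed

end

section \<open>The energy form\<close>

context layered_svd
begin

lemma psd_form_energy:
  assumes "\<And>j. j \<in> {1..N} \<Longrightarrow> y j > 0"
  shows "psd_form (Xh P) (energy P y)"
proof
  have L: "psd_form (Xh P) (B j)" if "j \<in> {1..N}" for j using that by (intro psd_form_layer) auto
  show "energy P y (\<lambda>x. a * u x + b * v x) w = a * energy P y u w + b * energy P y v w"
    if "u \<in> Xh P" "v \<in> Xh P" "w \<in> Xh P" for u v w a b
  proof -
    have "energy P y (\<lambda>x. a * u x + b * v x) w = (\<Sum>j\<in>{1..N}. a * (y j * B j u w) + b * (y j * B j v w))"
      unfolding energy_def using psd_form.lincomb_left[OF L that]
      by (intro sum.cong) (auto simp: algebra_simps)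
    then show ?thesis by (simp add: energy_def sum.distrib sum_distrib_left)
  qed
  show "energy P y u v = energy P y v u" for u v
    unfolding energy_def by (simp add: grad_inner_commute[of _ u v])
  show "0 \<le> energy P y u u" for u
    unfolding energy_def using assms by (intro sum_nonneg mult_nonneg_nonneg grad_inner_nonneg) (simp add: less_imp_le)
qed (rule Xh_zero, rule Xh_lincomb)

lemma Gi_B_zero:
  assumes "p \<in> Gi i" "q \<in> Xh P" "l \<in> {1..N}" "l \<noteq> i" "l \<noteq> Suc i"
  shows "B l p q = 0" "B l q p = 0"
proof -
  have "p x = 0" if "x \<in> layer P l" for x
    using that assms(3) closure_subset[of "layer P l"] by (intro Gi_layer_zero[OF assms(1) _ _ assms(4,5)]) auto
  then show "B l p q = 0" "B l q p = 0"
    using B_zero[of l q p] assms(2,3) by auto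
qed

text \<open>The two components share layer i + 1 and no other, so a single weight survives.\<close>

lemma energy_Suc:
  assumes "1 \<le> i" "Suc i < N" "p \<in> Gi i" "q \<in> Gi (Suc i)"
  shows "energy P y p q = y (Suc i) * B (Suc i) p q"
proof -
  have "y l * B l p q = 0" if l: "l \<in> {1..N} - {Suc i}" for l
  proof (cases "l = i")
    case True
    then show ?thesis using Gi_B_zero(2)[OF assms(4) Gi_Xh[OF assms(3)], of l] l by simp
  next
    case False
    then show ?thesis using Gi_B_zero(1)[OF assms(3) Gi_Xh[OF assms(4)], of l] l by simp
  qed
  then have "energy P y p q = (\<Sum>l\<in>{Suc i}. y l * B l p q)"
    unfolding energy_def using assms by (intro sum.mono_neutral_right) auto
  then show ?thesis by simp
qed

lemma energy_far:
  assumes "Suc i < j" "p \<in> Gi i" "q \<in> Gi j"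
  shows "energy P y p q = 0"
  unfolding energy_def
proof (rule sum.neutral, rule ballI)
  fix l assume l: "l \<in> {1..N}"
  show "y l * B l p q = 0"
  proof (cases "l = i \<or> l = Suc i")
    case True
    then show ?thesis using Gi_B_zero(2)[OF assms(3) Gi_Xh[OF assms(2)] l] assms(1) by auto
  next
    case False
    then show ?thesis using Gi_B_zero(1)[OF assms(2) Gi_Xh[OF assms(3)] l] by auto
  qed
qed

text \<open>Both layers contribute the same gradient product by mirror symmetry. Hence the energy is
  the gradient product on \<open>Omega P\<close> times (y i + y (Suc i)) / 2, which is where the
  factor 2 / (y i + y (Suc i)) of the fast solutions comes from.\<close>

lemma energy_same:
  assumes "1 \<le> i" "i < N" "p \<in> Gi i" "q \<in> Gi i"
  shows "energy P y p q = (y i + y (Suc i)) * B (Suc i) p q"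
    and "grad_inner (Omega P) p q = 2 * B (Suc i) p q"
proof -
  have I: "finite {1..N}" "i \<noteq> Suc i" by auto
  have 0: "B l p q = 0" if "l \<in> {1..N}" "l \<noteq> i" "l \<noteq> Suc i" for l
    by (rule Gi_B_zero(1)[OF assms(3) Gi_Xh[OF assms(4)] that])
  note eq = Gi_B[OF assms(1,2,3,4)]
  show "energy P y p q = (y i + y (Suc i)) * B (Suc i) p q"
    unfolding energy_def using sum_two[OF I, of "\<lambda>l. y l * B l p q"] 0 assms(1,2)
    by (simp add: eq algebra_simps)
  have "grad_inner (Omega P) p q = (\<Sum>l\<in>{1..N}. B l p q)"
    by (intro grad_inner_Omega Xh_H1 Gi_Xh[OF assms(3)] Gi_Xh[OF assms(4)])
  then show "grad_inner (Omega P) p q = 2 * B (Suc i) p q"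
    using sum_two[OF I, of "\<lambda>l. B l p q"] 0 assms(1,2) by (simp add: eq)
qed

text \<open>The weight splits into two square roots, one for each factor, and the term of one layer
  is at most the full energy as all terms are nonnegative. So a bound on one layer passes to the
  energy norm with the same factor, whatever the weights are.\<close>

lemma energy_bound:
  assumes y: "\<And>j. j \<in> {1..N} \<Longrightarrow> y j > 0" and l: "l \<in> {1..N}" and eq: "energy P y p q = y l * B l p q"
    and b: "\<bar>B l p q\<bar> \<le> s * (sqrt (B l p p) * sqrt (B l q q))" and s: "s \<le> \<sigma>" and \<sigma>: "0 \<le> \<sigma>"
  shows "\<bar>energy P y p q\<bar> \<le> \<sigma> * sqrt (energy P y p p) * sqrt (energy P y q q)"
proof -
  have le: "sqrt (y l * B l v v) \<le> sqrt (energy P y v v)" for v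
  proof (rule real_sqrt_le_mono)
    show "y l * B l v v \<le> energy P y v v"
      unfolding energy_def
    proof (rule member_le_sum[OF l, of "\<lambda>j. y j * B j v v"])
      fix j assume "j \<in> {1..N} - {l}"
      then have "0 < y j" using y by blast
      then show "0 \<le> y j * B j v v" by (simp add: grad_inner_nonneg)
    qed simp
  qed
  have n: "0 \<le> sqrt (B l v v)" for v by (simp add: grad_inner_nonneg)
  have yl: "0 < y l" using y l by blast
  then have y0: "0 \<le> sqrt (y l * B l v v)" for v by (simp add: grad_inner_nonneg)
  have e0: "0 \<le> sqrt (energy P y v v)" for v by (rule order_trans[OF y0 le])
  have "\<bar>energy P y p q\<bar> = y l * \<bar>B l p q\<bar>" using eq yl by (simp add: abs_mult)
  also have "\<dots> \<le> y l * (\<sigma> * (sqrt (B l p p) * sqrt (B l q q)))"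
  proof (rule mult_left_mono)
    have "s * (sqrt (B l p p) * sqrt (B l q q)) \<le> \<sigma> * (sqrt (B l p p) * sqrt (B l q q))"
      using s n by (intro mult_right_mono mult_nonneg_nonneg) auto
    with b show "\<bar>B l p q\<bar> \<le> \<sigma> * (sqrt (B l p p) * sqrt (B l q q))" by linarith
  qed (use yl in simp)
  also have "\<dots> = \<sigma> * (sqrt (y l * B l p p) * sqrt (y l * B l q q))"
  proof -
    have "y l = sqrt (y l) * sqrt (y l)" using yl by simp
    then show ?thesis unfolding real_sqrt_mult by (metis mult.assoc mult.commute)
  qed
  also have "\<dots> \<le> \<sigma> * (sqrt (energy P y p p) * sqrt (energy P y q q))"
    by (rule mult_left_mono[OF mult_mono[OF le le e0 y0] \<sigma>])
  finally show ?thesis by (simp add: mult.assoc)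
qed

text \<open>The fast space of interface \<open>j\<close> is defined through layer j + 1. A neighbour
  on the right is met there directly, one on the left only after mirroring, and more distant
  components do not interact.\<close>

lemma energy_cross:
  assumes y: "\<And>j. j \<in> {1..N} \<Longrightarrow> y j > 0" and \<sigma>: "\<And>k. k \<in> {1..<N} \<Longrightarrow> sing_val (S k) (r k + 1) \<le> \<sigma>"
    and ij: "i \<in> {1..<N}" "j \<in> {1..<N}" "i \<noteq> j" and p: "p \<in> Gi i" and q: "q \<in> fast j"
  shows "\<bar>energy P y p q\<bar> \<le> \<sigma> * sqrt (energy P y p p) * sqrt (energy P y q q)"
proof -
  interpret psd_form "Xh P" "energy P y" by (rule psd_form_energy[OF y])
  have \<sigma>0: "0 \<le> \<sigma>" using \<sigma>[OF ij(1)] sing_val_nonneg[of i] ij(1) by (meson atLeastLessThan_iff order_trans)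
  have X: "p \<in> Xh P" "q \<in> Xh P" using Gi_Xh[OF p] Gi_Xh[OF fast_Gi[OF q]] .
  have E0: "0 \<le> \<sigma> * sqrt (energy P y p p) * sqrt (energy P y q q)"
    using \<sigma>0 nonneg X by simp
  consider "j = Suc i" | "Suc i < j" | "i = Suc j" | "Suc j < i" using ij(3) by linarith
  then show ?thesis
  proof cases
    case 1
    have i: "1 \<le> i" "Suc i < N" using ij 1 by auto
    have q': "q \<in> fast (Suc i)" and l: "Suc i \<in> {1..N}" using q i 1 by auto
    have s: "sing_val (S (Suc i)) (r (Suc i) + 1) \<le> \<sigma>" using \<sigma>[of "Suc i"] i by simp
    show ?thesis
      by (rule energy_bound[OF _ l energy_Suc[OF i p fast_Gi[OF q']] layer_bound_fast_Suc[OF i p q'] s \<sigma>0])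
        (rule y)
  next
    case 2
    then show ?thesis using energy_far[OF 2 p fast_Gi[OF q]] E0 by simp
  next
    case 3
    have j: "1 \<le> j" "Suc j < N" using ij 3 by auto
    have p': "p \<in> Gi (Suc j)" and l: "Suc j \<in> {1..N}" using p j 3 by auto
    have s: "sing_val (S j) (r j + 1) \<le> \<sigma>" using \<sigma>[of j] j by simp
    have "\<bar>energy P y q p\<bar> \<le> \<sigma> * sqrt (energy P y q q) * sqrt (energy P y p p)"
      by (rule energy_bound[OF _ l energy_Suc[OF j fast_Gi[OF q] p'] layer_bound_fast[OF j q p'] s \<sigma>0])
        (rule y)
    then show ?thesis using commute[OF X] by (simp add: mult_ac)
  next
    case 4
    then show ?thesis using energy_far[OF 4 fast_Gi[OF q] p] commute[OF X] E0 by simp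
  qed
qed

text \<open>On layer \<open>l\<close> only the components l - 1 and l are present. Their coupling is
  at most \<sigma> times the product of their norms, and 2 a b \<le> a^2 + b^2 turns this into a
  loss of \<sigma> times the sum of their energies.\<close>

lemma layer_coercive:
  assumes v: "\<And>i. i \<in> {1..<N} \<Longrightarrow> v i \<in> Gi i" and l: "l \<in> {1..N}"
    and \<sigma>: "\<And>k. k \<in> {1..<N} \<Longrightarrow> sing_val (S k) 1 \<le> \<sigma>" and \<sigma>0: "0 \<le> \<sigma>"
  shows "(1 - \<sigma>) * (\<Sum>i\<in>{1..<N}. B l (v i) (v i)) \<le> B l (\<lambda>x. \<Sum>i\<in>{1..<N}. v i x) (\<lambda>x. \<Sum>i\<in>{1..<N}. v i x)"
proof -
  have l1: "1 \<le> l" "l \<le> N" using l by auto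
  interpret psd_form "Xh P" "B l" by (rule psd_form_layer[OF l1])
  let ?I = "{1..<N}"
  obtain a where la: "l = Suc a" using l1(1) by (cases l) auto
  have I: "finite ?I" "a \<noteq> l" using la by auto
  \<comment> \<open>Padding by 0 covers the first and the last layer, where one of the two
    neighbouring interfaces carries no component.\<close>
  define z where "z i = (if i \<in> ?I then v i else (\<lambda>x. 0))" for i
  have zX: "z i \<in> Xh P" for i using v Gi_Xh Xh_zero by (auto simp: z_def)
  have on_layer: "(\<Sum>i\<in>?I. v i x) = z a x + z l x" if x: "x \<in> layer P l" for x
  proof -
    have xc: "x \<in> closure (layer P l)" using x closure_subset by blast
    have "v i x = 0" if "i \<in> ?I" "i \<noteq> a" "i \<noteq> l" for i
      using that la by (intro Gi_layer_zero[OF v[OF that(1)] l1 _ _ xc]) auto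
    from sum_two[OF I, of "\<lambda>i. v i x", OF this] show ?thesis by (auto simp: z_def)
  qed
  have "B l (\<lambda>x. \<Sum>i\<in>?I. v i x) (\<lambda>x. \<Sum>i\<in>?I. v i x) = B l (\<lambda>x. z a x + z l x) (\<lambda>x. z a x + z l x)"
    by (intro grad_inner_cong on_layer)
  also have "\<dots> = B l (z a) (z a) + 2 * B l (z a) (z l) + B l (z l) (z l)"
    using zX by (simp add: add_left add_right add_mem commute[of "z l" "z a"])
  finally have 1: "B l (\<lambda>x. \<Sum>i\<in>?I. v i x) (\<lambda>x. \<Sum>i\<in>?I. v i x) =
     B l (z a) (z a) + 2 * B l (z a) (z l) + B l (z l) (z l)" .
  have "B l (v i) (v i) = 0" if "i \<in> ?I" "i \<noteq> a" "i \<noteq> l" for i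
    using that la by (intro Gi_B_zero(1)[OF v[OF that(1)] Gi_Xh[OF v[OF that(1)]] l]) auto
  from sum_two[OF I, of "\<lambda>i. B l (v i) (v i)", OF this]
  have 2: "(\<Sum>i\<in>?I. B l (v i) (v i)) = B l (z a) (z a) + B l (z l) (z l)"
    using zero_left[OF Xh_zero] by (simp add: z_def)
  have 3: "\<bar>B l (z a) (z l)\<bar> \<le> \<sigma> * (sqrt (B l (z a) (z a)) * sqrt (B l (z l) (z l)))"
  proof (cases "a \<in> ?I \<and> l \<in> ?I")
    case True
    then have "\<bar>B l (z a) (z l)\<bar> \<le> sing_val (S a) 1 * (sqrt (B l (z a) (z a)) * sqrt (B l (z l) (z l)))"
      using layer_bound[of a "v a" "v l"] v la by (simp add: z_def)
    also have "\<dots> \<le> \<sigma> * (sqrt (B l (z a) (z a)) * sqrt (B l (z l) (z l)))"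
      using \<sigma> True nonneg zX by (intro mult_right_mono) auto
    finally show ?thesis .
  next
    case False
    then have "z a = (\<lambda>x. 0) \<or> z l = (\<lambda>x. 0)" by (auto simp: z_def)
    then have "B l (z a) (z l) = 0" using zero_left[OF zX] commute[OF zX Xh_zero] by auto
    then show ?thesis using \<sigma>0 nonneg zX by simp
  qed
  have "2 * (sqrt (B l (z a) (z a)) * sqrt (B l (z l) (z l))) \<le> B l (z a) (z a) + B l (z l) (z l)"
    using sum_squares_bound[of "sqrt (B l (z a) (z a))" "sqrt (B l (z l) (z l))"] nonneg zX
    by (simp add: mult.assoc)
  then have "2 * (\<sigma> * (sqrt (B l (z a) (z a)) * sqrt (B l (z l) (z l)))) \<le> \<sigma> * (B l (z a) (z a) + B l (z l) (z l))"
    using mult_left_mono[OF _ \<sigma>0] by fastforce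
  with 3 have "- (\<sigma> * (B l (z a) (z a) + B l (z l) (z l))) \<le> 2 * B l (z a) (z l)" by linarith
  then show ?thesis unfolding 1 2 by (simp add: algebra_simps)
qed

lemma energy_coercive:
  assumes y: "\<And>j. j \<in> {1..N} \<Longrightarrow> y j > 0" and v: "\<And>i. i \<in> {1..<N} \<Longrightarrow> v i \<in> Gi i"
    and \<sigma>: "\<And>k. k \<in> {1..<N} \<Longrightarrow> sing_val (S k) 1 \<le> \<sigma>" and \<sigma>0: "0 \<le> \<sigma>"
  shows "(1 - \<sigma>) * (\<Sum>i\<in>{1..<N}. energy P y (v i) (v i)) \<le>
    energy P y (\<lambda>x. \<Sum>i\<in>{1..<N}. v i x) (\<lambda>x. \<Sum>i\<in>{1..<N}. v i x)"
proof -
  have "(\<Sum>i\<in>{1..<N}. energy P y (v i) (v i)) = (\<Sum>l\<in>{1..N}. \<Sum>i\<in>{1..<N}. y l * B l (v i) (v i))"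
    unfolding energy_def by (rule sum.swap)
  then have "(1 - \<sigma>) * (\<Sum>i\<in>{1..<N}. energy P y (v i) (v i)) =
      (\<Sum>l\<in>{1..N}. y l * ((1 - \<sigma>) * (\<Sum>i\<in>{1..<N}. B l (v i) (v i))))"
    by (simp add: sum_distrib_left mult_ac)
  also have "\<dots> \<le> (\<Sum>l\<in>{1..N}. y l * B l (\<lambda>x. \<Sum>i\<in>{1..<N}. v i x) (\<lambda>x. \<Sum>i\<in>{1..<N}. v i x))"
    using y by (intro sum_mono mult_left_mono layer_coercive v \<sigma> \<sigma>0) (auto intro: less_imp_le)
  finally show ?thesis by (simp add: energy_def)
qed

section \<open>Splitting an interface function into components\<close>

lemma Gamma_sum:
  assumes "finite I" "\<And>i. i \<in> I \<Longrightarrow> v i \<in> Vh_Gamma P"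
  shows "(\<lambda>x. \<Sum>i\<in>I. v i x) \<in> Vh_Gamma P"
  using assms
proof (induction rule: finite_induct)
  case (insert i I)
  then show ?case using Gamma_lincomb[of "v i" "\<lambda>x. \<Sum>i\<in>I. v i x" 1 1] by simp
qed (simp add: Gamma_zero)

text \<open>The sum of the components with the traces of \<open>u\<close> has the same trace as
  \<open>u\<close> on every interface, the lateral ones included, so uniqueness on each layer
  identifies the two. Outside \<open>Omega P\<close> both vanish.\<close>

lemma Gamma_decomposition:
  assumes u: "u \<in> Vh_Gamma P"
  obtains v where "\<And>i. i \<in> {1..<N} \<Longrightarrow> v i \<in> Gi i" "u = (\<lambda>x. \<Sum>i\<in>{1..<N}. v i x)"
proof -
  let ?I = "{1..<N}"
  have "\<exists>v. i \<in> ?I \<longrightarrow> v \<in> Gi i \<and> (\<forall>x\<in>iface P i. v x = u x)" for i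
  proof (cases "i \<in> ?I")
    case True
    then have i: "1 \<le> i" "i < N" by auto
    obtain v where v: "v \<in> Vh_Gamma P" "\<And>x. x \<in> iface P i \<Longrightarrow> v x = u x"
      "\<And>j x. j \<le> N \<Longrightarrow> j \<noteq> i \<Longrightarrow> x \<in> iface P j \<Longrightarrow> v x = 0"
      using Gamma_exists[OF i Gamma_Xh[OF u]] by blast
    have "v x = 0" if "j \<in> {1..<N}" "j \<noteq> i" "x \<in> iface P j" for j x
      using v(3)[of j x] that by simp
    then have "v \<in> Gi i" using v(1) unfolding Gi_def by blast
    then show ?thesis using v(2) by blast
  next
    case False
    then show ?thesis by blast
  qed
  then obtain v where v: "\<And>i. i \<in> ?I \<Longrightarrow> v i \<in> Gi i" "\<And>i x. i \<in> ?I \<Longrightarrow> x \<in> iface P i \<Longrightarrow> v i x = u x"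
    by metis
  let ?w = "\<lambda>x. \<Sum>i\<in>?I. v i x"
  have w: "?w \<in> Vh_Gamma P" using v(1) Gi_Gamma by (intro Gamma_sum) auto
  have trace: "u x = ?w x" if j: "j \<le> N" and x: "x \<in> iface P j" for j x
  proof (cases "j \<in> ?I")
    case True
    have "?w x = (\<Sum>i\<in>{j}. v i x)"
      using True Gi_iface[OF v(1) j _ x] by (intro sum.mono_neutral_right) auto
    then show ?thesis using v(2)[OF True x] by simp
  next
    case False
    then have "x \<in> iface P 0 \<or> x \<in> iface P N" using j x by (cases "j = 0") auto
    then show ?thesis
      using Vh_lateral[OF Gamma_Vh[OF u]] Vh_lateral[OF Gamma_Vh[OF w]] by simp
  qed
  have "u x = ?w x" for x
  proof (cases "x \<in> Omega P")
    case True
    then obtain l where l: "l \<in> {1..N}" "x \<in> closure (layer P l)"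
      using interior_subset unfolding Omega_def by blast
    then have l1: "1 \<le> l" "l \<le> N" by auto
    show ?thesis
      by (rule harmonic_unique[OF l1 Gamma_harmonic[OF l1 u] Gamma_harmonic[OF l1 w] _ _ l(2)])
        (rule trace; use l1 in auto)+
  next
    case False
    then show ?thesis using conf(4)[OF Gamma_Vh[OF u]] conf(4)[OF Gamma_Vh[OF w]] by simp
  qed
  then show ?thesis using v(1) by (intro that) auto
qed

section \<open>Error of the slow-fast approximation\<close>

lemma approximation_error:
  assumes y: "\<And>j. j \<in> {1..N} \<Longrightarrow> y j > 0"
    and \<sigma>1: "\<And>k. k \<in> {1..<N} \<Longrightarrow> sing_val (S k) 1 \<le> \<sigma>1" "0 \<le> \<sigma>1" "\<sigma>1 < 1"
    and \<sigma>: "\<And>k. k \<in> {1..<N} \<Longrightarrow> sing_val (S k) (r k + 1) \<le> \<sigma>" "0 \<le> \<sigma>"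
    and u: "interface_solution P f y u"
    and w: "\<And>i. i \<in> {1..<N} \<Longrightarrow> fast_solution P r R0 U f i (w i)"
    and us: "slow_solution P r R0 U f y us"
  shows "energy_norm P y (\<lambda>x. u x - approx_solution P y w us x) \<le>
    (real (card {1..<N}))\<^sup>2 * (1 / (1 - \<sigma>1) + 1 / sqrt (1 - \<sigma>1)) * \<sigma> * energy_norm P y u"
proof -
  let ?I = "{1..<N}"
  interpret psd_form "Xh P" "energy P y" by (rule psd_form_energy[OF y])
  have i1: "1 \<le> i" "i < N" "i \<in> {1..N}" "Suc i \<in> {1..N}" if "i \<in> ?I" for i using that by auto
  have uG: "u \<in> Vh_Gamma P" using u by (simp add: interface_solution_def)
  have ueq: "energy P y u v = L2_inner (Omega P) f v" if "v \<in> Vh_Gamma P" for v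
    using u that by (simp add: interface_solution_def)
  obtain v where v: "\<And>i. i \<in> ?I \<Longrightarrow> v i \<in> Gi i" "u = (\<lambda>x. \<Sum>i\<in>?I. v i x)"
    using Gamma_decomposition[OF uG] by blast
  have "\<exists>s f. i \<in> ?I \<longrightarrow> s \<in> slow i \<and> f \<in> fast i \<and> v i = (\<lambda>x. s x + f x)" for i
    using slow_fast_decomposition[OF i1(1,2) v(1)] by metis
  then obtain s g where sg: "\<And>i. i \<in> ?I \<Longrightarrow> s i \<in> slow i" "\<And>i. i \<in> ?I \<Longrightarrow> g i \<in> fast i"
    "\<And>i. i \<in> ?I \<Longrightarrow> v i = (\<lambda>x. s i x + g i x)" by metis
  obtain t where t: "us = (\<lambda>x. \<Sum>i\<in>?I. t i x)" "\<And>i. i \<in> ?I \<Longrightarrow> t i \<in> slow i"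
    using us slow_eq[OF i1(1,2)] unfolding slow_solution_def Vh_slow_def by auto
  have wF: "w i \<in> fast i" if "i \<in> ?I" for i
    using w[OF that] fast_eq[OF i1(1,2)[OF that]] by (simp add: fast_solution_def)
  \<comment> \<open>The parameter factor is absorbed into the fast part, so that the approximation
    becomes a plain sum of fast and slow components.\<close>
  let ?w = "\<lambda>i x. 2 / (y i + y (Suc i)) * w i x"
  have wF': "?w i \<in> fast i" if "i \<in> ?I" for i
    using slow_fast_lincomb(2)[OF i1(1,2)[OF that] wF[OF that] wF[OF that], of "2 / (y i + y (Suc i))" 0] by simp
  have slow_sum: "(\<lambda>x. \<Sum>i\<in>?I. z i x) \<in> Vh_slow P r R0 U" "(\<lambda>x. \<Sum>i\<in>?I. z i x) \<in> Vh_Gamma P"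
    if "\<And>i. i \<in> ?I \<Longrightarrow> z i \<in> slow i" for z
  proof -
    show "(\<lambda>x. \<Sum>i\<in>?I. z i x) \<in> Vh_slow P r R0 U"
      unfolding Vh_slow_def mem_Collect_eq using that slow_eq[OF i1(1,2)] by (intro exI[of _ z]) auto
    show "(\<lambda>x. \<Sum>i\<in>?I. z i x) \<in> Vh_Gamma P"
      using that by (intro Gamma_sum Gi_Gamma[OF slow_Gi]) auto
  qed
  have "sqrt (energy P y (\<lambda>x. u x - ((\<Sum>i\<in>?I. ?w i x) + (\<Sum>i\<in>?I. t i x)))
      (\<lambda>x. u x - ((\<Sum>i\<in>?I. ?w i x) + (\<Sum>i\<in>?I. t i x)))) \<le>
    (real (card ?I))\<^sup>2 * (1 / (1 - \<sigma>1) + 1 / sqrt (1 - \<sigma>1)) * \<sigma> * sqrt (energy P y u u)"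
  proof (rule slow_fast_estimate[where S = slow and F = fast and W = Gi and s = s and f = g and t = t and w = ?w])
    show "finite ?I" by simp
    show "s i \<in> slow i" "t i \<in> slow i" "g i \<in> fast i" "?w i \<in> fast i" if "i \<in> ?I" for i
      using that sg t(2) wF' by auto
    show "(\<lambda>x. p x - q x) \<in> slow i" if "i \<in> ?I" "p \<in> slow i" "q \<in> slow i" for i p q
      using slow_fast_lincomb(1)[OF i1(1,2)[OF that(1)] that(2,3), of 1 "-1"] by simp
    show "(\<lambda>x. p x - q x) \<in> fast i" if "i \<in> ?I" "p \<in> fast i" "q \<in> fast i" for i p q
      using slow_fast_lincomb(2)[OF i1(1,2)[OF that(1)] that(2,3), of 1 "-1"] by simp
    show "(\<lambda>x. p x + q x) \<in> Gi i" if "p \<in> slow i" "q \<in> fast i" for i p q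
      using Gi_lincomb[OF slow_Gi[OF that(1)] fast_Gi[OF that(2)], of 1 1] by simp
    show "slow i \<subseteq> Gi i" "Gi i \<subseteq> Xh P" "fast i \<subseteq> Xh P" for i
      using slow_Gi fast_Gi Gi_Xh by blast+
    show "energy P y p q = 0" if "i \<in> ?I" "p \<in> slow i" "q \<in> fast i" for i p q
      using energy_same(1)[OF i1(1,2)[OF that(1)] slow_Gi[OF that(2)] fast_Gi[OF that(3)]]
        slow_fast_orthogonal(1)[OF i1(1,2)[OF that(1)] that(2,3)] by simp
    show "\<bar>energy P y p q\<bar> \<le> \<sigma> * sqrt (energy P y p p) * sqrt (energy P y q q)"
      if "i \<in> ?I" "j \<in> ?I" "i \<noteq> j" "p \<in> Gi i" "q \<in> fast j" for i j p q
      by (rule energy_cross[OF y \<sigma>(1) that])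
    show "0 \<le> \<sigma>" "0 < 1 - \<sigma>1" using \<sigma>(2) \<sigma>1(3) by auto
    show "(1 - \<sigma>1) * (\<Sum>i\<in>?I. energy P y (z i) (z i)) \<le>
        energy P y (\<lambda>x. \<Sum>i\<in>?I. z i x) (\<lambda>x. \<Sum>i\<in>?I. z i x)" if "\<And>i. i \<in> ?I \<Longrightarrow> z i \<in> Gi i" for z
      by (rule energy_coercive[OF y that \<sigma>1(1,2)])
    show "u = (\<lambda>x. \<Sum>i\<in>?I. s i x + g i x)" using v(2) sg(3) by simp
    show "energy P y u q = energy P y (?w i) q" if i: "i \<in> ?I" and q: "q \<in> fast i" for i q
    proof -
      \<comment> \<open>The factor cancels the weights, so the parameter-free equation for
        \<open>w i\<close> becomes the fast Galerkin equation of the energy form.\<close>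
      have "y i + y (Suc i) > 0" using y[OF i1(3)[OF i]] y[OF i1(4)[OF i]] by simp
      moreover have "energy P y (?w i) q = 2 / (y i + y (Suc i)) * energy P y (w i) q"
        by (intro scale_left Gi_Xh[OF fast_Gi[OF wF[OF i]]] Gi_Xh[OF fast_Gi[OF q]])
      ultimately have "energy P y (?w i) q = grad_inner (Omega P) (w i) q"
        using energy_same[OF i1(1,2)[OF i] fast_Gi[OF wF[OF i]] fast_Gi[OF q]] by simp
      also have "\<dots> = L2_inner (Omega P) f q"
        using w[OF i] q fast_eq[OF i1(1,2)[OF i]] by (simp add: fast_solution_def)
      finally show ?thesis using ueq[OF Gi_Gamma[OF fast_Gi[OF q]]] by simp
    qed
    show "energy P y u (\<lambda>x. \<Sum>i\<in>?I. z i x) = energy P y (\<lambda>x. \<Sum>i\<in>?I. t i x) (\<lambda>x. \<Sum>i\<in>?I. z i x)"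
      if "\<And>i. i \<in> ?I \<Longrightarrow> z i \<in> slow i" for z
      using us ueq[OF slow_sum(2)[OF that]] slow_sum(1)[OF that] t(1) by (simp add: slow_solution_def)
  qed (rule refl)
  then show ?thesis by (simp add: energy_norm_def approx_solution_def t(1))
qed

end

theorem theorem5p1:
  fixes N :: nat and m M \<sigma>1 :: real
  assumes "N \<ge> 2" and "m > 0" and "M > 0" and "\<sigma>1 < 1"
  shows "\<exists>\<epsilon>>0. \<exists>C. \<forall>(P :: layered_fem) (D :: (nat \<Rightarrow> real) set) (f :: plane \<Rightarrow> real)
      (r :: nat \<Rightarrow> nat) R0 R1 U S V \<sigma>r u wfast us.
    layers P = N \<longrightarrow> geometry P \<longrightarrow> fe_space P \<longrightarrow> trace_bases P \<longrightarrow>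
    (\<forall>y\<in>D. \<forall>i\<in>{1..N}. m < y i \<and> y i < M) \<longrightarrow>
    L2_on (Omega P) f \<longrightarrow>
    svd_data P R0 R1 U S V \<longrightarrow>
    \<sigma>1 = Max ((\<lambda>i. sing_val (S i) 1) ` {1..N - 1}) \<longrightarrow>
    \<sigma>r = Max ((\<lambda>i. sing_val (S i) (r i + 1)) ` {1..N - 1}) \<longrightarrow>
    \<sigma>r < \<epsilon> \<longrightarrow>
    (\<forall>y\<in>D. interface_solution P f y (u y)) \<longrightarrow>
    (\<forall>i\<in>{1..N - 1}. fast_solution P r R0 U f i (wfast i)) \<longrightarrow>
    (\<forall>y\<in>D. slow_solution P r R0 U f y (us y)) \<longrightarrow>
    (\<forall>y\<in>D. energy_norm P y (\<lambda>x. u y x - approx_solution P y wfast (us y) x)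
        \<le> C * \<sigma>r * energy_norm P y (u y))"
proof (intro exI conjI allI impI ballI)
  show "(0 :: real) < 1" by simp
  fix P :: layered_fem and D :: "(nat \<Rightarrow> real) set" and f :: "plane \<Rightarrow> real" and r :: "nat \<Rightarrow> nat"
    and R0 R1 U S V :: "nat \<Rightarrow> real Matrix.mat" and \<sigma>r :: real and u wfast us y
  assume P: "layers P = N" "geometry P" "fe_space P" "trace_bases P"
    and D: "\<forall>y\<in>D. \<forall>i\<in>{1..N}. m < y i \<and> y i < M"
    and svd: "svd_data P R0 R1 U S V"
    and \<sigma>1: "\<sigma>1 = Max ((\<lambda>i. sing_val (S i) 1) ` {1..N - 1})"
    and \<sigma>r: "\<sigma>r = Max ((\<lambda>i. sing_val (S i) (r i + 1)) ` {1..N - 1})"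
    and u: "\<forall>y\<in>D. interface_solution P f y (u y)"
    and wfast: "\<forall>i\<in>{1..N - 1}. fast_solution P r R0 U f i (wfast i)"
    and us: "\<forall>y\<in>D. slow_solution P r R0 U f y (us y)"
    and y: "y \<in> D"
  interpret layered_svd P R0 R1 U S V r
    using P svd assms(1) by unfold_locales auto
  have I: "{1..N - 1} = {1..<layers P}" and ne: "1 \<in> {1..N - 1}" using assms(1) P(1) by auto
  have s1: "sing_val (S k) 1 \<le> \<sigma>1" and sr: "sing_val (S k) (r k + 1) \<le> \<sigma>r" if "k \<in> {1..<layers P}" for k
    unfolding \<sigma>1 \<sigma>r using that unfolding I by (auto intro!: Max_ge)
  have 1: "1 \<le> (1 :: nat)" "1 < layers P" and 1: "1 \<in> {1..<layers P}" using assms(1) P(1) by auto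
  \<comment> \<open>Interface 1 exists because N \<ge> 2, and its nonnegative singular values bound
    both maxima from below.\<close>
  have pos: "0 \<le> \<sigma>1" "0 \<le> \<sigma>r"
    using s1[OF 1] sr[OF 1] sing_val_nonneg[of 1] 1 by (auto intro: order_trans)
  have "energy_norm P y (\<lambda>x. u y x - approx_solution P y wfast (us y) x)
      \<le> (real (card {1..<layers P}))\<^sup>2 * (1 / (1 - \<sigma>1) + 1 / sqrt (1 - \<sigma>1)) * \<sigma>r * energy_norm P y (u y)"
  proof (rule approximation_error)
    show "0 < y j" if "j \<in> {1..layers P}" for j
    proof -
      have "m < y j" using D y that unfolding P(1) by blast
      then show ?thesis using assms(2) by linarith
    qed
    show "interface_solution P f y (u y)" "slow_solution P r R0 U f y (us y)"
      using u us y by blast+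
    show "fast_solution P r R0 U f i (wfast i)" if "i \<in> {1..<layers P}" for i
      using wfast that unfolding I by blast
  qed (use s1 sr pos assms(4) in blast)+
  \<comment> \<open>The witness for \<open>C\<close> is fixed here. It is built from
    \<open>N\<close> and \<sigma>1 alone, so it may precede the choice of the problem, the
    truncation indices and the parameter.\<close>
  then show "energy_norm P y (\<lambda>x. u y x - approx_solution P y wfast (us y) x)
      \<le> (real (card {1..<N}))\<^sup>2 * (1 / (1 - \<sigma>1) + 1 / sqrt (1 - \<sigma>1)) * \<sigma>r * energy_norm P y (u y)"
    unfolding P(1) .
qed

end
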